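(* Let $(f_m)_{m\in\mathbb{N}}$ be a sequence of functions $f_m\in S$ with Taylor expansions $f_m(z)=\sum_{n=1}^{\infty}a_n^{(m)}z^n$, and let $\epsilon>0$ be arbitrary. Suppose that (i) $(f_m)$ converges locally uniformly in $\mathbb{D}$ to a function $f\in S$ as $m\to\infty$; (ii) $\alpha_m\to\alpha$ as $m\to\infty$, where $\alpha_m$ and $\alpha$ denote the Hayman indexes of $f_m$ and $f$ respectively. Then there exists a constant $N(\epsilon)$, depending only on $\epsilon$ (for the given sequence), such that \[ \frac{|a_n^{(m)}|}{n}<\epsilon+\sqrt{\alpha_m} \] whenever $m,n>N(\epsilon)$.
   Context: $\mathbb{D}$ is the open unit disk and $S$ is the class of schlicht functions, i.e. functions $f(z)=z+\sum_{n\ge2}a_nz^n$ analytic and univalent in $\mathbb{D}$. For $f\in S$ let $M_\infty(r,f)=\max\{|f(z)|:|z|=r\}$; the Hayman index of $f$ is $\alpha(f)=\lim_{r\to1^-}(1-r)^2M_\infty(r,f)$, which exists and satisfies $0\le\alpha(f)\le1$. *)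

theory Defs
  imports "HOL-Complex_Analysis.Complex_Analysis"
begin

definition schlicht :: "(complex \<Rightarrow> complex) \<Rightarrow> bool" where
  "schlicht f \<longleftrightarrow> f holomorphic_on ball 0 1 \<and> inj_on f (ball 0 1) \<and> f 0 = 0 \<and> deriv f 0 = 1"

definition taylor_coeff :: "(complex \<Rightarrow> complex) \<Rightarrow> nat \<Rightarrow> complex" where
  "taylor_coeff f n = (deriv ^^ n) f 0 / of_nat (fact n)"

definition max_modulus :: "real \<Rightarrow> (complex \<Rightarrow> complex) \<Rightarrow> real" where
  "max_modulus r f = Sup ((\<lambda>z. norm (f z)) ` sphere 0 r)"

definition hayman_index :: "(complex \<Rightarrow> complex) \<Rightarrow> real" where
  "hayman_index f = Lim (at_left 1) (\<lambda>r. (1 - r)^2 * max_modulus r f)"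

end

theory Submission
  imports Defs
begin

text \<open>
  Write \<open>log (f z / z) = \<Sum> 2 \<gamma>\<^sub>k z\<^sup>k\<close>. By the second Lebedev-Milin inequality \<open>|a\<^sub>n| / n\<close> is at most
  \<open>exp (\<Sum> (1 - k/n) (k |\<gamma>\<^sub>k|\<^sup>2 - 1/k))\<close>, so it suffices to bound this Milin functional by
  \<open>ln \<alpha> / 2 + o(1)\<close>, uniformly in the family. Put \<open>\<delta>\<^sub>k = u\<^sup>k \<gamma>\<^sub>k - 1/k\<close> with \<open>u\<close> a direction of maximal growth.
  Bazilevich's inequality gives \<open>\<Sum> k |\<delta>\<^sub>k|\<^sup>2 \<le> ln (1/\<alpha>) / 2\<close>, while \<open>\<Sum> 2 Re \<delta>\<^sub>k r\<^sup>k\<close> is the logarithm of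
  \<open>|f (r u)| (1 - r)\<^sup>2 / r\<close>, which decreases to \<open>\<alpha>\<close>; a Tauberian estimate transfers this to Fejer means. Uniformity
  in \<open>m\<close> comes from the monotonicity of \<open>(1 - r)\<^sup>2 M(r, f) / r\<close>, exactly as in Dini's theorem. If \<open>\<alpha> = 0\<close>, the area bound
  \<open>2 \<Sum> k |\<gamma>\<^sub>k|\<^sup>2 r\<^sup>2\<^sup>k \<le> ln (M(r, f) / r)\<close> with \<open>r = exp (- 1 / (2 n))\<close> already suffices.

  Both Bazilevich's inequality and the distortion theorem follow from one area argument. If
  \<open>g = (f - f p) / (f - f q)\<close> and \<open>k\<close> maps the disc onto a slit plane with the same zero \<open>p\<close> and pole \<open>q\<close>, then in
  the coordinate \<open>t = log k\<close> the function \<open>log g = t + W t\<close> is univalent, and its logarithmic area is at most that of an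
  annulus. Expanding \<open>|1 + W'|\<^sup>2\<close>, the cross term is evaluated along the lines that do not meet the slit: horizontal
  ones for a radial slit (Bazilevich), vertical ones for a circular slit (distortion).
\<close>

subsection \<open>Planar Lebesgue measure and holomorphic change of variables\<close>

text \<open>Since \<open>g\<close> and \<open>k\<close> share the simple zero \<open>p\<close> and
  the simple pole \<open>q\<close>, the logarithm \<open>F\<close> of \<open>g / k\<close> is
  holomorphic across both points, and \<open>W\<close> is \<open>F\<close> read in the coordinate
  \<open>t\<close>. Cut the t-plane down to a < Re t < b: near \<open>p\<close> and \<open>q\<close>
  the modulus of \<open>g\<close> is that of \<open>exp t\<close> times
  \<open>exp (Re (F p))\<close> or \<open>exp (Re (F q))\<close>, so the image lies in an annulus of
  logarithmic width about b - a + Re (F q) - Re (F p). The divergent part b - a is also the width of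
  the cut strip; it cancels, and only the difference of the two values of \<open>F\<close> survives.
  For distortion, p and q are s and -s, applied to the odd square root transform; for Bazilevich, p
  = 0 and q is a point of maximal modulus on a circle whose radius tends to 1.

  Areas are integrals in [0, \<infinity>], so that finiteness of the Dirichlet integral is a
  conclusion and not an assumption.

  The separate treatment of \<alpha> = 0 is forced: the Tauberian threshold depends on the Dirichlet
  bound ln (1/\<alpha>) / 2, which is common to all large m only if the indices stay away from
  0.\<close>

text \<open>The change of variables theorem of HOL-Analysis is only available on \<open>real ^ 'n\<close>.\<close>

definition vec_cplx :: "real^2 \<Rightarrow> complex" where "vec_cplx v = Complex (v$1) (v$2)"
definition cplx_vec :: "complex \<Rightarrow> real^2" where "cplx_vec z = vector [Re z, Im z]"

lemma vec_cplx_inverse [simp]: "vec_cplx (cplx_vec z) = z" "cplx_vec (vec_cplx v) = v"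
  by (auto simp: vec_cplx_def cplx_vec_def vec_eq_iff forall_2 complex_eq_iff)

lemma linear_vec_cplx: "linear vec_cplx"
  by (auto simp: vec_cplx_def linear_iff complex_eq_iff)

lemma linear_cplx_vec: "linear cplx_vec"
  by (auto simp: cplx_vec_def linear_iff vec_eq_iff forall_2)

lemma continuous_vec_cplx [continuous_intros]: "continuous_on S vec_cplx"
  using linear_vec_cplx by (simp add: linear_continuous_on linear_conv_bounded_linear)

lemma continuous_cplx_vec [continuous_intros]: "continuous_on S cplx_vec"
  using linear_cplx_vec by (simp add: linear_continuous_on linear_conv_bounded_linear)

lemma measurable_vec_cplx [measurable]: "vec_cplx \<in> borel_measurable borel"
  by (intro borel_measurable_continuous_onI continuous_intros)

lemma Basis_real2: "(Basis :: (real^2) set) = {axis 1 1, axis 2 1}"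
  by (auto simp: Basis_vec_def UNIV_2)

lemma lborel_vec_cplx: "distr lborel borel vec_cplx = lborel"
proof (rule lborel_eqI[symmetric])
  fix l u :: complex
  assume le: "\<And>b. b \<in> Basis \<Longrightarrow> l \<bullet> b \<le> u \<bullet> b"
  have eq: "vec_cplx -` box l u = box (cplx_vec l) (cplx_vec u)"
    by (auto simp: mem_box_cart in_box_complex_iff vec_cplx_def cplx_vec_def forall_2)
  have le': "Re l \<le> Re u" "Im l \<le> Im u"
    using le[of 1] le[of \<i>] by (auto simp: Basis_complex_def)
  have "emeasure (distr lborel borel vec_cplx) (box l u) = emeasure lborel (box (cplx_vec l) (cplx_vec u))"
    by (subst emeasure_distr) (auto simp: eq)
  also have "\<dots> = ennreal (\<Prod>b\<in>Basis. (cplx_vec u - cplx_vec l) \<bullet> b)"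
    by (rule emeasure_lborel_box) (use le' in \<open>auto simp: Basis_real2 inner_axis cplx_vec_def\<close>)
  also have "(\<Prod>b\<in>Basis. (cplx_vec u - cplx_vec l) \<bullet> b) = (\<Prod>b\<in>Basis. (u-l) \<bullet> b)"
    by (simp add: Basis_real2 axis_eq_axis Basis_complex_def inner_axis cplx_vec_def)
  finally show "emeasure (distr lborel borel vec_cplx) (box l u) = ennreal (\<Prod>b\<in>Basis. (u-l) \<bullet> b)" .
qed simp

lemma nn_integral_distr_vec_cplx:
  fixes f :: "complex \<Rightarrow> ennreal"
  assumes "f \<in> borel_measurable borel"
  shows "(\<integral>\<^sup>+x. f x \<partial>(distr lborel borel vec_cplx)) = (\<integral>\<^sup>+v. f (vec_cplx v) \<partial>lborel)"
  by (rule nn_integral_distr) (use assms in simp_all)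

lemma measurable_Complex_pair [measurable]: "(\<lambda>(x,y). Complex x y) \<in> borel_measurable (borel \<Otimes>\<^sub>M borel)"
proof -
  have "(\<lambda>(x,y). Complex x y) = (\<lambda>p. of_real (fst p) + \<i> * of_real (snd p))"
    by (auto simp: fun_eq_iff complex_eq_iff)
  thus ?thesis by simp
qed

lemma lborel_complex_pair: "distr (lborel \<Otimes>\<^sub>M lborel) borel (\<lambda>(x,y). Complex x y) = lborel"
proof (rule lborel_eqI[symmetric])
  fix l u :: complex
  assume le: "\<And>b. b \<in> Basis \<Longrightarrow> l \<bullet> b \<le> u \<bullet> b"
  have eq: "(\<lambda>(x,y). Complex x y) -` box l u = {Re l<..<Re u} \<times> {Im l<..<Im u}"
    by (auto simp: box_def Basis_complex_def)
  have le': "Re l \<le> Re u" "Im l \<le> Im u"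
    using le[of 1] le[of \<i>] by (auto simp: Basis_complex_def)
  have "emeasure (distr (lborel \<Otimes>\<^sub>M lborel) borel (\<lambda>(x,y). Complex x y)) (box l u)
      = emeasure (lborel \<Otimes>\<^sub>M lborel) ({Re l<..<Re u} \<times> {Im l<..<Im u})"
    by (subst emeasure_distr) (auto simp: eq space_pair_measure)
  also have "\<dots> = ennreal (Re u - Re l) * ennreal (Im u - Im l)"
    by (subst lborel.emeasure_pair_measure_Times) (use le' in auto)
  also have "\<dots> = ennreal (\<Prod>b\<in>Basis. (u-l) \<bullet> b)"
    using le' by (simp add: Basis_complex_def ennreal_mult)
  finally show "emeasure (distr (lborel \<Otimes>\<^sub>M lborel) borel (\<lambda>(x,y). Complex x y)) (box l u) = ennreal (\<Prod>b\<in>Basis. (u-l) \<bullet> b)" .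
qed simp

lemma nn_integral_complex_Re_Im:
  assumes [measurable]: "v \<in> borel_measurable borel"
  shows "(\<integral>\<^sup>+t. v t \<partial>lborel) = (\<integral>\<^sup>+x. \<integral>\<^sup>+y. v (Complex x y) \<partial>lborel \<partial>lborel)"
proof -
  have "(\<integral>\<^sup>+t. v t \<partial>lborel) = (\<integral>\<^sup>+p. v (case p of (x,y) \<Rightarrow> Complex x y) \<partial>(lborel \<Otimes>\<^sub>M lborel))"
    by (subst lborel_complex_pair[symmetric], subst nn_integral_distr) auto
  also have "\<dots> = (\<integral>\<^sup>+x. \<integral>\<^sup>+y. v (Complex x y) \<partial>lborel \<partial>lborel)"
    by (subst lborel.nn_integral_fst[symmetric]) (auto simp: case_prod_unfold)
  finally show ?thesis .
qed

lemma nn_integral_complex_Im_Re: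
  assumes [measurable]: "v \<in> borel_measurable borel"
  shows "(\<integral>\<^sup>+t. v t \<partial>lborel) = (\<integral>\<^sup>+y. \<integral>\<^sup>+x. v (Complex x y) \<partial>lborel \<partial>lborel)"
proof -
  have *: "(\<lambda>(x,y). v (Complex x y)) \<in> borel_measurable (lborel \<Otimes>\<^sub>M lborel)"
  proof -
    have "(\<lambda>(x,y). v (Complex x y)) = v \<circ> (\<lambda>(x,y). Complex x y)" by auto
    thus ?thesis by simp
  qed
  show ?thesis
    unfolding nn_integral_complex_Re_Im[OF assms] 
    using lborel_pair.Fubini'[OF *] by simp
qed

lemma borel_measurable_open_indicator:
  fixes f :: "'a::euclidean_space \<Rightarrow> real"
  assumes "open S" "continuous_on S f"
  shows "(\<lambda>t. ennreal (f t) * indicator S t) \<in> borel_measurable borel"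
proof -
  have "(\<lambda>t. ennreal (indicator S t *\<^sub>R f t)) \<in> borel_measurable borel"
    using assms by (intro measurable_compose[OF _ measurable_ennreal] borel_measurable_continuous_on_indicator) auto
  also have "(\<lambda>t. ennreal (indicator S t *\<^sub>R f t)) = (\<lambda>t. ennreal (f t) * indicator S t)"
    by (auto simp: indicator_def)
  finally show ?thesis .
qed

lemma abs_integrable_iff_nn:
  fixes u :: "'a::euclidean_space \<Rightarrow> real"
  assumes "open S" "continuous_on S u" "\<And>x. x \<in> S \<Longrightarrow> u x \<ge> 0"
  shows "u absolutely_integrable_on S \<longleftrightarrow> (\<integral>\<^sup>+x. ennreal (u x) * indicator S x \<partial>lborel) < \<infinity>"
proof -
  have m: "(\<lambda>x. indicator S x *\<^sub>R u x) \<in> borel_measurable borel"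
    using assms by (intro borel_measurable_continuous_on_indicator) auto
  have "(\<integral>\<^sup>+x. ennreal (norm (indicator S x *\<^sub>R u x)) \<partial>lebesgue) = (\<integral>\<^sup>+x. ennreal (norm (indicator S x *\<^sub>R u x)) \<partial>lborel)"
    by (rule nn_integral_completion)
  also have "\<dots> = (\<integral>\<^sup>+x. ennreal (u x) * indicator S x \<partial>lborel)"
    by (intro nn_integral_cong) (use assms in \<open>auto simp: indicator_def\<close>)
  finally show ?thesis
    unfolding set_integrable_def integrable_iff_bounded
    using m by (auto simp: measurable_completion)
qed

lemma abs_integrable_nn_eq:
  fixes u :: "'a::euclidean_space \<Rightarrow> real"
  assumes "u absolutely_integrable_on S" "\<And>x. x \<in> S \<Longrightarrow> u x \<ge> 0"
  shows "(\<integral>\<^sup>+x. ennreal (u x) * indicator S x \<partial>lborel) = ennreal (integral S u)"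
  using assms by (intro nn_integral_has_integral_lebesgue')
    (auto simp: has_integral_integral absolutely_integrable_on_def)

text \<open>Working in [0, \<infinity>] makes a case of infinite integrals possible: absolute
  integrability of \<open>u\<close> and of its pullback are equivalent, and when both fail both
  sides are infinite. The Jacobian is passed as a continuous function \<open>J\<close>, because
  continuity makes the pulled-back integrand measurable.\<close>

lemma nn_integral_image_real2:
  fixes g :: "real^2 \<Rightarrow> real^2" and u :: "real^2 \<Rightarrow> real"
  assumes S: "open S" and gS: "open (g ` S)"
    and der: "\<And>x. x \<in> S \<Longrightarrow> (g has_derivative g' x) (at x)"
    and inj: "inj_on g S"
    and u: "continuous_on (g ` S) u" "\<And>x. x \<in> g ` S \<Longrightarrow> u x \<ge> 0"
    and J: "continuous_on S J" "\<And>x. x \<in> S \<Longrightarrow> \<bar>det (matrix (g' x))\<bar> = J x"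
  shows "(\<integral>\<^sup>+x. ennreal (u x) * indicator (g ` S) x \<partial>lborel) = (\<integral>\<^sup>+x. ennreal (J x * u (g x)) * indicator S x \<partial>lborel)"
proof -
  have cg: "continuous_on S g"
    using der by (meson continuous_at_imp_continuous_on has_derivative_continuous)
  have c2: "continuous_on S (\<lambda>x. J x * u (g x))"
    by (intro continuous_intros J continuous_on_compose2[OF u(1) cg]) auto
  have n2: "J x * u (g x) \<ge> 0" if "x \<in> S" for x
    using J(2)[OF that, symmetric] u(2)[of "g x"] that by simp
  have cv: "(\<lambda>x. J x * u (g x)) absolutely_integrable_on S \<and> integral S (\<lambda>x. J x * u (g x)) = b
     \<longleftrightarrow> u absolutely_integrable_on (g ` S) \<and> integral (g ` S) u = b" for b
  proof -
    have sw: "(\<lambda>x. \<bar>det (matrix (g' x))\<bar> * u (g x)) absolutely_integrable_on S \<longleftrightarrow>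
      (\<lambda>x. J x * u (g x)) absolutely_integrable_on S"
      by (intro set_integrable_cong) (auto simp: J(2))
    have sw2: "integral S (\<lambda>x. \<bar>det (matrix (g' x))\<bar> * u (g x)) = integral S (\<lambda>x. J x * u (g x))"
      by (intro integral_cong) (auto simp: J(2))
    have 1: "(\<lambda>x. \<bar>det (matrix (g' x))\<bar> *\<^sub>R (vec (u (g x)) :: real^1)) absolutely_integrable_on S \<and>
           integral S (\<lambda>x. \<bar>det (matrix (g' x))\<bar> *\<^sub>R (vec (u (g x)) :: real^1)) = vec b
     \<longleftrightarrow> (\<lambda>x. vec (u x)::real^1) absolutely_integrable_on (g ` S) \<and> integral (g ` S) (\<lambda>x. vec (u x)::real^1) = vec b"
      by (rule has_absolute_integral_change_of_variables)
         (use S inj der in \<open>auto intro: has_derivative_at_withinI\<close>)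
    show ?thesis
      using 1 unfolding absolutely_integrable_on_1_iff integral_on_1_eq
      by (simp add: vec_eq_iff sw sw2)
  qed
  show ?thesis
  proof (cases "u absolutely_integrable_on (g ` S)")
    case True
    hence "(\<lambda>x. J x * u (g x)) absolutely_integrable_on S \<and> integral S (\<lambda>x. J x * u (g x)) = integral (g ` S) u"
      using cv by blast
    thus ?thesis
      using abs_integrable_nn_eq[OF True u(2)] abs_integrable_nn_eq[where S = S and u = "\<lambda>x. J x * u (g x)"] n2 by simp
  next
    case False
    hence "\<not> (\<lambda>x. J x * u (g x)) absolutely_integrable_on S" using cv by blast
    hence "(\<integral>\<^sup>+x. ennreal (J x * u (g x)) * indicator S x \<partial>lborel) = \<infinity>"
      using abs_integrable_iff_nn[OF S c2] n2 by (simp add: less_top[symmetric])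
    moreover have "(\<integral>\<^sup>+x. ennreal (u x) * indicator (g ` S) x \<partial>lborel) = \<infinity>"
      using False abs_integrable_iff_nn[OF gS u] by (simp add: less_top[symmetric])
    ultimately show ?thesis by simp
  qed
qed

lemma nn_integral_image_holomorphic:
  fixes Y :: "complex \<Rightarrow> complex" and u :: "complex \<Rightarrow> real"
  assumes X: "open X" and hol: "Y holomorphic_on X" and inj: "inj_on Y X"
    and u: "continuous_on (Y ` X) u" "\<And>x. x \<in> Y ` X \<Longrightarrow> u x \<ge> 0"
  shows "(\<integral>\<^sup>+x. ennreal (u x) * indicator (Y ` X) x \<partial>lborel)
       = (\<integral>\<^sup>+x. ennreal ((cmod (deriv Y x))\<^sup>2 * u (Y x)) * indicator X x \<partial>lborel)"
proof -
  let ?g = "cplx_vec \<circ> Y \<circ> vec_cplx"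
  let ?S = "vec_cplx -` X"
  have oYX: "open (Y ` X)" using open_mapping_thm3[OF hol X inj] .
  have img: "?g ` ?S = vec_cplx -` (Y ` X)"
  proof (rule set_eqI, rule iffI)
    fix v assume "v \<in> vec_cplx -` (Y ` X)"
    then obtain x where "x \<in> X" "vec_cplx v = Y x" by auto
    have "cplx_vec (vec_cplx v) = cplx_vec (Y x)" using \<open>vec_cplx v = Y x\<close> by (rule arg_cong)
    hence "v = ?g (cplx_vec x)" "cplx_vec x \<in> ?S"
      using \<open>x \<in> X\<close> by simp_all
    thus "v \<in> ?g ` ?S" by blast
  qed auto
  have S: "open ?S" "open (?g ` ?S)"
    using X oYX unfolding img by (auto intro!: continuous_open_vimage continuous_intros)
  have bl: "bounded_linear vec_cplx" "bounded_linear cplx_vec"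
    using linear_vec_cplx linear_cplx_vec by (auto simp: linear_conv_bounded_linear)
  have der: "(?g has_derivative (\<lambda>h. cplx_vec (deriv Y (vec_cplx v) * vec_cplx h))) (at v)" if "v \<in> ?S" for v
  proof -
    have "(Y has_derivative (\<lambda>h. deriv Y (vec_cplx v) * h)) (at (vec_cplx v))"
      using hol X that holomorphic_derivI[OF hol X, of "vec_cplx v"]
      by (auto simp: has_field_derivative_def)
    from diff_chain_at[OF bounded_linear_imp_has_derivative[OF bl(1)] this]
    have "(Y \<circ> vec_cplx has_derivative (\<lambda>h. deriv Y (vec_cplx v) * h) \<circ> vec_cplx) (at v)" .
    from diff_chain_at[OF this bounded_linear_imp_has_derivative[OF bl(2)]]
    have "(cplx_vec \<circ> (Y \<circ> vec_cplx) has_derivative cplx_vec \<circ> ((\<lambda>h. deriv Y (vec_cplx v) * h) \<circ> vec_cplx)) (at v)" .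
    thus ?thesis by (simp add: o_def)
  qed
  \<comment> \<open>Multiplication by \<open>d\<close> is a rotation combined with a dilation by
    \<open>cmod d\<close>.\<close>
  have det: "\<bar>det (matrix (\<lambda>h. cplx_vec (d * vec_cplx h)))\<bar> = (cmod d)\<^sup>2" for d
    unfolding cmod_power2 by (simp add: det_2 matrix_def cplx_vec_def vec_cplx_def axis_def power2_eq_square)
  have inj': "inj_on ?g ?S"
  proof (rule inj_onI)
    fix v w assume vw: "v \<in> ?S" "w \<in> ?S" and "?g v = ?g w"
    hence "vec_cplx (?g v) = vec_cplx (?g w)" by simp
    hence "Y (vec_cplx v) = Y (vec_cplx w)" by simp
    hence "vec_cplx v = vec_cplx w" using vw inj by (auto dest: inj_onD)
    hence "cplx_vec (vec_cplx v) = cplx_vec (vec_cplx w)" by (rule arg_cong)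
    thus "v = w" by simp
  qed
  have cderiv: "continuous_on ?S (\<lambda>v. (cmod (deriv Y (vec_cplx v)))\<^sup>2)"
    using holomorphic_on_imp_continuous_on[OF holomorphic_deriv[OF hol X]]
    by (intro continuous_intros continuous_on_compose2[of X "deriv Y" _ vec_cplx]) auto
  have cu: "continuous_on (?g ` ?S) (\<lambda>v. u (vec_cplx v))"
    unfolding img by (intro continuous_on_compose2[OF u(1)] continuous_intros) auto
  have m1: "(\<lambda>x. ennreal (u x) * indicator (Y ` X) x) \<in> borel_measurable borel"
    by (rule borel_measurable_open_indicator[OF oYX u(1)])
  have m2: "(\<lambda>x. ennreal ((cmod (deriv Y x))\<^sup>2 * u (Y x)) * indicator X x) \<in> borel_measurable borel"
  proof -
    have c: "continuous_on X (\<lambda>x. (cmod (deriv Y x))\<^sup>2 * u (Y x))"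
      using holomorphic_on_imp_continuous_on[OF holomorphic_deriv[OF hol X]]
        holomorphic_on_imp_continuous_on[OF hol]
      by (intro continuous_intros continuous_on_compose2[OF u(1)]) auto
    show ?thesis by (rule borel_measurable_open_indicator[OF X c])
  qed
  have "(\<integral>\<^sup>+x. ennreal (u x) * indicator (Y ` X) x \<partial>lborel) = 
     (\<integral>\<^sup>+x. ennreal (u x) * indicator (Y ` X) x \<partial>(distr lborel borel vec_cplx))"
    by (simp add: lborel_vec_cplx)
  also have "\<dots> = (\<integral>\<^sup>+v. ennreal (u (vec_cplx v)) * indicator (?g ` ?S) v \<partial>lborel)"
  proof -
    have "indicator (vec_cplx -` (Y ` X)) v = (indicator (Y ` X) (vec_cplx v) :: ennreal)" for v
      by (simp add: indicator_def)
    thus ?thesis unfolding img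
      by (subst nn_integral_distr_vec_cplx[OF m1]) (simp only:)
  qed
  also have "\<dots> = (\<integral>\<^sup>+v. ennreal ((cmod (deriv Y (vec_cplx v)))\<^sup>2 * u (vec_cplx (?g v))) * indicator ?S v \<partial>lborel)"
  proof (rule nn_integral_image_real2[OF S der inj' cu _ cderiv])
    show "0 \<le> u (vec_cplx x)" if "x \<in> ?g ` ?S" for x
      using u(2) that unfolding img by auto
  qed (assumption | rule det)+
  also have "\<dots> = (\<integral>\<^sup>+x. ennreal ((cmod (deriv Y x))\<^sup>2 * u (Y x)) * indicator X x \<partial>(distr lborel borel vec_cplx))"
  proof -
    have "indicator (vec_cplx -` X) v = (indicator X (vec_cplx v) :: ennreal)" for v
      by (simp add: indicator_def)
    thus ?thesis by (subst nn_integral_distr_vec_cplx[OF m2]) (simp only: o_def vec_cplx_inverse)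
  qed
  finally show ?thesis by (simp add: lborel_vec_cplx)
qed

subsection \<open>Logarithmic area\<close>

lemma inj_on_exp_strip:
  assumes "\<And>t. t \<in> S \<Longrightarrow> c < Im t \<and> Im t < c + 2 * pi"
  shows "inj_on exp S"
proof (rule inj_onI)
  fix x y assume xy: "x \<in> S" "y \<in> S" and eq: "exp x = exp y"
  have "\<bar>Im x - Im y\<bar> < 2 * pi" using assms[OF xy(1)] assms[OF xy(2)] by linarith
  with eq show "x = y" by (rule exp_complex_eqI[rotated])
qed

lemma AE_Im_neq: "AE z in lborel. Im z \<noteq> c"
proof -
  have "negligible {z::complex. z \<bullet> \<i> = c}"
    by (rule negligible_standard_hyperplane) (simp add: Basis_complex_def)
  hence "AE z in lebesgue. \<not> (z \<in> {z::complex. z \<bullet> \<i> = c})"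
    unfolding negligible_iff_null_sets by (rule AE_not_in)
  thus ?thesis by (simp add: AE_completion_iff)
qed

text \<open>\<open>exp\<close> maps an open rectangle of height 2 pi bijectively onto the annulus
  slit along the negative real axis, a null set, and pulls the metric |dw| / |w| back to the
  Euclidean one. The bound is the area of the rectangle.\<close>

lemma nn_integral_annulus_le:
  assumes "a < b"
  shows "(\<integral>\<^sup>+w. ennreal (1 / (cmod w)\<^sup>2) * indicator {w. exp a < cmod w \<and> cmod w < exp b} w \<partial>lborel) \<le> ennreal (2 * pi * (b - a))"
proof -
  define S where "S = box (Complex a (-pi)) (Complex b pi)"
  have inj: "inj_on exp S"
    by (rule inj_on_exp_strip[of _ "- pi"]) (auto simp: S_def in_box_complex_iff)
  have "AE w in lborel. ennreal (1 / (cmod w)\<^sup>2) * indicator {w. exp a < cmod w \<and> cmod w < exp b} w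
      = ennreal (1 / (cmod w)\<^sup>2) * indicator (exp ` S) w"
    using AE_Im_neq[of 0]
  proof eventually_elim
    case (elim w)
    have "w \<in> exp ` S" if w: "exp a < cmod w" "cmod w < exp b"
    proof -
      have w0: "w \<noteq> 0" using w by (metis exp_gt_zero norm_zero not_less_iff_gr_or_eq)
      have "Im (Ln w) \<noteq> pi" using elim Im_Ln_eq_pi[of w] w0 by auto
      moreover have "a < ln (cmod w)" "ln (cmod w) < b"
        using w w0 by (metis exp_less_cancel_iff exp_ln zero_less_norm_iff)+
      ultimately have "Ln w \<in> S"
        using mpi_less_Im_Ln[OF w0] Im_Ln_le_pi[OF w0] w0 unfolding S_def in_box_complex_iff
        by auto
      thus ?thesis using exp_Ln[OF w0] by (metis image_eqI)
    qed
    moreover have "exp a < cmod w \<and> cmod w < exp b" if "w \<in> exp ` S"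
      using that unfolding S_def by (auto simp: in_box_complex_iff)
    ultimately show ?case by (auto simp: indicator_def)
  qed
  hence "(\<integral>\<^sup>+w. ennreal (1 / (cmod w)\<^sup>2) * indicator {w. exp a < cmod w \<and> cmod w < exp b} w \<partial>lborel)
      = (\<integral>\<^sup>+w. ennreal (1 / (cmod w)\<^sup>2) * indicator (exp ` S) w \<partial>lborel)"
    by (rule nn_integral_cong_AE)
  also have "\<dots> = (\<integral>\<^sup>+t. ennreal ((cmod (deriv exp t))\<^sup>2 * (1 / (cmod (exp t))\<^sup>2)) * indicator S t \<partial>lborel)"
    by (rule nn_integral_image_holomorphic)
       (use inj in \<open>auto simp: S_def intro!: holomorphic_intros continuous_intros\<close>)
  also have "\<dots> = (\<integral>\<^sup>+t. indicator S t \<partial>lborel)"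
    by (intro nn_integral_cong) (auto simp: indicator_def DERIV_imp_deriv[OF DERIV_exp])
  also have "\<dots> = ennreal (\<Prod>k\<in>Basis. (Complex b pi - Complex a (-pi)) \<bullet> k)"
    unfolding S_def by (subst nn_integral_indicator, simp, rule emeasure_lborel_box)
       (use assms in \<open>auto simp: Basis_complex_def\<close>)
  also have "(\<Prod>k\<in>Basis. (Complex b pi - Complex a (-pi)) \<bullet> k) = 2 * pi * (b - a)"
    by (simp add: Basis_complex_def)
  finally show ?thesis by simp
qed

text \<open>\<open>exp (t + W t)\<close> has logarithmic derivative 1 + W', so the left side is the
  area of the image of \<open>X\<close> in the metric |dw| / |w|. By injectivity no part of the
  enclosing annulus is counted twice.\<close>

lemma log_area_le:
  assumes X: "open X" and W: "W holomorphic_on X" and inj: "inj_on (\<lambda>t. exp (t + W t)) X"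
    and lo: "\<And>t. t \<in> X \<Longrightarrow> a \<le> Re t + Re (W t)" and hi: "\<And>t. t \<in> X \<Longrightarrow> Re t + Re (W t) \<le> b" and ab: "a \<le> b"
  shows "(\<integral>\<^sup>+t. ennreal ((cmod (1 + deriv W t))\<^sup>2) * indicator X t \<partial>lborel) \<le> ennreal (2 * pi * (b - a))"
proof (rule ennreal_le_epsilon)
  fix e :: real assume e: "e > 0"
  \<comment> \<open>The bounds \<open>lo\<close> and \<open>hi\<close> are not strict whereas the
    annulus is open. Widening it by \<open>h\<close> at both ends costs 2 pi * 2 h = e.\<close>
  define h where "h = e / (4 * pi)"
  have h: "h > 0" using e by (simp add: h_def)
  define Y where "Y = (\<lambda>t. exp (t + W t))"
  have holY: "Y holomorphic_on X" unfolding Y_def by (intro holomorphic_intros W)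
  have dY: "deriv Y t = Y t * (1 + deriv W t)" if "t \<in> X" for t
    unfolding Y_def
    by (rule DERIV_imp_deriv) (auto intro!: derivative_eq_intros holomorphic_derivI[OF W X that])
  have "(\<integral>\<^sup>+t. ennreal ((cmod (1 + deriv W t))\<^sup>2) * indicator X t \<partial>lborel)
     = (\<integral>\<^sup>+t. ennreal ((cmod (deriv Y t))\<^sup>2 * (1 / (cmod (Y t))\<^sup>2)) * indicator X t \<partial>lborel)"
  proof (intro nn_integral_cong)
    fix t
    have "Y t \<noteq> 0" by (simp add: Y_def)
    thus "ennreal ((cmod (1 + deriv W t))\<^sup>2) * indicator X t =
        ennreal ((cmod (deriv Y t))\<^sup>2 * (1 / (cmod (Y t))\<^sup>2)) * indicator X t"
      by (cases "t \<in> X") (simp_all add: dY norm_mult power_mult_distrib)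
  qed
  also have "\<dots> = (\<integral>\<^sup>+w. ennreal (1 / (cmod w)\<^sup>2) * indicator (Y ` X) w \<partial>lborel)"
    by (rule nn_integral_image_holomorphic[symmetric])
       (use X holY inj in \<open>auto simp: Y_def intro!: continuous_intros\<close>)
  also have "\<dots> \<le> (\<integral>\<^sup>+w. ennreal (1 / (cmod w)\<^sup>2) * indicator {w. exp (a-h) < cmod w \<and> cmod w < exp (b+h)} w \<partial>lborel)"
  proof (intro nn_integral_mono mult_left_mono)
    fix w
    have "exp (a - h) < cmod (Y t) \<and> cmod (Y t) < exp (b+h)" if "t \<in> X" for t
      using lo[OF that] hi[OF that] h unfolding Y_def by simp
    thus "(indicator (Y ` X) w :: ennreal) \<le> indicator {w. exp (a-h) < cmod w \<and> cmod w < exp (b+h)} w"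
      by (auto simp: indicator_def)
  qed simp
  also have "\<dots> \<le> ennreal (2 * pi * (b + h - (a - h)))"
    by (rule nn_integral_annulus_le) (use h ab in simp)
  also have "2 * pi * (b + h - (a - h)) = 2 * pi * (b - a) + e"
    by (simp add: h_def field_simps)
  also have "ennreal (2 * pi * (b - a) + e) = ennreal (2 * pi * (b - a)) + ennreal e"
    by (rule ennreal_plus) (use ab e in auto)
  finally show "(\<integral>\<^sup>+t. ennreal ((cmod (1 + deriv W t))\<^sup>2) * indicator X t \<partial>lborel) \<le> ennreal (2 * pi * (b - a)) + ennreal e" .
qed

subsection \<open>Mean values on circles\<close>

lemma circle_mean_value:
  assumes "v holomorphic_on ball 0 R" "0 < r" "r < R"
  shows "((\<lambda>\<phi>. v (of_real r * cis \<phi>)) has_integral (of_real (2 * pi) * v 0)) {0..2*pi}"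
proof -
  have "((\<lambda>w. v w / (w - 0)) has_contour_integral (2 * of_real pi * \<i> * v 0)) (circlepath 0 r)"
    using assms by (intro Cauchy_integral_circlepath_simple holomorphic_on_subset[OF assms(1)]) auto
  hence "((\<lambda>t. v (of_real r * cis t) / (of_real r * cis t) * of_real r * \<i> * cis t) has_integral 2 * of_real pi * \<i> * v 0) {0..2*pi}"
    unfolding circlepath_def by (subst (asm) has_contour_integral_part_circlepath_iff) auto
  hence "((\<lambda>t. - \<i> * (v (of_real r * cis t) / (of_real r * cis t) * of_real r * \<i> * cis t)) has_integral - \<i> * (2 * of_real pi * \<i> * v 0)) {0..2*pi}"
    by (rule has_integral_mult_right)
  moreover have "- \<i> * (v (of_real r * cis t) / (of_real r * cis t) * of_real r * \<i> * cis t) = v (of_real r * cis t)" for t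
    using assms by (simp add: field_simps)
  ultimately show ?thesis by (simp add: mult_ac)
qed

lemma cmod_add_squared: "(cmod (x + p))\<^sup>2 = (cmod x)\<^sup>2 + 2 * Re (cnj x * p) + (cmod p)\<^sup>2"
  unfolding cmod_power2 by (simp add: power2_eq_square algebra_simps)

text \<open>Induction by splitting off the constant term, u = c 0 + z v. In |u|^2 the cross term is
  the real part of a holomorphic function vanishing at 0, so its mean over the circle is 0; the
  remaining term is r^2 |v|^2, and the coefficients of \<open>v\<close> are the shifted
  ones.\<close>

lemma Bessel_circle:
  assumes "\<And>z. cmod z < R \<Longrightarrow> (\<lambda>k. c k * z ^ k) sums u z" "0 < r" "r < R"
  shows "2 * pi * (\<Sum>k\<le>K. (cmod (c k))\<^sup>2 * r ^ (2*k)) \<le> integral {0..2*pi} (\<lambda>\<phi>. (cmod (u (of_real r * cis \<phi>)))\<^sup>2)"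
  using assms(1)
proof (induction K arbitrary: c u)
  have hol: "u holomorphic_on ball 0 R" if "\<And>z. cmod z < R \<Longrightarrow> (\<lambda>k. c k * z ^ k) sums u z" for c u
    by (rule power_series_holomorphic[where a = c]) (use that in auto)
  have cont: "continuous_on {0..2*pi} (\<lambda>\<phi>. u (of_real r * cis \<phi>))" if "u holomorphic_on ball 0 R" for u
    by (rule continuous_on_compose2[OF holomorphic_on_imp_continuous_on[OF that]])
       (use assms in \<open>auto intro!: continuous_intros simp: norm_mult\<close>)
  have step: "integral {0..2*pi} (\<lambda>\<phi>. (cmod (u (of_real r * cis \<phi>)))\<^sup>2) = 2 * pi * (cmod (c 0))\<^sup>2 +
        r\<^sup>2 * integral {0..2*pi} (\<lambda>\<phi>. (cmod (v (of_real r * cis \<phi>)))\<^sup>2)"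
    if c: "\<And>z. cmod z < R \<Longrightarrow> u z = c 0 + z * v z" and v: "v holomorphic_on ball 0 R" for c :: "nat \<Rightarrow> complex" and u v
  proof -
    define w where "w = (\<lambda>z. cnj (c 0) * (z * v z))"
    have holw: "w holomorphic_on ball 0 R" unfolding w_def by (intro holomorphic_intros v)
    have "((\<lambda>\<phi>. w (of_real r * cis \<phi>)) has_integral 0) {0..2*pi}"
      using circle_mean_value[OF holw assms(2,3)] by (simp add: w_def)
    from has_integral_linear[OF this bounded_linear_Re]
    have w0: "((\<lambda>\<phi>. Re (w (of_real r * cis \<phi>))) has_integral 0) {0..2*pi}" by (simp add: o_def)
    have "(cmod (u (of_real r * cis \<phi>)))\<^sup>2 = (cmod (c 0))\<^sup>2 + 2 * Re (w (of_real r * cis \<phi>)) + r\<^sup>2 * (cmod (v (of_real r * cis \<phi>)))\<^sup>2" for \<phi>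
    proof -
      let ?z = "of_real r * cis \<phi>"
      have "(cmod (c 0 + ?z * v ?z))\<^sup>2 = (cmod (c 0))\<^sup>2 + 2 * Re (cnj (c 0) * (?z * v ?z)) + (cmod (?z * v ?z))\<^sup>2"
        by (rule cmod_add_squared)
      moreover have "(cmod (?z * v ?z))\<^sup>2 = r\<^sup>2 * (cmod (v ?z))\<^sup>2"
        by (simp add: norm_mult power_mult_distrib)
      ultimately show ?thesis using c[of ?z] assms by (simp add: norm_mult w_def)
    qed
    moreover have "((\<lambda>\<phi>. (cmod (c 0))\<^sup>2 + 2 * Re (w (of_real r * cis \<phi>)) + r\<^sup>2 * (cmod (v (of_real r * cis \<phi>)))\<^sup>2) has_integral
        (2 * pi * (cmod (c 0))\<^sup>2 + 2 * 0 + r\<^sup>2 * integral {0..2*pi} (\<lambda>\<phi>. (cmod (v (of_real r * cis \<phi>)))\<^sup>2))) {0..2*pi}"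
    proof (intro has_integral_add has_integral_mult_right w0 integrable_integral)
      show "((\<lambda>\<phi>. (cmod (c 0))\<^sup>2) has_integral 2 * pi * (cmod (c 0))\<^sup>2) {0..2*pi}"
        using has_integral_const_real[of "(cmod (c 0))\<^sup>2" 0 "2*pi"] by simp
      show "(\<lambda>\<phi>. (cmod (v (of_real r * cis \<phi>)))\<^sup>2) integrable_on {0..2*pi}"
        by (intro integrable_continuous_interval continuous_on_power continuous_on_norm cont v)
    qed
    ultimately show ?thesis by (simp add: integral_unique)
  qed
  have ex: "\<exists>v. v holomorphic_on ball 0 R \<and> (\<forall>z. cmod z < R \<longrightarrow> u z = c 0 + z * v z \<and> (\<lambda>k. c (Suc k) * z ^ k) sums v z)"
    if s: "\<And>z. cmod z < R \<Longrightarrow> (\<lambda>k. c k * z ^ k) sums u z" for c u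
  proof -
    define v where "v = (\<lambda>z. if z = 0 then c 1 else (u z - c 0) / z)"
    have sv: "(\<lambda>k. c (Suc k) * z ^ k) sums v z" if "cmod z < R" for z
    proof (cases "z = 0")
      case True
      have "(\<lambda>k. c (Suc k) * 0 ^ k) sums c (Suc 0)"
        using powser_sums_zero[of "\<lambda>k. c (Suc k)"] by simp
      thus ?thesis using True by (simp add: v_def)
    next
      case False
      have "(\<lambda>k. c (Suc k) * z ^ (Suc k)) sums (u z - c 0)"
        using s[OF that] by (subst sums_Suc_iff) simp
      hence "(\<lambda>k. c (Suc k) * z ^ (Suc k) / z) sums ((u z - c 0) / z)" by (rule sums_divide)
      thus ?thesis using False by (simp add: v_def)
    qed
    have "u 0 = c 0"
      using sums_unique2[OF s[of 0] powser_sums_zero[of c]] assms by simp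
    hence "u z = c 0 + z * v z" if "cmod z < R" for z
      by (simp add: v_def)
    moreover have "v holomorphic_on ball 0 R" by (rule hol[OF sv])
    ultimately show ?thesis using sv by blast
  qed
  {
    case 0
    obtain v where v: "v holomorphic_on ball 0 R" "\<And>z. cmod z < R \<Longrightarrow> u z = c 0 + z * v z"
      using ex[OF 0] by blast
    have "integral {0..2*pi} (\<lambda>\<phi>. (cmod (v (of_real r * cis \<phi>)))\<^sup>2) \<ge> 0"
      by (intro integral_nonneg integrable_continuous_interval continuous_on_power continuous_on_norm cont v) auto
    thus ?case using step[where u = u and c = c and v = v, OF v(2,1)] by simp
  next
    case (Suc K)
    obtain v where v: "v holomorphic_on ball 0 R" "\<And>z. cmod z < R \<Longrightarrow> u z = c 0 + z * v z"
       "\<And>z. cmod z < R \<Longrightarrow> (\<lambda>k. c (Suc k) * z ^ k) sums v z"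
      using ex[OF Suc.prems] by blast
    have "r\<^sup>2 * (2 * pi * (\<Sum>k\<le>K. (cmod (c (Suc k)))\<^sup>2 * r ^ (2*k))) \<le> r\<^sup>2 * integral {0..2*pi} (\<lambda>\<phi>. (cmod (v (of_real r * cis \<phi>)))\<^sup>2)"
      by (intro mult_left_mono Suc.IH v(3)) auto
    moreover have "2 * pi * (\<Sum>k\<le>Suc K. (cmod (c k))\<^sup>2 * r ^ (2*k)) = 2 * pi * (cmod (c 0))\<^sup>2 + r\<^sup>2 * (2 * pi * (\<Sum>k\<le>K. (cmod (c (Suc k)))\<^sup>2 * r ^ (2*k)))"
    proof -
      have "(\<Sum>k\<le>K. (cmod (c (Suc k)))\<^sup>2 * r ^ (2 * Suc k)) = r\<^sup>2 * (\<Sum>k\<le>K. (cmod (c (Suc k)))\<^sup>2 * r ^ (2*k))"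
        unfolding sum_distrib_left by (intro sum.cong) (simp_all add: power2_eq_square)
      thus ?thesis unfolding sum.atMost_Suc_shift by (simp add: distrib_left)
    qed
    ultimately show ?case using step[where u = u and c = c and v = v, OF v(2,1)] by simp
  }
qed

section \<open>Area integrals over strips in the logarithmic coordinate\<close>

lemma continuous_nn_integral:
  fixes f :: "real \<Rightarrow> real"
  assumes "continuous_on {a..b} f" "\<And>x. x \<in> {a..b} \<Longrightarrow> f x \<ge> 0"
  shows "(\<integral>\<^sup>+x. ennreal (f x) * indicator {a..b} x \<partial>lborel) = ennreal (integral {a..b} f)"
  using assms by (intro nn_integral_has_integral_lebesgue' integrable_integral integrable_continuous_interval) auto

lemma open_punctured_strip: "open {t. a < Re t \<and> Re t < b \<and> 0 < Im t \<and> Im t < 2 * pi \<and> Im t \<noteq> pi}"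
  by (intro open_Collect_conj open_halfspace_Re_gt open_halfspace_Re_lt open_halfspace_Im_gt
      open_halfspace_Im_lt open_Collect_neq continuous_intros)

text \<open>The segment Re t = x becomes the circle of radius \<open>exp x\<close>, where
  \<open>Bessel_circle\<close> applies. Integration over x turns \<open>exp (2 k x)\<close> into the
  stated weights and the constant coefficient into a term linear in b - a. The midline Im t = pi is
  left out so that \<open>exp\<close> maps \<open>S\<close> off the real axis; it is a null
  set.\<close>

lemma nn_integral_strip_Bessel:
  assumes u: "\<And>z. cmod z < 1 \<Longrightarrow> (\<lambda>k. c k * z ^ k) sums u z" and ab: "a \<le> b" "b \<le> 0"
    and S: "S = {t. a < Re t \<and> Re t < b \<and> 0 < Im t \<and> Im t < 2 * pi \<and> Im t \<noteq> pi}"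
  shows "ennreal (2 * pi * (cmod (c 0))\<^sup>2 * (b - a) + pi * (\<Sum>k=1..K. (cmod (c k))\<^sup>2 / k * (exp (2*k*b) - exp (2*k*a))))
     \<le> (\<integral>\<^sup>+t. ennreal ((cmod (u (exp t)))\<^sup>2) * indicator S t \<partial>lborel)"
proof -
  have hol: "u holomorphic_on ball 0 1"
    by (rule power_series_holomorphic[where a = c]) (use u in auto)
  have opS: "open S" unfolding S by (rule open_punctured_strip)
  have cS: "continuous_on S (\<lambda>t. (cmod (u (exp t)))\<^sup>2)"
    by (intro continuous_intros continuous_on_compose2[OF holomorphic_on_imp_continuous_on[OF hol]]) (use ab in \<open>auto simp: S\<close>)
  define v where "v = (\<lambda>t. ennreal ((cmod (u (exp t)))\<^sup>2) * indicator S t)"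
  have m: "v \<in> borel_measurable borel"
    unfolding v_def by (rule borel_measurable_open_indicator[OF opS cS])
  define g where "g = (\<lambda>x::real. 2 * pi * (\<Sum>k\<le>K. (cmod (c k))\<^sup>2 * exp x ^ (2*k)))"
  have inner: "ennreal (g x) * indicator {a..b} x \<le> (\<integral>\<^sup>+y. v (Complex x y) \<partial>lborel)" if x: "x \<noteq> a" "x \<noteq> b" for x
  proof (cases "a < x \<and> x < b")
    case True
    have "g x \<le> integral {0..2*pi} (\<lambda>y. (cmod (u (of_real (exp x) * cis y)))\<^sup>2)"
      unfolding g_def by (rule Bessel_circle[OF u]) (use True ab in auto)
    hence "ennreal (g x) \<le> ennreal (integral {0..2*pi} (\<lambda>y. (cmod (u (of_real (exp x) * cis y)))\<^sup>2))"
      by (rule ennreal_leI)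
    also have "\<dots> = (\<integral>\<^sup>+y. ennreal ((cmod (u (of_real (exp x) * cis y)))\<^sup>2) * indicator {0..2*pi} y \<partial>lborel)"
      by (rule continuous_nn_integral[symmetric])
         (use True ab in \<open>auto intro!: continuous_intros continuous_on_compose2[OF holomorphic_on_imp_continuous_on[OF hol]] simp: norm_mult\<close>)
    also have "\<dots> = (\<integral>\<^sup>+y. v (Complex x y) \<partial>lborel)"
    proof (rule nn_integral_cong_AE)
      have "AE y in lborel. y \<noteq> (0::real)" "AE y in lborel. y \<noteq> pi" "AE y in lborel. y \<noteq> 2*pi"
        by (rule AE_lborel_singleton)+
      thus "AE y in lborel. ennreal ((cmod (u (of_real (exp x) * cis y)))\<^sup>2) * indicator {0..2*pi} y = v (Complex x y)"
        by eventually_elim (use True in \<open>auto simp: v_def S indicator_def exp_eq_polar\<close>)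
    qed
    finally show ?thesis using True by simp
  qed (use x in \<open>auto simp: indicator_def\<close>)
  define E where "E = (\<lambda>x::real. \<Sum>k=1..K. (cmod (c k))\<^sup>2 * (exp (2*k*x) / (2*k)))"
  define G where "G = (\<lambda>x::real. 2 * pi * ((cmod (c 0))\<^sup>2 * x + E x))"
  have e2: "exp x ^ (2*k) = exp (2 * real k * x)" for x :: real and k
    using exp_of_nat_mult[of "2*k" x] by simp
  have "(g has_integral (G b - G a)) {a..b}"
  proof (rule fundamental_theorem_of_calculus)
    fix x assume "x \<in> {a..b}"
    have "(G has_real_derivative (2 * pi * ((cmod (c 0))\<^sup>2 + (\<Sum>k=1..K. (cmod (c k))\<^sup>2 * exp (2*k*x))))) (at x within {a..b})"
      unfolding G_def E_def by (auto intro!: derivative_eq_intros sum.cong)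
    moreover have "{..K} = insert 0 {1..K}" by auto
    ultimately have "(G has_real_derivative g x) (at x within {a..b})"
      unfolding g_def by (simp add: e2)
    thus "(G has_vector_derivative g x) (at x within {a..b})"
      by (rule has_real_derivative_iff_has_vector_derivative[THEN iffD1])
  qed (use ab in auto)
  hence "(\<integral>\<^sup>+x. ennreal (g x) * indicator {a..b} x \<partial>lborel) = ennreal (G b - G a)"
    by (intro nn_integral_has_integral_lebesgue') (auto simp: g_def intro!: mult_nonneg_nonneg sum_nonneg)
  moreover have "G b - G a = 2 * pi * (cmod (c 0))\<^sup>2 * (b - a) + pi * (\<Sum>k=1..K. (cmod (c k))\<^sup>2 / k * (exp (2*k*b) - exp (2*k*a)))"
  proof -
    have "2 * E b - 2 * E a = (\<Sum>k=1..K. (cmod (c k))\<^sup>2 / k * (exp (2*k*b) - exp (2*k*a)))"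
      unfolding E_def sum_distrib_left sum_subtractf[symmetric] by (intro sum.cong) (auto simp: field_simps)
    moreover have "G b - G a = 2 * pi * (cmod (c 0))\<^sup>2 * (b - a) + pi * (2 * E b - 2 * E a)"
      unfolding G_def by (simp add: algebra_simps)
    ultimately show ?thesis by simp
  qed
  moreover have "(\<integral>\<^sup>+x. ennreal (g x) * indicator {a..b} x \<partial>lborel) \<le> (\<integral>\<^sup>+x. \<integral>\<^sup>+y. v (Complex x y) \<partial>lborel \<partial>lborel)"
  proof (rule nn_integral_mono_AE)
    have "AE x in lborel. x \<noteq> a" "AE x in lborel. x \<noteq> b" by (rule AE_lborel_singleton)+
    thus "AE x in lborel. ennreal (g x) * indicator {a..b} x \<le> (\<integral>\<^sup>+y. v (Complex x y) \<partial>lborel)"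
      by eventually_elim (rule inner)
  qed
  moreover have "(\<integral>\<^sup>+x. \<integral>\<^sup>+y. v (Complex x y) \<partial>lborel \<partial>lborel) = (\<integral>\<^sup>+t. v t \<partial>lborel)"
    by (rule nn_integral_complex_Re_Im[OF m, symmetric])
  ultimately show ?thesis unfolding v_def by simp
qed

text \<open>Serves to let the inner radius \<open>exp a\<close> of a cut annulus shrink to
  0.\<close>

lemma tendsto_exp_weight_sum:
  fixes c w :: "nat \<Rightarrow> real"
  shows "((\<lambda>a. \<Sum>k=1..K. c k * (w k - exp (2 * real k * a))) \<longlongrightarrow> (\<Sum>k=1..K. c k * w k)) at_bot"
proof -
  have "((\<lambda>a. exp (2 * real k * a)) \<longlongrightarrow> 0) at_bot" if "k \<in> {1..K}" for k
  proof -
    have "filterlim (\<lambda>a. 2 * real k * a) at_bot at_bot"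
      using that by (intro filterlim_tendsto_pos_mult_at_bot[OF tendsto_const _ filterlim_ident]) auto
    thus ?thesis by (rule filterlim_compose[OF exp_at_bot])
  qed
  hence "((\<lambda>a. \<Sum>k=1..K. c k * (w k - exp (2 * real k * a))) \<longlongrightarrow> (\<Sum>k=1..K. c k * (w k - 0))) at_bot"
    by (intro tendsto_intros) auto
  thus ?thesis by simp
qed

subsection \<open>The inverse of the Joukowski map\<close>

definition joukowski :: "complex \<Rightarrow> complex" where "joukowski z = z + 1 / z"

lemma joukowski_inj: "inj_on joukowski (ball 0 1 - {0})"
proof (rule inj_onI)
  fix x y assume x: "x \<in> ball 0 1 - {0}" and y: "y \<in> ball 0 1 - {0}" and eq: "joukowski x = joukowski y"
  have "(x - y) * (x * y - 1) = 0"
    using x y eq by (auto simp: joukowski_def field_simps)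
  moreover have "x * y \<noteq> 1"
  proof
    assume "x * y = 1"
    hence "cmod x * cmod y = 1" by (metis norm_mult norm_one)
    moreover have "cmod x * cmod y < 1 * 1" using x y by (intro mult_strict_mono) auto
    ultimately show False by simp
  qed
  ultimately show "x = y" by simp
qed

text \<open>The two roots of z + 1/z = s have product 1. If one is unimodular, the other is its
  conjugate and s is real in [-2, 2], the excluded slit; otherwise one of them lies inside the
  disc.\<close>

lemma joukowski_surj:
  assumes "Im s \<noteq> 0 \<or> \<bar>Re s\<bar> > 2"
  shows "s \<in> joukowski ` (ball 0 1 - {0})"
proof -
  define d where "d = csqrt (s\<^sup>2 - 4)"
  define z1 where "z1 = (s + d) / 2"
  define z2 where "z2 = (s - d) / 2"
  have d: "d\<^sup>2 = s\<^sup>2 - 4" by (simp add: d_def)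
  have prod: "z1 * z2 = 1" using d by (simp add: z1_def z2_def field_simps power2_eq_square)
  have sum: "z1 + z2 = s" by (simp add: z1_def z2_def field_simps)
  have nz: "z1 \<noteq> 0" "z2 \<noteq> 0" using prod by auto
  have J: "joukowski z1 = s" "joukowski z2 = s"
    using prod sum nz by (auto simp: joukowski_def field_simps)
  have "cmod z1 * cmod z2 = 1" using prod by (metis norm_mult norm_one)
  moreover have "cmod z1 \<noteq> 1"
  proof
    assume 1: "cmod z1 = 1"
    hence "z1 * cnj z1 = 1" by (simp add: complex_norm_square[symmetric])
    hence "z2 = cnj z1" using prod nz by (metis mult_left_cancel)
    hence "s = complex_of_real (2 * Re z1)" using sum by (simp add: complex_add_cnj)
    moreover have "\<bar>Re z1\<bar> \<le> 1" using 1 abs_Re_le_cmod[of z1] by simp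
    ultimately show False using assms by auto
  qed
  ultimately have "cmod z1 < 1 \<or> cmod z2 < 1"
    by (metis linorder_neqE_linordered_idom mult.commute mult_less_cancel_right2 less_le_trans mult_le_cancel_left2 norm_ge_zero not_less nz(1) zero_less_norm_iff)
  thus ?thesis
  proof
    assume "cmod z1 < 1"
    thus ?thesis using J(1) nz(1) by (intro image_eqI[of _ _ z1]) auto
  next
    assume "cmod z2 < 1"
    thus ?thesis using J(2) nz(2) by (intro image_eqI[of _ _ z2]) auto
  qed
qed

lemma joukowski_inverse:
  "\<exists>J. J holomorphic_on {s. Im s \<noteq> 0 \<or> \<bar>Re s\<bar> > 2} \<and>
    (\<forall>s. Im s \<noteq> 0 \<or> \<bar>Re s\<bar> > 2 \<longrightarrow> J s \<in> ball 0 1 - {0} \<and> J s + 1 / J s = s) \<and>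
    (\<forall>z\<in>ball 0 1 - {0}. J (z + 1 / z) = z)"
proof -
  have hol: "joukowski holomorphic_on (ball 0 1 - {0})"
    unfolding joukowski_def by (intro holomorphic_intros) auto
  obtain J where J: "J holomorphic_on joukowski ` (ball 0 1 - {0})" 
    "\<And>z. z \<in> ball 0 1 - {0} \<Longrightarrow> J (joukowski z) = z"
    using holomorphic_has_inverse[OF hol _ joukowski_inj] by (metis open_ball open_delete)
  show ?thesis
  proof (intro exI[of _ J] conjI allI ballI impI)
    show "J holomorphic_on {s. Im s \<noteq> 0 \<or> \<bar>Re s\<bar> > 2}"
      using J(1) joukowski_surj by (auto intro: holomorphic_on_subset)
    fix s assume s: "Im s \<noteq> 0 \<or> \<bar>Re s\<bar> > 2"
    obtain z where "z \<in> ball 0 1 - {0}" "joukowski z = s" using joukowski_surj[OF s] by blast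
    thus "J s \<in> ball 0 1 - {0}" "J s + 1 / J s = s" using J(2)[of z] by (auto simp: joukowski_def)
  next
    fix z assume "z \<in> ball 0 1 - {0 :: complex}"
    thus "J (z + 1 / z) = z"
      using J(2)[of z] by (simp add: joukowski_def)
  qed
qed

text \<open>By the open mapping theorem the image of a small disc about \<open>p\<close> covers a
  disc about \<open>h p\<close>, and injectivity rules out any other preimage of that disc. Thus
  closeness of values forces closeness of arguments on all of \<open>S\<close>, even near its
  boundary.\<close>

lemma injective_small_imp_near:
  assumes h: "h holomorphic_on S" "inj_on h S" "open S" and p: "p \<in> S" and d: "d > 0"
  obtains e where "e > 0" "\<And>z. z \<in> S \<Longrightarrow> cmod (h z - h p) < e \<Longrightarrow> cmod (z - p) < d"
proof -
  have "open (h ` (S \<inter> ball p d))"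
    using h by (intro open_mapping_thm3) (auto intro: holomorphic_on_subset inj_on_subset)
  moreover have "h p \<in> h ` (S \<inter> ball p d)" using p d by auto
  ultimately obtain e where e: "e > 0" "ball (h p) e \<subseteq> h ` (S \<inter> ball p d)"
    by (meson open_contains_ball)
  show ?thesis
  proof (rule that[OF e(1)])
    fix z assume z: "z \<in> S" "cmod (h z - h p) < e"
    hence "h z \<in> ball (h p) e" by (simp add: dist_norm norm_minus_commute)
    then obtain z' where "z' \<in> S \<inter> ball p d" "h z = h z'" using e(2) by blast
    moreover have "z = z'" using calculation z(1) h(2) by (auto dest: inj_onD)
    ultimately show "cmod (z - p) < d" by (simp add: dist_norm norm_minus_commute)
  qed
qed

lemma moebius_small_imp_near:
  assumes h: "h holomorphic_on S" "inj_on h S" "open S" and p: "p \<in> S" "q \<in> S" "p \<noteq> q"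
    and F: "continuous_on S F" and eta: "\<eta> > 0"
  obtains \<tau> where "\<tau> > 0" "\<And>z. z \<in> S \<Longrightarrow> z \<noteq> q \<Longrightarrow> cmod ((h z - h p) / (h z - h q)) < \<tau> \<Longrightarrow> \<bar>Re (F z) - Re (F p)\<bar> < \<eta>"
proof -
  have "continuous (at p within S) F" using F p(1) by (auto simp: continuous_on_eq_continuous_within)
  then obtain d where d: "d > 0" "\<And>z. z \<in> S \<Longrightarrow> dist z p < d \<Longrightarrow> dist (F z) (F p) < \<eta>"
    using eta unfolding continuous_within_eps_delta by metis
  obtain e where e: "e > 0" "\<And>z. z \<in> S \<Longrightarrow> cmod (h z - h p) < e \<Longrightarrow> cmod (z - p) < d"
    using injective_small_imp_near[OF h p(1) d(1)] by blast
  define D where "D = cmod (h p - h q)"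
  \<comment> \<open>For x = |h z - h p| the inequality x < \<tau> (x + D) rearranges to (D + 1) x <
    e D, and hence x < e.\<close>
  define \<tau> where "\<tau> = e / (e + D + 1)"
  have D: "D \<ge> 0" by (simp add: D_def)
  show ?thesis
  proof
    show "\<tau> > 0" using e(1) D by (simp add: \<tau>_def)
    fix z assume z: "z \<in> S" "z \<noteq> q" and lt: "cmod ((h z - h p) / (h z - h q)) < \<tau>"
    have "h z \<noteq> h q" using z h(2) p by (auto dest: inj_onD)
    hence "cmod (h z - h p) < \<tau> * cmod (h z - h q)"
      using lt by (simp add: norm_divide divide_less_eq)
    also have "cmod (h z - h q) \<le> cmod (h z - h p) + D"
      unfolding D_def using norm_triangle_ineq[of "h z - h p" "h p - h q"] by simp
    finally have "cmod (h z - h p) < \<tau> * (cmod (h z - h p) + D)"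
      using \<open>\<tau> > 0\<close> by (simp add: mult_left_mono order_less_le_trans)
    hence "(e + D + 1) * cmod (h z - h p) < e * (cmod (h z - h p) + D)"
      using e(1) D by (simp add: \<tau>_def field_simps)
    hence "(D + 1) * cmod (h z - h p) < e * D" by (simp add: algebra_simps)
    also have "\<dots> \<le> e * (D + 1)" using e(1) by simp
    finally have "cmod (h z - h p) < e" using D by (simp add: mult.commute)
    hence "dist (F z) (F p) < \<eta>" using e(2)[OF z(1)] d(2)[OF z(1)] by (simp add: dist_norm)
    moreover have "\<bar>Re (F z) - Re (F p)\<bar> \<le> cmod (F z - F p)"
      using abs_Re_le_cmod[of "F z - F p"] by simp
    ultimately show "\<bar>Re (F z) - Re (F p)\<bar> < \<eta>" by (simp add: dist_norm)
  qed
qed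

subsection \<open>Area inequalities for a zero and a pole\<close>

lemma continuous_on_cmod_deriv:
  assumes "W holomorphic_on X" "open X"
  shows "continuous_on X (\<lambda>t. (cmod (deriv W t))\<^sup>2)" "continuous_on X (\<lambda>t. (cmod (1 + deriv W t))\<^sup>2)"
  using holomorphic_on_imp_continuous_on[OF holomorphic_deriv[OF assms]] by (auto intro!: continuous_intros)

text \<open>\<open>exp (t + F (\<kappa> t))\<close> is the Moebius image g of the univalent
  \<open>h\<close>, hence itself univalent. Where |g| is small, the point is near \<open>p\<close>
  and log |g| differs from Re t by almost exactly Re (F p); where |g| is large, the same holds with
  \<open>q\<close>. So a cut in Re t becomes an annulus bound for g, with an error \<eta> at each
  end.\<close>

lemma two_point_area_bound:
  assumes h: "h holomorphic_on D" "inj_on h D" "open D" and pq: "p \<in> D" "q \<in> D" "p \<noteq> q"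
    and F: "F holomorphic_on D" and X: "open X" and kap: "\<kappa> holomorphic_on X" "inj_on \<kappa> X"
    and img: "\<And>t. t \<in> X \<Longrightarrow> \<kappa> t \<in> D - {p, q}"
    and eq: "\<And>t. t \<in> X \<Longrightarrow> exp (t + F (\<kappa> t)) = (h (\<kappa> t) - h p) / (h (\<kappa> t) - h q)"
    and eta: "\<eta> > 0"
  obtains A B where "\<And>a b. a \<le> A \<Longrightarrow> B \<le> b \<Longrightarrow>
    (\<integral>\<^sup>+t. ennreal ((cmod (1 + deriv (\<lambda>t. F (\<kappa> t)) t))\<^sup>2) * indicator (X \<inter> {t. a < Re t \<and> Re t < b}) t \<partial>lborel)
      \<le> ennreal (2 * pi * (b - a + Re (F q) - Re (F p) + 2 * \<eta>))"
proof -
  define W where "W = (\<lambda>t. F (\<kappa> t))"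
  have holW: "W holomorphic_on X" unfolding W_def
    by (rule holomorphic_on_compose_gen[OF kap(1) F, unfolded o_def]) (use img in auto)
  have nz: "h (\<kappa> t) \<noteq> h p" "h (\<kappa> t) \<noteq> h q" if "t \<in> X" for t
    using img[OF that] h(2) pq by (auto dest: inj_onD)
  note contF = holomorphic_on_imp_continuous_on[OF F]
  obtain \<tau> where \<tau>: "\<tau> > 0" "\<And>z. z \<in> D \<Longrightarrow> z \<noteq> q \<Longrightarrow> cmod ((h z - h p) / (h z - h q)) < \<tau> \<Longrightarrow> \<bar>Re (F z) - Re (F p)\<bar> < \<eta>"
    using moebius_small_imp_near[OF h pq contF eta] by blast
  obtain \<tau>' where \<tau>': "\<tau>' > 0" "\<And>z. z \<in> D \<Longrightarrow> z \<noteq> p \<Longrightarrow> cmod ((h z - h q) / (h z - h p)) < \<tau>' \<Longrightarrow> \<bar>Re (F z) - Re (F q)\<bar> < \<eta>"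
    using moebius_small_imp_near[OF h pq(2,1) pq(3)[symmetric] contF eta] by blast
  \<comment> \<open>With a \<le> \<open>A\<close> the inner bound a + Re (F p) - \<eta> is at most
    ln \<tau>, so it also holds at points where |g| \<ge> \<tau>. The first entry in
    \<open>B\<close> does the same at the outer end; the second keeps the inner radius below the
    outer one.\<close>
  define A where "A = ln \<tau> - Re (F p) + \<eta>"
  define B where "B = max (- ln \<tau>' - Re (F q) - \<eta>) (A + Re (F p) - Re (F q))"
  have modY: "exp (Re t + Re (W t)) = cmod ((h (\<kappa> t) - h p) / (h (\<kappa> t) - h q))" if "t \<in> X" for t
    using arg_cong[OF eq[OF that], of cmod] by (simp add: W_def)
  show ?thesis
  proof (rule that[of A B])
    fix a b assume ab: "a \<le> A" "B \<le> b"
    let ?X = "X \<inter> {t. a < Re t \<and> Re t < b}"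
    have oX: "open ?X" using X by (intro open_Int open_Collect_conj open_halfspace_Re_gt open_halfspace_Re_lt)
    have "(\<integral>\<^sup>+t. ennreal ((cmod (1 + deriv W t))\<^sup>2) * indicator ?X t \<partial>lborel)
      \<le> ennreal (2 * pi * ((b + Re (F q) + \<eta>) - (a + Re (F p) - \<eta>)))"
    proof (rule log_area_le[OF oX])
      show "W holomorphic_on ?X" using holW by (rule holomorphic_on_subset) auto
      show "inj_on (\<lambda>t. exp (t + W t)) ?X"
      proof (rule inj_onI)
        fix s t assume st: "s \<in> ?X" "t \<in> ?X" and "exp (s + W s) = exp (t + W t)"
        hence e: "(h (\<kappa> s) - h p) / (h (\<kappa> s) - h q) = (h (\<kappa> t) - h p) / (h (\<kappa> t) - h q)"
          using eq by (simp add: W_def)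
        have "(h (\<kappa> s) - h p) * (h (\<kappa> t) - h q) = (h (\<kappa> t) - h p) * (h (\<kappa> s) - h q)"
          using e nz[of s] nz[of t] st by (simp add: frac_eq_eq)
        hence "(h (\<kappa> s) - h (\<kappa> t)) * (h p - h q) = 0" by (simp add: algebra_simps)
        moreover have "h p \<noteq> h q" using h(2) pq by (auto dest: inj_onD)
        ultimately have "h (\<kappa> s) = h (\<kappa> t)" by simp
        hence "\<kappa> s = \<kappa> t" using h(2) img st by (auto dest: inj_onD)
        thus "s = t" using kap(2) st by (auto dest: inj_onD)
      qed
      show "a + Re (F p) - \<eta> \<le> Re t + Re (W t)" if t: "t \<in> ?X" for t
      proof (cases "exp (Re t + Re (W t)) < \<tau>")
        case True
        hence "\<bar>Re (F (\<kappa> t)) - Re (F p)\<bar> < \<eta>"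
          using modY[of t] t img[of t] by (intro \<tau>(2)) auto
        thus ?thesis using t by (auto simp: W_def)
      next
        case False
        hence "ln \<tau> \<le> Re t + Re (W t)" using \<tau>(1) by (metis exp_gt_zero ln_exp ln_le_cancel_iff not_less)
        thus ?thesis using ab by (simp add: A_def)
      qed
      show "Re t + Re (W t) \<le> b + Re (F q) + \<eta>" if t: "t \<in> ?X" for t
      proof (cases "exp (- (Re t + Re (W t))) < \<tau>'")
        case True
        have "exp (- (Re t + Re (W t))) = cmod ((h (\<kappa> t) - h q) / (h (\<kappa> t) - h p))"
          unfolding exp_minus using modY[of t] t by (simp add: norm_divide)
        hence "\<bar>Re (F (\<kappa> t)) - Re (F q)\<bar> < \<eta>"
          using True t img[of t] by (intro \<tau>'(2)) auto
        thus ?thesis using t by (auto simp: W_def)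
      next
        case False
        hence "ln \<tau>' \<le> - (Re t + Re (W t))" using \<tau>'(1) by (metis exp_gt_zero ln_exp ln_le_cancel_iff not_less)
        thus ?thesis using ab by (auto simp: B_def)
      qed
      show "a + Re (F p) - \<eta> \<le> b + Re (F q) + \<eta>" using ab eta by (auto simp: B_def)
    qed
    thus "(\<integral>\<^sup>+t. ennreal ((cmod (1 + deriv (\<lambda>t. F (\<kappa> t)) t))\<^sup>2) * indicator ?X t \<partial>lborel)
      \<le> ennreal (2 * pi * (b - a + Re (F q) - Re (F p) + 2 * \<eta>))"
      unfolding W_def by (simp add: algebra_simps)
  qed
qed

text \<open>Re W' is the y-derivative of Im W, so the cross term 2 Re W' integrates to 0 over a
  period. The square |W'|^2 is discarded.\<close>

lemma vertical_line_integral: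
  assumes W: "W holomorphic_on U" "open U" and line: "\<And>y. y \<in> {0..2*pi} \<Longrightarrow> Complex x y \<in> U"
    and per: "W (Complex x (2*pi)) = W (Complex x 0)"
  shows "ennreal (2 * pi) \<le> (\<integral>\<^sup>+y. ennreal ((cmod (1 + deriv W (Complex x y)))\<^sup>2) * indicator {0..2*pi} y \<partial>lborel)"
proof -
  have d: "((\<lambda>y. Im (W (Complex x y))) has_vector_derivative Re (deriv W (Complex x y))) (at y within {0..2*pi})"
    if "y \<in> {0..2*pi}" for y
  proof -
    have "(W has_field_derivative deriv W (Complex x y)) (at (Complex x y))"
      by (rule holomorphic_derivI[OF W line[OF that]])
    moreover have "((\<lambda>y. Complex x y) has_vector_derivative \<i>) (at y within {0..2*pi})"
    proof -
      have "(\<lambda>y. Complex x y) = (\<lambda>y. of_real x + of_real y * \<i>)" by (auto simp: complex_eq_iff)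
      moreover have "((\<lambda>y. of_real x + of_real y * \<i>) has_vector_derivative \<i>) (at y within {0..2*pi})"
        by (auto intro!: derivative_eq_intros simp: has_vector_derivative_def scaleR_conv_of_real)
      ultimately show ?thesis by simp
    qed
    ultimately have "(W \<circ> (\<lambda>y. Complex x y) has_vector_derivative \<i> * deriv W (Complex x y)) (at y within {0..2*pi})"
      by (intro field_vector_diff_chain_within[of _ _ _ _ W]) (auto intro: has_field_derivative_at_within)
    from bounded_linear.has_vector_derivative[OF bounded_linear_Im this]
    show ?thesis by (simp add: o_def)
  qed
  have "((\<lambda>y. Re (deriv W (Complex x y))) has_integral (Im (W (Complex x (2*pi))) - Im (W (Complex x 0)))) {0..2*pi}"
    by (rule fundamental_theorem_of_calculus) (use d in auto)
  hence i0: "((\<lambda>y. Re (deriv W (Complex x y))) has_integral 0) {0..2*pi}" using per by simp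
  have cline: "continuous_on {0..2*pi} (\<lambda>y. Complex x y)"
    by (auto intro!: continuous_intros simp: Complex_eq)
  have cont: "continuous_on {0..2*pi} (\<lambda>y. (cmod (1 + deriv W (Complex x y)))\<^sup>2)"
    by (rule continuous_on_compose2[OF continuous_on_cmod_deriv(2)[OF W] cline]) (use line in auto)
  have "((\<lambda>y. 1 + 2 * Re (deriv W (Complex x y))) has_integral 2 * pi + 2 * 0) {0..2*pi}"
    using has_integral_const_real[of "1::real" 0 "2*pi"]
    by (intro has_integral_add has_integral_mult_right i0) simp
  moreover have "1 + 2 * Re w \<le> (cmod (1 + w))\<^sup>2" for w
    using cmod_add_squared[of 1 w] by simp
  ultimately have "2 * pi \<le> integral {0..2*pi} (\<lambda>y. (cmod (1 + deriv W (Complex x y)))\<^sup>2)"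
    using has_integral_le[OF _ integrable_integral[OF integrable_continuous_interval[OF cont]]] by fastforce
  hence "ennreal (2 * pi) \<le> ennreal (integral {0..2*pi} (\<lambda>y. (cmod (1 + deriv W (Complex x y)))\<^sup>2))"
    by (rule ennreal_leI)
  also have "\<dots> = (\<integral>\<^sup>+y. ennreal ((cmod (1 + deriv W (Complex x y)))\<^sup>2) * indicator {0..2*pi} y \<partial>lborel)"
    by (rule continuous_nn_integral[OF cont, symmetric]) auto
  finally show ?thesis .
qed

text \<open>Re W' is the x-derivative of Re W, so the cross term is twice the difference of the end
  values. Here |W'|^2 is kept, since it is the quantity to be estimated. The sign condition on b - a
  - 2 C prevents \<open>ennreal\<close> from truncating.\<close>

lemma horizontal_line_integral:
  assumes W: "W holomorphic_on U" "open U" and line: "\<And>x. x \<in> {a..b} \<Longrightarrow> Complex x y \<in> U" and ab: "a \<le> b"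
    and C: "Re (W (Complex a y)) - Re (W (Complex b y)) \<le> C" "0 \<le> b - a - 2 * C"
  shows "(\<integral>\<^sup>+x. ennreal ((cmod (deriv W (Complex x y)))\<^sup>2) * indicator {a..b} x \<partial>lborel) + ennreal (b - a - 2 * C)
    \<le> (\<integral>\<^sup>+x. ennreal ((cmod (1 + deriv W (Complex x y)))\<^sup>2) * indicator {a..b} x \<partial>lborel)"
proof -
  have d: "((\<lambda>x. Re (W (Complex x y))) has_vector_derivative Re (deriv W (Complex x y))) (at x within {a..b})"
    if "x \<in> {a..b}" for x
  proof -
    have "(W has_field_derivative deriv W (Complex x y)) (at (Complex x y))"
      by (rule holomorphic_derivI[OF W line[OF that]])
    moreover have "((\<lambda>x. Complex x y) has_vector_derivative 1) (at x within {a..b})"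
    proof -
      have "(\<lambda>x. Complex x y) = (\<lambda>x. of_real x + of_real y * \<i>)" by (auto simp: complex_eq_iff)
      moreover have "((\<lambda>x. of_real x + of_real y * \<i>) has_vector_derivative 1) (at x within {a..b})"
        by (auto intro!: derivative_eq_intros simp: has_vector_derivative_def scaleR_conv_of_real)
      ultimately show ?thesis by simp
    qed
    ultimately have "(W \<circ> (\<lambda>x. Complex x y) has_vector_derivative 1 * deriv W (Complex x y)) (at x within {a..b})"
      by (intro field_vector_diff_chain_within[of _ _ _ _ W]) (auto intro: has_field_derivative_at_within)
    from bounded_linear.has_vector_derivative[OF bounded_linear_Re this]
    show ?thesis by (simp add: o_def)
  qed
  have i0: "((\<lambda>x. Re (deriv W (Complex x y))) has_integral (Re (W (Complex b y)) - Re (W (Complex a y)))) {a..b}"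
    by (rule fundamental_theorem_of_calculus) (use d ab in auto)
  have cline: "continuous_on {a..b} (\<lambda>x. Complex x y)"
    by (auto intro!: continuous_intros simp: Complex_eq)
  have cont: "continuous_on {a..b} (\<lambda>x. (cmod (1 + deriv W (Complex x y)))\<^sup>2)"
             "continuous_on {a..b} (\<lambda>x. (cmod (deriv W (Complex x y)))\<^sup>2)"
    by (rule continuous_on_compose2[OF continuous_on_cmod_deriv(2)[OF W] cline]
             continuous_on_compose2[OF continuous_on_cmod_deriv(1)[OF W] cline]; use line in auto)+
  let ?I = "integral {a..b} (\<lambda>x. (cmod (deriv W (Complex x y)))\<^sup>2)"
  have "((\<lambda>x. (cmod (deriv W (Complex x y)))\<^sup>2 + (1 + 2 * Re (deriv W (Complex x y)))) has_integral
      ?I + ((b - a) + 2 * (Re (W (Complex b y)) - Re (W (Complex a y))))) {a..b}"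
    using has_integral_const_real[of "1::real" a b] ab
    by (intro has_integral_add has_integral_mult_right i0 integrable_integral integrable_continuous_interval cont) simp
  moreover have "(cmod (1 + w))\<^sup>2 = (cmod w)\<^sup>2 + (1 + 2 * Re w)" for w
    using cmod_add_squared[of 1 w] by simp
  ultimately have J: "?I + ((b - a) + 2 * (Re (W (Complex b y)) - Re (W (Complex a y)))) = integral {a..b} (\<lambda>x. (cmod (1 + deriv W (Complex x y)))\<^sup>2)"
    by (simp add: integral_unique)
  have "- (2 * C) \<le> 2 * (Re (W (Complex b y)) - Re (W (Complex a y)))" using C(1) by simp
  hence le: "?I + (b - a - 2 * C) \<le> integral {a..b} (\<lambda>x. (cmod (1 + deriv W (Complex x y)))\<^sup>2)"
    unfolding J[symmetric] by simp
  have I0: "?I \<ge> 0" by (intro integral_nonneg integrable_continuous_interval cont) auto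
  show ?thesis
    using ennreal_leI[OF le] I0 C
    by (simp add: continuous_nn_integral[OF cont(1)] continuous_nn_integral[OF cont(2)] ennreal_plus)
qed

text \<open>Here \<open>exp t\<close> runs through the sphere minus the unit circle. On a vertical line \<open>\<integral> W' = 0\<close> by periodicity, so
  the logarithmic area is at least that of the strip.\<close>

lemma circular_inequality:
  assumes h: "h holomorphic_on D" "inj_on h D" "open D" and pq: "p \<in> D" "q \<in> D" "p \<noteq> q"
    and F: "F holomorphic_on D" and kap: "\<kappa> holomorphic_on {t. Re t \<noteq> 0}"
    and inj: "inj_on \<kappa> {t. Re t \<noteq> 0 \<and> 0 < Im t \<and> Im t < 2 * pi}"
    and img: "\<And>t. Re t \<noteq> 0 \<Longrightarrow> \<kappa> t \<in> D - {p, q}"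
    and per: "\<And>t. Re t \<noteq> 0 \<Longrightarrow> \<kappa> (t + 2 * pi * \<i>) = \<kappa> t"
    and eq: "\<And>t. Re t \<noteq> 0 \<Longrightarrow> exp (t + F (\<kappa> t)) = (h (\<kappa> t) - h p) / (h (\<kappa> t) - h q)"
  shows "Re (F p) \<le> Re (F q)"
proof (rule field_le_epsilon)
  fix e :: real assume "e > 0"
  define \<eta> where "\<eta> = e / 2"
  have eta: "\<eta> > 0" using \<open>e > 0\<close> by (simp add: \<eta>_def)
  define U where "U = {t. Re t \<noteq> 0}"
  have oU: "open U" unfolding U_def by (intro open_Collect_neq continuous_intros)
  define X where "X = U \<inter> {t. 0 < Im t} \<inter> {t. Im t < 2 * pi}"
  have oX: "open X" unfolding X_def
    by (intro open_Int oU open_halfspace_Im_gt open_halfspace_Im_lt)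
  define W where "W = (\<lambda>t. F (\<kappa> t))"
  have holW: "W holomorphic_on U" unfolding W_def
    by (rule holomorphic_on_compose_gen[OF _ F, unfolded o_def]) (use img kap in \<open>auto simp: U_def\<close>)
  have kX: "\<kappa> holomorphic_on X" using kap by (rule holomorphic_on_subset) (auto simp: X_def U_def)
  have iX: "inj_on \<kappa> X" using inj by (rule inj_on_subset) (auto simp: X_def U_def)
  have imgX: "\<kappa> t \<in> D - {p, q}" if "t \<in> X" for t
    using img that by (auto simp: X_def U_def)
  have eqX: "exp (t + F (\<kappa> t)) = (h (\<kappa> t) - h p) / (h (\<kappa> t) - h q)" if "t \<in> X" for t
    using eq that by (auto simp: X_def U_def)
  obtain A B where AB: "\<And>a b. a \<le> A \<Longrightarrow> B \<le> b \<Longrightarrow>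
    (\<integral>\<^sup>+t. ennreal ((cmod (1 + deriv W t))\<^sup>2) * indicator (X \<inter> {t. a < Re t \<and> Re t < b}) t \<partial>lborel)
      \<le> ennreal (2 * pi * (b - a + Re (F q) - Re (F p) + 2 * \<eta>))"
    using two_point_area_bound[OF h pq F oX kX iX imgX eqX eta] unfolding W_def by blast
  \<comment> \<open>Both bounds contain the width of the cut in the form 2 pi (b - a), so a single
    cut suffices; \<open>B - 1\<close> only ensures a < b.\<close>
  define a where "a = min A (B - 1)"
  define b where "b = B"
  have ab: "a < b" by (auto simp: a_def b_def)
  let ?X = "X \<inter> {t. a < Re t \<and> Re t < b}"
  have oX': "open ?X" using oX by (intro open_Int open_Collect_conj open_halfspace_Re_gt open_halfspace_Re_lt)
  have m: "(\<lambda>t. ennreal ((cmod (1 + deriv W t))\<^sup>2) * indicator ?X t) \<in> borel_measurable borel"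
    by (rule borel_measurable_open_indicator[OF oX'])
       (rule continuous_on_subset[OF continuous_on_cmod_deriv(2)[OF holW oU]], auto simp: X_def)
  have "ennreal (2 * pi * (b - a)) = (\<integral>\<^sup>+x. ennreal (2 * pi) * indicator {a..b} x \<partial>lborel)"
    using ab by (simp add: nn_integral_cmult_indicator ennreal_mult)
  also have "\<dots> \<le> (\<integral>\<^sup>+x. \<integral>\<^sup>+y. ennreal ((cmod (1 + deriv W (Complex x y)))\<^sup>2) * indicator ?X (Complex x y) \<partial>lborel \<partial>lborel)"
  proof (rule nn_integral_mono_AE)
    \<comment> \<open>The line x = 0 corresponds to the slit, the unit circle, where nothing is
      assumed about \<open>\<kappa>\<close>; a and b are removed because the cut strip is
      open.\<close>
    have "AE x in lborel. x \<noteq> 0" "AE x in lborel. x \<noteq> a" "AE x in lborel. x \<noteq> b" by (rule AE_lborel_singleton)+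
    thus "AE x in lborel. ennreal (2 * pi) * indicator {a..b} x \<le>
       (\<integral>\<^sup>+y. ennreal ((cmod (1 + deriv W (Complex x y)))\<^sup>2) * indicator ?X (Complex x y) \<partial>lborel)"
    proof eventually_elim
      case (elim x)
      show ?case
      proof (cases "x \<in> {a..b}")
        case True
        have "ennreal (2 * pi) \<le> (\<integral>\<^sup>+y. ennreal ((cmod (1 + deriv W (Complex x y)))\<^sup>2) * indicator {0..2*pi} y \<partial>lborel)"
        proof (rule vertical_line_integral[OF holW oU])
          show "W (Complex x (2*pi)) = W (Complex x 0)"
          proof -
            have "Complex x 0 + 2 * pi * \<i> = Complex x (2*pi)" by (simp add: complex_eq_iff)
            thus ?thesis using per[of "Complex x 0"] elim by (simp add: W_def)
          qed
        qed (use elim in \<open>auto simp: U_def\<close>)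
        also have "\<dots> = (\<integral>\<^sup>+y. ennreal ((cmod (1 + deriv W (Complex x y)))\<^sup>2) * indicator ?X (Complex x y) \<partial>lborel)"
        proof (rule nn_integral_cong_AE)
          have "AE y in lborel. y \<noteq> 0" "AE y in lborel. y \<noteq> 2 * pi" by (rule AE_lborel_singleton)+
          thus "AE y in lborel. ennreal ((cmod (1 + deriv W (Complex x y)))\<^sup>2) * indicator {0..2*pi} y
             = ennreal ((cmod (1 + deriv W (Complex x y)))\<^sup>2) * indicator ?X (Complex x y)"
            by eventually_elim (use True elim in \<open>auto simp: indicator_def X_def U_def\<close>)
        qed
        finally show ?thesis using True by simp
      qed simp
    qed
  qed
  also have "\<dots> = (\<integral>\<^sup>+t. ennreal ((cmod (1 + deriv W t))\<^sup>2) * indicator ?X t \<partial>lborel)"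
    by (rule nn_integral_complex_Re_Im[OF m, symmetric])
  also have "\<dots> \<le> ennreal (2 * pi * (b - a + Re (F q) - Re (F p) + 2 * \<eta>))"
    by (rule AB) (auto simp: a_def b_def)
  finally have "2 * pi * (b - a) \<le> 2 * pi * (b - a + Re (F q) - Re (F p) + 2 * \<eta>)"
    using ab by (subst (asm) ennreal_le_iff2) (use pi_gt_zero in \<open>auto simp: mult_le_0_iff\<close>)
  thus "Re (F p) \<le> Re (F q) + e" by (simp add: \<eta>_def)
qed

lemma ennreal_le_diffI:
  assumes "x + ennreal c \<le> ennreal d" "0 \<le> c"
  shows "x \<le> ennreal (d - c)"
proof (cases x)
  case (real r)
  thus ?thesis using assms by (cases "d \<ge> 0") (auto simp: ennreal_plus[symmetric] ennreal_neg simp del: ennreal_plus intro!: ennreal_leI)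
qed (use assms in \<open>auto simp: top_unique\<close>)

text \<open>Here \<open>exp t\<close> runs through the plane minus the positive real axis. On a horizontal line \<open>\<integral> W'\<close> tends to
  \<open>F q - F p\<close>; subtracting twice this from the term \<open>F q - F p\<close> of the area bound leaves \<open>F p - F q\<close>.\<close>

lemma radial_inequality:
  assumes h: "h holomorphic_on D" "inj_on h D" "open D" and pq: "p \<in> D" "q \<in> D" "p \<noteq> q"
    and F: "F holomorphic_on D" and X_def: "X = {t. 0 < Im t \<and> Im t < 2 * pi}" and kap: "\<kappa> holomorphic_on X"
    and inj: "inj_on \<kappa> X"
    and img: "\<And>t. t \<in> X \<Longrightarrow> \<kappa> t \<in> D - {p, q}"
    and lim_p: "\<And>\<eta>. \<eta> > 0 \<Longrightarrow> \<exists>A. \<forall>t\<in>X. Re t \<le> A \<longrightarrow> \<bar>Re (F (\<kappa> t)) - Re (F p)\<bar> < \<eta>"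
    and lim_q: "\<And>\<eta>. \<eta> > 0 \<Longrightarrow> \<exists>B. \<forall>t\<in>X. B \<le> Re t \<longrightarrow> \<bar>Re (F (\<kappa> t)) - Re (F q)\<bar> < \<eta>"
    and eq: "\<And>t. t \<in> X \<Longrightarrow> exp (t + F (\<kappa> t)) = (h (\<kappa> t) - h p) / (h (\<kappa> t) - h q)"
  shows "(\<integral>\<^sup>+t. ennreal ((cmod (deriv (\<lambda>t. F (\<kappa> t)) t))\<^sup>2) * indicator X t \<partial>lborel) \<le> ennreal (2 * pi * (Re (F p) - Re (F q)))"
proof (rule ennreal_le_epsilon)
  fix e :: real assume "e > 0"
  \<comment> \<open>The total error is 2 pi * 6 \<eta> = e: 2 \<eta> from the area bound and 4
    \<eta> from \<open>C\<close>, which is subtracted twice.\<close>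
  define \<eta> where "\<eta> = e / (12 * pi)"
  have eta: "\<eta> > 0" using \<open>e > 0\<close> by (simp add: \<eta>_def)
  define W where "W = (\<lambda>t. F (\<kappa> t))"
  have oX: "open X" unfolding X_def by (intro open_Collect_conj open_halfspace_Im_gt open_halfspace_Im_lt)
  have holW: "W holomorphic_on X" unfolding W_def
    by (rule holomorphic_on_compose_gen[OF kap F, unfolded o_def]) (use img in auto)
  obtain A B where AB: "\<And>a b. a \<le> A \<Longrightarrow> B \<le> b \<Longrightarrow>
    (\<integral>\<^sup>+t. ennreal ((cmod (1 + deriv W t))\<^sup>2) * indicator (X \<inter> {t. a < Re t \<and> Re t < b}) t \<partial>lborel)
      \<le> ennreal (2 * pi * (b - a + Re (F q) - Re (F p) + 2 * \<eta>))"
    using two_point_area_bound[OF h pq F oX kap inj img eq eta] unfolding W_def by blast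
  obtain A' where A': "\<And>t. t \<in> X \<Longrightarrow> Re t \<le> A' \<Longrightarrow> \<bar>Re (W t) - Re (F p)\<bar> < \<eta>"
    using lim_p[OF eta] unfolding W_def by blast
  obtain B' where B': "\<And>t. t \<in> X \<Longrightarrow> B' \<le> Re t \<Longrightarrow> \<bar>Re (W t) - Re (F q)\<bar> < \<eta>"
    using lim_q[OF eta] unfolding W_def by blast
  define d where "d = Re (F p) - Re (F q)"
  define C where "C = d + 2 * \<eta>"
  have key: "(\<integral>\<^sup>+t. ennreal ((cmod (deriv W t))\<^sup>2) * indicator (X \<inter> {t. a < Re t \<and> Re t < b}) t \<partial>lborel)
     \<le> ennreal (2 * pi * (d + 6 * \<eta>))"
    if ab: "a \<le> A" "a \<le> A'" "B \<le> b" "B' \<le> b" "a \<le> b" "0 \<le> b - a - 2 * C" for a b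
  proof -
    let ?X = "X \<inter> {t. a < Re t \<and> Re t < b}"
    have oX': "open ?X" using oX by (intro open_Int open_Collect_conj open_halfspace_Re_gt open_halfspace_Re_lt)
    have m: "(\<lambda>t. ennreal ((cmod (1 + deriv W t))\<^sup>2) * indicator ?X t) \<in> borel_measurable borel"
      "(\<lambda>t. ennreal ((cmod (deriv W t))\<^sup>2) * indicator ?X t) \<in> borel_measurable borel"
      by (rule borel_measurable_open_indicator[OF oX'], 
          rule continuous_on_subset[OF continuous_on_cmod_deriv(2)[OF holW oX]] continuous_on_subset[OF continuous_on_cmod_deriv(1)[OF holW oX]], auto)+
    have m2: "(\<lambda>y. \<integral>\<^sup>+x. ennreal ((cmod (deriv W (Complex x y)))\<^sup>2) * indicator ?X (Complex x y) \<partial>lborel) \<in> borel_measurable lborel"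
    proof -
      have m0: "(\<lambda>p. (\<lambda>t. ennreal ((cmod (deriv W t))\<^sup>2) * indicator ?X t) (case p of (x,y) \<Rightarrow> Complex x y)) \<in> borel_measurable (lborel \<Otimes>\<^sub>M lborel)"
        using measurable_compose[OF measurable_Complex_pair m(2)] by simp
      have "(\<lambda>(y,x). (\<lambda>t. ennreal ((cmod (deriv W t))\<^sup>2) * indicator ?X t) (Complex x y)) \<in> borel_measurable (lborel \<Otimes>\<^sub>M lborel)"
        using measurable_compose[OF measurable_pair_swap' m0] by (simp add: case_prod_unfold)
      thus ?thesis by (rule lborel.borel_measurable_nn_integral)
    qed
    have inner: "(\<integral>\<^sup>+x. ennreal ((cmod (deriv W (Complex x y)))\<^sup>2) * indicator ?X (Complex x y) \<partial>lborel) + ennreal (b - a - 2 * C) * indicator {0<..<2*pi} y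
      \<le> (\<integral>\<^sup>+x. ennreal ((cmod (1 + deriv W (Complex x y)))\<^sup>2) * indicator ?X (Complex x y) \<partial>lborel)" for y
    proof (cases "0 < y \<and> y < 2 * pi")
      case True
      have *: "(\<integral>\<^sup>+x. ennreal (f (Complex x y)) * indicator ?X (Complex x y) \<partial>lborel) = (\<integral>\<^sup>+x. ennreal (f (Complex x y)) * indicator {a..b} x \<partial>lborel)" for f
      proof (rule nn_integral_cong_AE)
        have "AE x in lborel. x \<noteq> a" "AE x in lborel. x \<noteq> b" by (rule AE_lborel_singleton)+
        thus "AE x in lborel. ennreal (f (Complex x y)) * indicator ?X (Complex x y) = ennreal (f (Complex x y)) * indicator {a..b} x"
          by eventually_elim (use True in \<open>auto simp: indicator_def X_def\<close>)
      qed
      have "(\<integral>\<^sup>+x. ennreal ((cmod (deriv W (Complex x y)))\<^sup>2) * indicator {a..b} x \<partial>lborel) + ennreal (b - a - 2 * C)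
        \<le> (\<integral>\<^sup>+x. ennreal ((cmod (1 + deriv W (Complex x y)))\<^sup>2) * indicator {a..b} x \<partial>lborel)"
      proof (rule horizontal_line_integral[OF holW oX])
        have "Complex a y \<in> X" "Complex b y \<in> X" using True by (auto simp: X_def)
        thus "Re (W (Complex a y)) - Re (W (Complex b y)) \<le> C"
          using A'[of "Complex a y"] B'[of "Complex b y"] ab unfolding C_def d_def by auto
      qed (use True ab in \<open>auto simp: X_def\<close>)
      thus ?thesis using True unfolding *[of "\<lambda>t. (cmod (deriv W t))\<^sup>2"] *[of "\<lambda>t. (cmod (1 + deriv W t))\<^sup>2"] by simp
    next
      case False
      thus ?thesis by (auto simp: X_def indicator_def)
    qed
    have "(\<integral>\<^sup>+t. ennreal ((cmod (deriv W t))\<^sup>2) * indicator ?X t \<partial>lborel) + ennreal (2 * pi * (b - a - 2 * C))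
       = (\<integral>\<^sup>+y. \<integral>\<^sup>+x. ennreal ((cmod (deriv W (Complex x y)))\<^sup>2) * indicator ?X (Complex x y) \<partial>lborel \<partial>lborel)
         + (\<integral>\<^sup>+y. ennreal (b - a - 2 * C) * indicator {0<..<2*pi} y \<partial>lborel)"
    proof -
      have "(\<integral>\<^sup>+y. ennreal (b - a - 2 * C) * indicator {0<..<2*pi} y \<partial>lborel) = ennreal (b - a - 2 * C) * ennreal (2 * pi)"
        by (subst nn_integral_cmult_indicator) auto
      also have "\<dots> = ennreal (2 * pi * (b - a - 2 * C))"
        using ab by (subst ennreal_mult[symmetric]) (auto simp: mult.commute)
      finally show ?thesis by (simp only: nn_integral_complex_Im_Re[OF m(2)])
    qed
    also have "\<dots> = (\<integral>\<^sup>+y. (\<integral>\<^sup>+x. ennreal ((cmod (deriv W (Complex x y)))\<^sup>2) * indicator ?X (Complex x y) \<partial>lborel)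
         + ennreal (b - a - 2 * C) * indicator {0<..<2*pi} y \<partial>lborel)"
      by (rule nn_integral_add[symmetric]) (use m2 in auto)
    also have "\<dots> \<le> (\<integral>\<^sup>+y. \<integral>\<^sup>+x. ennreal ((cmod (1 + deriv W (Complex x y)))\<^sup>2) * indicator ?X (Complex x y) \<partial>lborel \<partial>lborel)"
      by (intro nn_integral_mono inner)
    also have "\<dots> = (\<integral>\<^sup>+t. ennreal ((cmod (1 + deriv W t))\<^sup>2) * indicator ?X t \<partial>lborel)"
      by (rule nn_integral_complex_Im_Re[OF m(1), symmetric])
    also have "\<dots> \<le> ennreal (2 * pi * (b - a + Re (F q) - Re (F p) + 2 * \<eta>))"
      by (rule AB) (use ab in auto)
    finally have "(\<integral>\<^sup>+t. ennreal ((cmod (deriv W t))\<^sup>2) * indicator ?X t \<partial>lborel)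
       \<le> ennreal (2 * pi * (b - a + Re (F q) - Re (F p) + 2 * \<eta>) - 2 * pi * (b - a - 2 * C))"
      by (rule ennreal_le_diffI) (use ab in auto)
    also have "2 * pi * (b - a + Re (F q) - Re (F p) + 2 * \<eta>) - 2 * pi * (b - a - 2 * C) = 2 * pi * (d + 6 * \<eta>)"
      unfolding C_def d_def by (simp add: algebra_simps)
    finally show ?thesis .
  qed
  \<comment> \<open>Large enough that every cut from -c - n to c + n meets all conditions of
    \<open>key\<close>, including b - a \<ge> 2 C. Monotone convergence then removes the
    cut.\<close>
  define c where "c = \<bar>A\<bar> + \<bar>A'\<bar> + \<bar>B\<bar> + \<bar>B'\<bar> + \<bar>C\<bar>"
  define f where "f = (\<lambda>n t. ennreal ((cmod (deriv W t))\<^sup>2) * indicator (X \<inter> {t. - c - real n < Re t \<and> Re t < c + real n}) t)"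
  have SUP: "(SUP n. f n t) = ennreal ((cmod (deriv W t))\<^sup>2) * indicator X t" for t
  proof (rule antisym)
    show "(SUP n. f n t) \<le> ennreal ((cmod (deriv W t))\<^sup>2) * indicator X t"
      by (rule SUP_least) (auto simp: f_def indicator_def)
    obtain n :: nat where n: "\<bar>Re t\<bar> < real n" using reals_Archimedean2 by blast
    have "c \<ge> 0" by (simp add: c_def)
    hence "ennreal ((cmod (deriv W t))\<^sup>2) * indicator X t = f n t"
      using n by (auto simp: f_def indicator_def)
    thus "ennreal ((cmod (deriv W t))\<^sup>2) * indicator X t \<le> (SUP n. f n t)"
      by (metis SUP_upper UNIV_I)
  qed
  have "(\<integral>\<^sup>+t. ennreal ((cmod (deriv W t))\<^sup>2) * indicator X t \<partial>lborel) = (\<integral>\<^sup>+t. (SUP n. f n t) \<partial>lborel)"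
    by (simp add: SUP)
  also have "\<dots> = (SUP n. \<integral>\<^sup>+t. f n t \<partial>lborel)"
  proof (rule nn_integral_monotone_convergence_SUP)
    show "incseq f" by (auto simp: incseq_def le_fun_def f_def indicator_def)
    show "f n \<in> borel_measurable lborel" for n
    proof -
      have "open (X \<inter> {t. - c - real n < Re t \<and> Re t < c + real n})"
        using oX by (intro open_Int open_Collect_conj open_halfspace_Re_gt open_halfspace_Re_lt)
      from borel_measurable_open_indicator[OF this]
      show ?thesis unfolding f_def
        using continuous_on_subset[OF continuous_on_cmod_deriv(1)[OF holW oX]] by auto
    qed
  qed
  also have "\<dots> \<le> ennreal (2 * pi * (d + 6 * \<eta>))"
    unfolding f_def by (intro SUP_least key) (auto simp: c_def)
  also have "2 * pi * (d + 6 * \<eta>) = 2 * pi * d + e"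
    by (simp add: \<eta>_def field_simps)
  also have "ennreal (2 * pi * d + e) \<le> ennreal (2 * pi * d) + ennreal e"
    using \<open>e > 0\<close> by (cases "d \<ge> 0") (auto simp: ennreal_plus[symmetric] ennreal_neg mult_nonneg_nonpos simp del: ennreal_plus intro!: ennreal_leI mult_nonneg_nonpos)
  finally show "(\<integral>\<^sup>+t. ennreal ((cmod (deriv (\<lambda>t. F (\<kappa> t)) t))\<^sup>2) * indicator X t \<partial>lborel) \<le> ennreal (2 * pi * (Re (F p) - Re (F q))) + ennreal e"
    unfolding W_def d_def .
qed

section \<open>Two-point quotients and the distortion of odd univalent functions\<close>

definition diff_quot :: "(complex \<Rightarrow> complex) \<Rightarrow> complex \<Rightarrow> complex \<Rightarrow> complex" where
  "diff_quot h a z = (if z = a then deriv h a else (h z - h a) / (z - a))"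

lemma diff_quot_mult: "(z - a) * diff_quot h a z = h z - h a"
  by (simp add: diff_quot_def)

lemma holomorphic_diff_quot:
  assumes "h holomorphic_on S" "open S"
  shows "diff_quot h a holomorphic_on S"
  unfolding diff_quot_def using pole_lemma_open[OF assms] .

lemma diff_quot_nonzero:
  assumes "h holomorphic_on S" "open S" "inj_on h S" "a \<in> S" "z \<in> S"
  shows "diff_quot h a z \<noteq> 0"
  using holomorphic_injective_imp_regular[OF assms(1-4)] inj_onD[OF assms(3) _ assms(5,4)]
  by (auto simp: diff_quot_def)

lemma disc_logarithm:
  assumes "G holomorphic_on ball (0::complex) 1" "\<And>z. z \<in> ball 0 1 \<Longrightarrow> G z \<noteq> 0"
  shows "\<exists>F. F holomorphic_on ball 0 1 \<and> (\<forall>z\<in>ball 0 1. exp (F z) = G z)"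
  using contractible_imp_holomorphic_log[OF assms(1) convex_imp_contractible[OF convex_ball] assms(2)] by metis

text \<open>The coordinate is \<open>exp t = (z - s) (1 + s z) / ((z + s) (1 - s z))\<close>, a Moebius function of \<open>z - 1/z\<close>, so that
  \<open>z\<close> is recovered from \<open>t\<close> by the Joukowski inverse.\<close>

lemma odd_univalent_distortion:
  fixes s :: real
  assumes h: "h holomorphic_on ball 0 1" "inj_on h (ball 0 1)" and odd: "\<And>z. h (- z) = - h z"
    and s: "0 < s" "s < 1"
  shows "cmod (of_real s * deriv h (of_real s) / h (of_real s)) \<le> (1 + s\<^sup>2) / (1 - s\<^sup>2)"
proof -
  let ?D = "ball 0 1 :: complex set"
  let ?s = "complex_of_real s"
  have sD: "?s \<in> ?D" "- ?s \<in> ?D" "?s \<noteq> - ?s" using s by auto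
  have s1: "s\<^sup>2 < 1" "1 - s\<^sup>2 > 0" using s by (auto simp: power_less_one_iff abs_square_less_1)
  have den: "1 + ?s * z \<noteq> 0" "1 - ?s * z \<noteq> 0" if "z \<in> ?D" for z
  proof -
    have "cmod (?s * z) < 1 * 1" unfolding norm_mult using that s by (intro mult_strict_mono) auto
    thus "1 + ?s * z \<noteq> 0" "1 - ?s * z \<noteq> 0"
      by (metis add_eq_0_iff mult.right_neutral norm_minus_cancel norm_one order_less_irrefl)
         (use \<open>cmod (?s * z) < 1 * 1\<close> in auto)
  qed
  \<comment> \<open>This is g / k with the common factors z - s and z + s cancelled, so it is free
    of zeros and poles.\<close>
  define G where "G = (\<lambda>z. diff_quot h ?s z / diff_quot h (- ?s) z * ((1 - ?s * z) / (1 + ?s * z)))"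
  have nz: "diff_quot h ?s z \<noteq> 0" "diff_quot h (- ?s) z \<noteq> 0" if "z \<in> ?D" for z
    using diff_quot_nonzero[OF h(1) _ h(2)] sD that by auto
  have holG: "G holomorphic_on ?D" unfolding G_def
    by (intro holomorphic_intros holomorphic_diff_quot h) (use nz den in auto)
  have Gnz: "G z \<noteq> 0" if "z \<in> ?D" for z
    using nz[OF that] den[OF that] by (simp add: G_def)
  obtain F where F: "F holomorphic_on ?D" "\<And>z. z \<in> ?D \<Longrightarrow> exp (F z) = G z"
    using disc_logarithm[OF holG Gnz] by blast
  obtain J where J: "J holomorphic_on {s. Im s \<noteq> 0 \<or> \<bar>Re s\<bar> > 2}"
    "\<And>s. Im s \<noteq> 0 \<or> \<bar>Re s\<bar> > 2 \<Longrightarrow> J s \<in> ball 0 1 - {0} \<and> J s + 1 / J s = s"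
    using joukowski_inverse by blast
  \<comment> \<open>Since (z - s) (1 + s z) = z ((1 - s^2) + s (z - 1/z)), and likewise for the
    denominator with a minus sign, the coordinate equation solved for z - 1/z gives
    \<open>w t\<close>. The factor -i in \<open>\<kappa>\<close> turns z - 1/z into a Joukowski
    sum.\<close>
  define c where "c = complex_of_real ((1 - s\<^sup>2) / s)"
  define w where "w = (\<lambda>t. c * ((exp t - 1) / (exp t + 1)))"
  define \<kappa> where "\<kappa> = (\<lambda>t. - \<i> * J (\<i> * w t))"
  have e1: "exp t \<noteq> - 1" if "Re t \<noteq> 0" for t :: complex
  proof
    assume "exp t = -1"
    hence "exp (Re t) = 1" by (metis norm_exp_eq_Re norm_minus_cancel norm_one)
    thus False using that by simp
  qed
  have e1': "exp t + 1 \<noteq> 0" if "Re t \<noteq> 0" for t :: complex using e1[OF that] by (simp add: add_eq_0_iff2)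
  \<comment> \<open>(e - 1) / (e + 1) is purely imaginary only for |e| = 1. So off the line Re t = 0
    the number i * w t is not real and avoids the Joukowski slit.\<close>
  have Rew: "Re (w t) \<noteq> 0" if t: "Re t \<noteq> 0" for t
  proof -
    have "Re ((e - 1) * cnj (e + 1)) = (cmod e)\<^sup>2 - 1" for e
      unfolding cmod_power2 by (simp add: power2_eq_square algebra_simps)
    hence "Re ((exp t - 1) * cnj (exp t + 1)) = (exp (Re t))\<^sup>2 - 1"
      by (simp only: norm_exp_eq_Re)
    moreover have "(exp (Re t))\<^sup>2 \<noteq> 1"
    proof -
      have "exp (Re t) \<noteq> 1" using t by simp
      moreover have "exp (Re t) \<noteq> -1" using exp_gt_zero[of "Re t"] by linarith
      ultimately show ?thesis by (simp add: power2_eq_1_iff)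
    qed
    moreover have "(exp t - 1) / (exp t + 1) = (exp t - 1) * cnj (exp t + 1) / of_real ((cmod (exp t + 1))\<^sup>2)"
      by (rule complex_div_cnj)
    ultimately have "Re ((exp t - 1) / (exp t + 1)) \<noteq> 0"
      using e1'[OF t] by (simp add: Re_divide_of_real)
    moreover have "(1 - s\<^sup>2) / s \<noteq> 0" using s s1 by auto
    ultimately show ?thesis unfolding w_def c_def by (simp only: times_complex.sel Re_complex_of_real Im_complex_of_real mult_zero_left diff_0_right mult_eq_0_iff) blast
  qed
  have Jw: "J (\<i> * w t) \<in> ball 0 1 - {0}" "J (\<i> * w t) + 1 / J (\<i> * w t) = \<i> * w t" if "Re t \<noteq> 0" for t
    using J(2)[of "\<i> * w t"] Rew[OF that] by auto
  have kw: "\<kappa> t - 1 / \<kappa> t = w t" if "Re t \<noteq> 0" for t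
  proof -
    have nz: "J (\<i> * w t) \<noteq> 0" using Jw(1)[OF that] by auto
    have "\<kappa> t - 1 / \<kappa> t = - \<i> * (J (\<i> * w t) + 1 / J (\<i> * w t))"
      by (simp add: \<kappa>_def divide_inverse inverse_mult_distrib algebra_simps)
    thus ?thesis unfolding Jw(2)[OF that] by simp
  qed
  have kD: "\<kappa> t \<in> ?D" "\<kappa> t \<noteq> 0" if "Re t \<noteq> 0" for t
    using Jw(1)[OF that] by (auto simp: \<kappa>_def norm_mult)
  have key: "(\<kappa> t - ?s) * (1 + ?s * \<kappa> t) = exp t * ((\<kappa> t + ?s) * (1 - ?s * \<kappa> t))" if t: "Re t \<noteq> 0" for t
  proof -
    have sw: "?s * w t * (exp t + 1) = (1 - ?s\<^sup>2) * (exp t - 1)"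
      using s e1'[OF t] by (simp add: w_def c_def)
    have 1: "(\<kappa> t - ?s) * (1 + ?s * \<kappa> t) = \<kappa> t * ((1 - ?s\<^sup>2) + ?s * (\<kappa> t - 1 / \<kappa> t))"
      using kD(2)[OF t] by (simp add: field_simps power2_eq_square)
    have 2: "(\<kappa> t + ?s) * (1 - ?s * \<kappa> t) = \<kappa> t * ((1 - ?s\<^sup>2) - ?s * (\<kappa> t - 1 / \<kappa> t))"
      using kD(2)[OF t] by (simp add: field_simps power2_eq_square)
    have "(1 - ?s\<^sup>2) + ?s * w t = exp t * ((1 - ?s\<^sup>2) - ?s * w t)"
      using sw by (simp add: algebra_simps)
    thus ?thesis unfolding 1 2 kw[OF t] by simp
  qed
  have ne: "\<kappa> t \<noteq> ?s" "\<kappa> t \<noteq> - ?s" if t: "Re t \<noteq> 0" for t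
  proof -
    have "1 + ?s * ?s \<noteq> 0" using den(1)[OF sD(1)] .
    moreover have "?s \<noteq> 0" "?s + ?s \<noteq> 0" using s by auto
    moreover have "1 - ?s * ?s \<noteq> 0" using den(2)[OF sD(1)] .
    ultimately show "\<kappa> t \<noteq> ?s" "\<kappa> t \<noteq> - ?s" using key[OF t] by auto
  qed
    have kh: "\<kappa> holomorphic_on {t. Re t \<noteq> 0}"
    proof -
      have "w holomorphic_on {t. Re t \<noteq> 0}"
        unfolding w_def by (intro holomorphic_intros) (use e1' in auto)
      hence "(\<lambda>t. \<i> * w t) holomorphic_on {t. Re t \<noteq> 0}"
        by (intro holomorphic_on_mult holomorphic_on_const)
      moreover have "(\<lambda>t. \<i> * w t) ` {t. Re t \<noteq> 0} \<subseteq> {s. Im s \<noteq> 0 \<or> \<bar>Re s\<bar> > 2}"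
      proof (rule image_subsetI)
        fix t assume "t \<in> {t. Re t \<noteq> 0}"
        hence "Re (w t) \<noteq> 0" by (intro Rew) simp
        thus "\<i> * w t \<in> {s. Im s \<noteq> 0 \<or> \<bar>Re s\<bar> > 2}" by simp
      qed
      ultimately have "J \<circ> (\<lambda>t. \<i> * w t) holomorphic_on {t. Re t \<noteq> 0}"
        by (intro holomorphic_on_compose_gen[OF _ J(1)])
      thus ?thesis unfolding \<kappa>_def o_def by (intro holomorphic_on_mult holomorphic_on_const)
    qed
    have ki: "inj_on \<kappa> {t. Re t \<noteq> 0 \<and> 0 < Im t \<and> Im t < 2 * pi}"
    proof (rule inj_onI)
      fix x y assume x: "x \<in> {t. Re t \<noteq> 0 \<and> 0 < Im t \<and> Im t < 2 * pi}" and y: "y \<in> {t. Re t \<noteq> 0 \<and> 0 < Im t \<and> Im t < 2 * pi}"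
        and eq: "\<kappa> x = \<kappa> y"
      have "(\<kappa> x + ?s) * (1 - ?s * \<kappa> x) \<noteq> 0"
        using ne(2)[of x] x den(2)[OF kD(1)[of x]] by (auto simp: add_eq_0_iff2)
      hence "exp x = exp y" using key[of x] key[of y] x y eq by auto
      moreover have "\<bar>Im x - Im y\<bar> < 2 * pi" using x y by auto
      ultimately show "x = y" using exp_complex_eqI by blast
    qed
    have kimg: "\<kappa> t \<in> ?D - {?s, - ?s}" if "Re t \<noteq> 0" for t using kD[OF that] ne[OF that] by auto
    have kper: "\<kappa> (t + 2 * pi * \<i>) = \<kappa> t" if "Re t \<noteq> 0" for t
      by (simp add: \<kappa>_def w_def exp_add)
    have keq: "exp (t + F (\<kappa> t)) = (h (\<kappa> t) - h ?s) / (h (\<kappa> t) - h (- ?s))" if t: "Re t \<noteq> 0" for t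
    proof -
      note z = kD(1)[OF t] ne[OF t]
      have "h (\<kappa> t) - h ?s = (\<kappa> t - ?s) * diff_quot h ?s (\<kappa> t)" by (simp add: diff_quot_mult)
      moreover have "h (\<kappa> t) - h (- ?s) = (\<kappa> t - (- ?s)) * diff_quot h (- ?s) (\<kappa> t)" by (simp only: diff_quot_mult)
      moreover have "\<kappa> t + ?s \<noteq> 0" using z by (simp add: add_eq_0_iff2)
      ultimately show ?thesis
        unfolding exp_add F(2)[OF z(1)] G_def
        using key[OF t] z den[OF z(1)] nz[OF z(1)] by (simp add: frac_eq_eq)
    qed
  have FF: "Re (F ?s) \<le> Re (F (- ?s))"
    by (rule circular_inequality[OF h open_ball sD F(1) kh ki kimg kper keq])
  \<comment> \<open>Oddness of \<open>h\<close> exchanges the zero and the pole. Together with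
    \<open>FF\<close> this gives |G s| \<le> 1 / |G s|, where G s is s h'(s) / h(s) times (1 - s^2)
    / (1 + s^2).\<close>
  have Gm: "G (- ?s) = 1 / G ?s"
  proof -
    have hs: "h ?s \<noteq> 0"
      using odd[of ?s] inj_onD[OF h(2), of ?s "- ?s"] sD by auto
    have "deriv h (- ?s) = deriv h ?s"
    proof -
      have "(h has_field_derivative deriv h ?s) (at (- (- ?s)))"
        using holomorphic_derivI[OF h(1) _ sD(1)] by simp
      hence "((\<lambda>z. h (- z)) has_field_derivative deriv h ?s * (- 1)) (at (- ?s))"
        by (intro DERIV_chain'[of uminus]) (auto intro!: derivative_eq_intros)
      hence "((\<lambda>z. - h z) has_field_derivative - deriv h ?s) (at (- ?s))" by (simp add: odd)
      hence "((\<lambda>z. - (- h z)) has_field_derivative - (- deriv h ?s)) (at (- ?s))" by (rule DERIV_minus)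
      thus ?thesis by (simp add: DERIV_imp_deriv)
    qed
    thus ?thesis using s hs unfolding G_def diff_quot_def odd by (simp add: divide_simps)
  qed
  have "exp (Re (F ?s)) * exp (Re (F ?s)) \<le> 1"
  proof -
    have "exp (Re (F (- ?s))) = 1 / exp (Re (F ?s))"
      using Gm F(2)[OF sD(1)] F(2)[OF sD(2)] by (metis norm_divide norm_exp_eq_Re norm_one)
    thus ?thesis using FF by (metis exp_gt_zero exp_le_cancel_iff pos_le_divide_eq)
  qed
  hence "exp (Re (F ?s)) \<le> 1" by (smt (verit) exp_gt_zero mult_le_cancel_left1)
  hence "cmod (G ?s) \<le> 1" using F(2)[OF sD(1)] by (metis norm_exp_eq_Re)
  moreover have "cmod (G ?s) = cmod (?s * deriv h ?s / h ?s) * ((1 - s\<^sup>2) / (1 + s\<^sup>2))"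
  proof -
    have "G ?s = ?s * deriv h ?s / h ?s * of_real ((1 - s\<^sup>2) / (1 + s\<^sup>2))"
      using s unfolding G_def diff_quot_def odd by (simp add: power2_eq_square)
    moreover have "cmod (of_real ((1 - s\<^sup>2) / (1 + s\<^sup>2))) = (1 - s\<^sup>2) / (1 + s\<^sup>2)"
      using s1 by (subst norm_of_real) (auto simp: abs_of_nonneg)
    ultimately show ?thesis by (simp only: norm_mult)
  qed
  moreover have "0 < 1 + s\<^sup>2" by (simp add: add_pos_nonneg)
  ultimately show ?thesis using s1 by (simp add: field_simps)
qed

subsection \<open>Distortion and growth of schlicht functions\<close>

lemma schlichtD:
  assumes "schlicht f"
  shows "f holomorphic_on ball 0 1" "inj_on f (ball 0 1)" "f 0 = 0" "deriv f 0 = 1"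
  using assms by (auto simp: schlicht_def)

lemma schlicht_logarithm:
  assumes "schlicht f"
  shows "\<exists>L. L holomorphic_on ball 0 1 \<and> L 0 = 0 \<and> (\<forall>z\<in>ball 0 1. f z = z * exp (L z))"
proof -
  note f = schlichtD[OF assms]
  have "diff_quot f 0 holomorphic_on ball 0 1" "\<And>z. z \<in> ball 0 1 \<Longrightarrow> diff_quot f 0 z \<noteq> 0"
    using holomorphic_diff_quot[OF f(1)] diff_quot_nonzero[OF f(1) _ f(2)] by auto
  then obtain F where F: "F holomorphic_on ball 0 1" "\<And>z. z \<in> ball 0 1 \<Longrightarrow> exp (F z) = diff_quot f 0 z"
    using disc_logarithm by metis
  have F0: "exp (F 0) = 1" using F(2)[of 0] f(4) by (simp add: diff_quot_def)
  have "f z = z * exp (F z - F 0)" if "z \<in> ball 0 1" for z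
    using diff_quot_mult[of z 0 f] F(2)[OF that] F0 f(3) by (simp add: exp_diff)
  moreover have "(\<lambda>z. F z - F 0) holomorphic_on ball 0 1" by (intro holomorphic_intros F)
  ultimately show ?thesis by (intro exI[of _ "\<lambda>z. F z - F 0"]) auto
qed

lemma schlicht_rotate:
  assumes "schlicht f" and u: "cmod u = 1"
  shows "schlicht (\<lambda>z. cnj u * f (u * z))"
proof -
  note f = schlichtD[OF assms(1)]
  have u0: "u \<noteq> 0" using u by auto
  have img: "(\<lambda>z. u * z) ` ball 0 1 \<subseteq> ball 0 1" using u by (auto simp: norm_mult)
  have "f \<circ> (\<lambda>z. u * z) holomorphic_on ball 0 1"
    by (rule holomorphic_on_compose_gen[OF _ f(1) img]) (intro holomorphic_intros)
  hence "(\<lambda>z. cnj u * f (u * z)) holomorphic_on ball 0 1"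
    unfolding o_def by (intro holomorphic_intros)
  moreover have "inj_on (\<lambda>z. cnj u * f (u * z)) (ball 0 1)"
  proof (rule inj_onI)
    fix x y assume "x \<in> ball 0 1" "y \<in> ball 0 1" "cnj u * f (u * x) = cnj u * f (u * y)"
    moreover have "u * x \<in> ball 0 1" "u * y \<in> ball 0 1" using calculation(1,2) img by blast+
    ultimately have "u * x = u * y" using u0 f(2) by (auto dest: inj_onD)
    thus "x = y" using u0 by simp
  qed
  moreover have "deriv (\<lambda>z. cnj u * f (u * z)) 0 = 1"
  proof -
    have "(f has_field_derivative 1) (at (u * 0))"
      using holomorphic_derivI[OF f(1), of 0] f(4) by simp
    hence "((\<lambda>z. f (u * z)) has_field_derivative 1 * u) (at 0)"
      by (intro DERIV_chain'[of "\<lambda>z. u * z"]) (auto intro!: derivative_eq_intros)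
    hence "((\<lambda>z. cnj u * f (u * z)) has_field_derivative cnj u * (1 * u)) (at 0)"
      by (rule DERIV_cmult)
    moreover have "cnj u * (1 * u) = 1" using u by (simp add: mult.commute complex_norm_square[symmetric])
    ultimately show ?thesis by (simp add: DERIV_imp_deriv)
  qed
  ultimately show ?thesis using f(3) by (simp add: schlicht_def)
qed

text \<open>Square root transform: h(z)^2 = f(z^2) defines an odd univalent h, and differentiating
  at s = sqrt r gives s h'(s) / h(s) = r f'(r) / f(r). The bound for odd functions at s is then
  exactly the one claimed at r.\<close>

lemma schlicht_distortion_real:
  assumes "schlicht f" and r: "0 < r" "r < 1"
  shows "cmod (of_real r * deriv f (of_real r) / f (of_real r)) \<le> (1 + r) / (1 - r)"
proof -
  note f = schlichtD[OF assms(1)]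
  obtain L where L: "L holomorphic_on ball 0 1" "L 0 = 0" "\<And>z. z \<in> ball 0 1 \<Longrightarrow> f z = z * exp (L z)"
    using schlicht_logarithm[OF assms(1)] by auto
  define h where "h = (\<lambda>z. z * exp (L (z * z) / 2))"
  have sqD: "z * z \<in> ball 0 1" if "z \<in> ball 0 1" for z :: complex
    using that mult_strict_mono[of "cmod z" 1 "cmod z" 1] by (simp add: norm_mult)
  have h2: "h z * h z = f (z * z)" if "z \<in> ball 0 1" for z
    using L(3)[OF sqD[OF that]] by (simp add: h_def exp_add[symmetric] algebra_simps)
  have odd: "h (- z) = - h z" for z by (simp add: h_def)
  have "L \<circ> (\<lambda>z. z * z) holomorphic_on ball 0 1"
    by (rule holomorphic_on_compose_gen[OF _ L(1)]) (use sqD in \<open>auto intro!: holomorphic_intros\<close>)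
  hence holh: "h holomorphic_on ball 0 1" unfolding h_def o_def by (intro holomorphic_intros) auto
  have inj: "inj_on h (ball 0 1)"
  proof (rule inj_onI)
    fix x y assume x: "x \<in> ball 0 1" and y: "y \<in> ball 0 1" and eq: "h x = h y"
    hence "f (x * x) = f (y * y)" using h2 by metis
    hence "x * x = y * y" using inj_onD[OF f(2)] sqD x y by blast
    hence "x = y \<or> x = - y" by (simp add: square_eq_iff)
    moreover have "x = y" if "x = - y"
    proof -
      have "h y = - h y" using eq odd[of y] that by simp
      hence "h y = 0" by (simp add: equal_neg_zero)
      hence "y = 0" by (simp add: h_def)
      thus ?thesis using that by simp
    qed
    ultimately show "x = y" by blast
  qed
  define s where "s = sqrt r"
  have s: "0 < s" "s < 1" "s\<^sup>2 = r" "s * s = r" using r by (auto simp: s_def)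
  let ?s = "complex_of_real s"
  have sD: "?s \<in> ball 0 1" using s by simp
  have ss: "?s * ?s = of_real r" using s(4) by (metis of_real_mult)
  have "(h has_field_derivative deriv h ?s) (at ?s)" by (rule holomorphic_derivI[OF holh _ sD]) simp
  hence "((\<lambda>z. h z * h z) has_field_derivative 2 * h ?s * deriv h ?s) (at ?s)"
    by (auto intro!: derivative_eq_intros)
  moreover have "((\<lambda>z. f (z * z)) has_field_derivative deriv f (?s * ?s) * (2 * ?s)) (at ?s)"
    by (rule DERIV_chain'[of "\<lambda>z. z * z"])
       (auto intro!: derivative_eq_intros holomorphic_derivI[OF f(1) _ sqD[OF sD]])
  hence "((\<lambda>z. h z * h z) has_field_derivative deriv f (?s * ?s) * (2 * ?s)) (at ?s)"
    by (rule has_field_derivative_transform_within_open[OF _ open_ball[of 0 1] sD]) (use h2 in auto)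
  ultimately have "2 * h ?s * deriv h ?s = deriv f (?s * ?s) * (2 * ?s)" by (rule DERIV_unique)
  hence d: "h ?s * deriv h ?s = ?s * deriv f (of_real r)" by (simp add: ss)
  have hs: "h ?s \<noteq> 0" using s by (simp add: h_def)
  have "?s * deriv h ?s / h ?s = ?s * (h ?s * deriv h ?s) / (h ?s * h ?s)" using hs by simp
  also have "\<dots> = of_real r * deriv f (of_real r) / f (of_real r)"
    unfolding d h2[OF sD] ss[symmetric] by (simp add: mult.assoc)
  finally show ?thesis
    using odd_univalent_distortion[OF holh inj odd s(1,2)] s(3) by simp
qed

lemma schlicht_distortion:
  assumes "schlicht f" and z: "z \<noteq> 0" "cmod z < 1"
  shows "cmod (z * deriv f z / f z) \<le> (1 + cmod z) / (1 - cmod z)"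
proof -
  note f = schlichtD[OF assms(1)]
  define r where "r = cmod z"
  define u where "u = z / of_real r"
  have r: "0 < r" "r < 1" using z by (auto simp: r_def)
  have u: "cmod u = 1" "u * of_real r = z"
    using r by (auto simp: u_def r_def norm_divide)
  let ?g = "\<lambda>z. cnj u * f (u * z)"
  have "(f has_field_derivative deriv f z) (at (u * of_real r))"
    using holomorphic_derivI[OF f(1), of z] z u by simp
  hence "((\<lambda>z. f (u * z)) has_field_derivative deriv f z * u) (at (of_real r))"
    by (intro DERIV_chain'[of "\<lambda>z. u * z"]) (auto intro!: derivative_eq_intros)
  hence "(?g has_field_derivative cnj u * (deriv f z * u)) (at (of_real r))"
    by (rule DERIV_cmult)
  hence dg: "deriv ?g (of_real r) = cnj u * (deriv f z * u)" by (rule DERIV_imp_deriv)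
  have u0: "cnj u \<noteq> 0" using u(1) by auto
  have "of_real r * deriv ?g (of_real r) / ?g (of_real r) = z * deriv f z / f z"
    unfolding dg using u0 u(2) by (simp add: mult_ac)
  thus ?thesis using schlicht_distortion_real[OF schlicht_rotate[OF assms(1) u(1)] r] by (simp add: r_def)
qed

text \<open>At z = x u, z f'/f = 1 + z L', and (1 + x) / (1 - x) - 1 = 2 x / (1 - x). So the
  distortion theorem bounds the radial derivative of Re L by 2 / (1 - x), which the derivative of 2
  ln (1 - x) cancels. Admitting r = 0 brings in the normalisation at the origin.\<close>

lemma schlicht_growth_antimono:
  assumes "schlicht f" and L: "L holomorphic_on ball 0 1" "\<And>z. z \<in> ball 0 1 \<Longrightarrow> f z = z * exp (L z)"
    and u: "cmod u = 1" and rr: "0 \<le> r" "r \<le> r'" "r' < 1"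
  shows "Re (L (of_real r' * u)) + 2 * ln (1 - r') \<le> Re (L (of_real r * u)) + 2 * ln (1 - r)"
proof -
  note f = schlichtD[OF assms(1)]
  define \<psi> where "\<psi> = (\<lambda>r. Re (L (of_real r * u)) + 2 * ln (1 - r))"
  have inD: "of_real x * u \<in> ball 0 1" if "0 \<le> x" "x < 1" for x
    using that u by (simp add: norm_mult)
  have d: "(\<psi> has_real_derivative Re (deriv L (of_real x * u) * u) - 2 / (1 - x)) (at x)" if x: "0 \<le> x" "x < 1" for x
  proof -
    have 1: "(L has_field_derivative deriv L (of_real x * u)) (at (of_real x * u))"
      by (rule holomorphic_derivI[OF L(1) open_ball inD[OF x]])
    have "((\<lambda>x. of_real x * u) has_vector_derivative u) (at x)"
      by (auto intro!: derivative_eq_intros simp: has_vector_derivative_def scaleR_conv_of_real)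
    from field_vector_diff_chain_at[OF this 1]
    have "(L \<circ> (\<lambda>x. of_real x * u) has_vector_derivative u * deriv L (of_real x * u)) (at x)" .
    from bounded_linear.has_vector_derivative[OF bounded_linear_Re this]
    have "((\<lambda>x. Re (L (of_real x * u))) has_real_derivative Re (u * deriv L (of_real x * u))) (at x)"
      by (simp add: o_def has_real_derivative_iff_has_vector_derivative)
    moreover have "((\<lambda>x. 2 * ln (1 - x)) has_real_derivative - (2 / (1 - x))) (at x)"
      using x by (auto intro!: derivative_eq_intros)
    ultimately have "(\<psi> has_real_derivative Re (u * deriv L (of_real x * u)) + - (2 / (1 - x))) (at x)"
      unfolding \<psi>_def by (rule DERIV_add)
    thus ?thesis by (simp add: mult.commute)
  qed
  have neg: "Re (deriv L (of_real x * u) * u) - 2 / (1 - x) \<le> 0" if x: "0 < x" "x < 1" for x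
  proof -
    let ?z = "of_real x * u"
    have zD: "?z \<in> ball 0 1" using inD x by simp
    have z0: "?z \<noteq> 0" using x u by auto
    have cz: "cmod ?z = x" using x u by (simp add: norm_mult)
    have "(L has_field_derivative deriv L ?z) (at ?z)"
      by (rule holomorphic_derivI[OF L(1) open_ball zD])
    hence "((\<lambda>z. z * exp (L z)) has_field_derivative exp (L ?z) + ?z * (exp (L ?z) * deriv L ?z)) (at ?z)"
      by (auto intro!: derivative_eq_intros)
    hence "(f has_field_derivative exp (L ?z) + ?z * (exp (L ?z) * deriv L ?z)) (at ?z)"
      by (rule has_field_derivative_transform_within_open[OF _ open_ball[of 0 1] zD]) (use L in auto)
    hence "deriv f ?z = exp (L ?z) * (1 + ?z * deriv L ?z)" by (simp add: DERIV_imp_deriv algebra_simps)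
    hence "?z * deriv f ?z / f ?z = 1 + ?z * deriv L ?z" using L(2)[OF zD] z0 by simp
    hence "cmod (1 + ?z * deriv L ?z) \<le> (1 + x) / (1 - x)"
      using schlicht_distortion[OF assms(1) z0] x cz by simp
    hence "1 + Re (?z * deriv L ?z) \<le> (1 + x) / (1 - x)"
      using complex_Re_le_cmod[of "1 + ?z * deriv L ?z"] by simp
    moreover have "Re (?z * deriv L ?z) = x * Re (deriv L ?z * u)"
      by (simp add: mult.assoc mult.commute[of u])
    ultimately have "x * Re (deriv L ?z * u) \<le> x * (2 / (1 - x))" using x by (simp add: field_simps)
    hence "Re (deriv L ?z * u) \<le> 2 / (1 - x)" using x by (simp only: mult_le_cancel_left_pos)
    thus ?thesis by simp
  qed
  have "\<psi> r' \<le> \<psi> r"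
  proof (rule DERIV_nonpos_imp_decreasing_open[OF rr(2)])
    show "\<exists>y. (\<psi> has_real_derivative y) (at x) \<and> y \<le> 0" if "r < x" "x < r'" for x
      using d[of x] neg[of x] that rr by auto
    show "continuous_on {r..r'} \<psi>"
    proof (rule DERIV_atLeastAtMost_imp_continuous_on)
      show "\<exists>y. (\<psi> has_real_derivative y) (at x)" if "r \<le> x" "x \<le> r'" for x
        using d[of x] that rr by auto
    qed
  qed
  thus ?thesis by (simp add: \<psi>_def)
qed

section \<open>Maximum modulus and the Hayman index\<close>

lemma max_modulus_attained:
  assumes "continuous_on (sphere 0 r) f" "r > 0"
  shows "\<exists>u. cmod u = 1 \<and> cmod (f (of_real r * u)) = max_modulus r f"
    and "\<And>z. cmod z = r \<Longrightarrow> cmod (f z) \<le> max_modulus r f"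
proof -
  let ?S = "(\<lambda>z. norm (f z)) ` sphere 0 r"
  have c: "compact ?S" by (intro compact_continuous_image continuous_intros assms) simp
  have "of_real r \<in> sphere (0::complex) r" using assms(2) by simp
  hence ne: "?S \<noteq> {}" by blast
  have bdd: "bdd_above ?S" by (intro bounded_imp_bdd_above compact_imp_bounded c)
  show "cmod (f z) \<le> max_modulus r f" if "cmod z = r" for z
    unfolding max_modulus_def by (rule cSUP_upper[OF _ bdd]) (use that in simp)
  have "Sup ?S \<in> ?S" by (rule closed_contains_Sup[OF ne bdd]) (rule compact_imp_closed[OF c])
  then obtain z where z: "cmod z = r" "cmod (f z) = max_modulus r f"
    unfolding max_modulus_def by auto
  show "\<exists>u. cmod u = 1 \<and> cmod (f (of_real r * u)) = max_modulus r f"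
    by (rule exI[of _ "z / of_real r"]) (use z assms(2) in \<open>auto simp: norm_divide\<close>)
qed

text \<open>Division by r leaves the limit at 1 unchanged but makes the quantity decreasing on the
  whole interval; for the Koebe function it is constantly 1.\<close>

definition growth :: "(complex \<Rightarrow> complex) \<Rightarrow> real \<Rightarrow> real" where
  "growth f r = (1 - r)\<^sup>2 * max_modulus r f / r"

lemma schlicht_growth_along_ray:
  assumes "schlicht f" and u: "cmod u = 1" and rr: "0 < r" "r \<le> r'" "r' < 1"
  shows "(1 - r')\<^sup>2 * cmod (f (of_real r' * u)) / r' \<le> (1 - r)\<^sup>2 * cmod (f (of_real r * u)) / r"
proof -
  obtain L where L: "L holomorphic_on ball 0 1" "\<And>z. z \<in> ball 0 1 \<Longrightarrow> f z = z * exp (L z)"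
    using schlicht_logarithm[OF assms(1)] by auto
  have *: "(1 - x)\<^sup>2 * cmod (f (of_real x * u)) / x = exp (Re (L (of_real x * u)) + 2 * ln (1 - x))"
    if "0 < x" "x < 1" for x
  proof -
    have "of_real x * u \<in> ball 0 1" using that u by (simp add: norm_mult)
    hence "cmod (f (of_real x * u)) = x * exp (Re (L (of_real x * u)))"
      using that u by (simp add: L(2) norm_mult)
    moreover have "exp (2 * ln (1 - x)) = (1 - x)\<^sup>2"
      using that by (simp add: exp_double)
    ultimately show ?thesis using that by (simp add: exp_add)
  qed
  show ?thesis
    using schlicht_growth_antimono[OF assms(1) L u _ rr(2,3)] rr *[of r] *[of r'] by simp
qed

lemma schlicht_continuous_sphere:
  assumes "schlicht f" "r < 1"
  shows "continuous_on (sphere 0 r) f"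
  using assms by (intro continuous_on_subset[OF holomorphic_on_imp_continuous_on[OF schlichtD(1)]]) auto

lemma growth_ray_le:
  assumes "schlicht f" "0 < r" "r < 1" "cmod u = 1"
  shows "(1 - r)\<^sup>2 * cmod (f (of_real r * u)) / r \<le> growth f r"
  unfolding growth_def
  using max_modulus_attained(2)[OF schlicht_continuous_sphere[OF assms(1,3)] assms(2), of "of_real r * u"] assms
  by (intro divide_right_mono mult_left_mono) (auto simp: norm_mult)

text \<open>Follow the ray through a point of maximal modulus on the larger circle inwards.\<close>

lemma growth_antimono:
  assumes "schlicht f" "0 < r" "r \<le> r'" "r' < 1"
  shows "growth f r' \<le> growth f r"
proof -
  obtain u where u: "cmod u = 1" "cmod (f (of_real r' * u)) = max_modulus r' f"
    using max_modulus_attained(1)[OF schlicht_continuous_sphere[OF assms(1,4)]] assms by auto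
  have "growth f r' = (1 - r')\<^sup>2 * cmod (f (of_real r' * u)) / r'" by (simp add: growth_def u)
  also have "\<dots> \<le> (1 - r)\<^sup>2 * cmod (f (of_real r * u)) / r"
    by (rule schlicht_growth_along_ray[OF assms(1) u(1) assms(2-4)])
  also have "\<dots> \<le> growth f r" by (rule growth_ray_le) (use assms u in auto)
  finally show ?thesis .
qed

lemma growth_nonneg:
  assumes "schlicht f" "0 < r" "r < 1"
  shows "0 \<le> growth f r"
proof -
  have "0 \<le> (1 - r)\<^sup>2 * cmod (f (of_real r * 1)) / r" using assms by simp
  also have "\<dots> \<le> growth f r" by (rule growth_ray_le[OF assms]) simp
  finally show ?thesis .
qed

lemma growth_pos:
  assumes "schlicht f" "0 < r" "r < 1"
  shows "0 < growth f r"
proof -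
  have "f (of_real r) \<noteq> f 0"
    using inj_onD[OF schlichtD(2)[OF assms(1)], of "of_real r" 0] assms by auto
  hence "0 < (1 - r)\<^sup>2 * cmod (f (of_real r * 1)) / r" using assms schlichtD(3)[OF assms(1)] by simp
  also have "\<dots> \<le> growth f r" by (rule growth_ray_le[OF assms]) simp
  finally show ?thesis .
qed

text \<open>A decreasing function bounded below tends to its infimum. Existence of this limit is
  what makes the \<open>Lim\<close> in \<open>hayman_index\<close> meaningful, and the infimum
  property supplies the one-sided comparison at every radius.\<close>

lemma growth_tendsto_hayman:
  assumes "schlicht f"
  shows "(growth f \<longlongrightarrow> hayman_index f) (at_left 1)"
    and "\<And>r. 0 < r \<Longrightarrow> r < 1 \<Longrightarrow> hayman_index f \<le> growth f r" and "0 \<le> hayman_index f"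
proof -
  define \<alpha> where "\<alpha> = Inf (growth f ` {0<..<1})"
  have bdd: "bdd_below (growth f ` {0<..<1})"
    using growth_nonneg[OF assms] by (intro bdd_belowI[of _ 0]) auto
  have le: "\<alpha> \<le> growth f r" if "0 < r" "r < 1" for r
    unfolding \<alpha>_def by (rule cINF_lower[OF bdd]) (use that in auto)
  have lim: "(growth f \<longlongrightarrow> \<alpha>) (at_left 1)"
  proof (rule tendstoI)
    fix e :: real assume e: "e > 0"
    have "\<exists>r\<in>{0<..<1}. growth f r < \<alpha> + e"
    proof (rule ccontr)
      assume "\<not> ?thesis"
      hence "\<alpha> + e \<le> \<alpha>" unfolding \<alpha>_def by (intro cINF_greatest) (auto simp: not_less \<alpha>_def)
      thus False using e by simp
    qed
    then obtain r where r: "0 < r" "r < 1" "growth f r < \<alpha> + e" by auto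
    have "eventually (\<lambda>x. r < x \<and> x < 1) (at_left (1::real))"
      using r by (auto simp: eventually_at_left_field)
    thus "eventually (\<lambda>x. dist (growth f x) \<alpha> < e) (at_left 1)"
    proof eventually_elim
      case (elim x)
      hence "growth f x \<le> growth f r" by (intro growth_antimono assms r) auto
      thus ?case using le[of x] r elim by (auto simp: dist_real_def)
    qed
  qed
  have "((\<lambda>r. r * growth f r) \<longlongrightarrow> 1 * \<alpha>) (at_left 1)"
    by (intro tendsto_mult lim tendsto_ident_at)
  moreover have "eventually (\<lambda>r. r * growth f r = (1 - r)^2 * max_modulus r f) (at_left (1::real))"
  proof -
    have "eventually (\<lambda>x. 0 < x \<and> x < 1) (at_left (1::real))" by (auto simp: eventually_at_left_field intro: exI[of _ 0])
    thus ?thesis by eventually_elim (auto simp: growth_def)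
  qed
  ultimately have "((\<lambda>r. (1 - r)^2 * max_modulus r f) \<longlongrightarrow> \<alpha>) (at_left 1)"
    by (simp add: tendsto_cong)
  hence eq: "hayman_index f = \<alpha>" unfolding hayman_index_def by (intro tendsto_Lim) auto
  show "(growth f \<longlongrightarrow> hayman_index f) (at_left 1)" using lim eq by simp
  show "\<And>r. 0 < r \<Longrightarrow> r < 1 \<Longrightarrow> hayman_index f \<le> growth f r" using le eq by simp
  show "0 \<le> hayman_index f" unfolding eq \<alpha>_def
    by (rule cINF_greatest) (use growth_nonneg[OF assms] in auto)
qed

lemma max_modulus_tendsto:
  assumes fs: "\<And>m. continuous_on (sphere 0 r) (fs m)" and f: "continuous_on (sphere 0 r) f" and r: "r > 0"
    and lim: "uniform_limit (sphere 0 r) fs f sequentially"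
  shows "(\<lambda>m. max_modulus r (fs m)) \<longlonglongrightarrow> max_modulus r f"
proof (rule tendstoI)
  fix e :: real assume e: "e > 0"
  have "eventually (\<lambda>m. \<forall>z\<in>sphere 0 r. dist (fs m z) (f z) < e) sequentially"
    using lim e by (auto dest: uniform_limitD)
  thus "eventually (\<lambda>m. dist (max_modulus r (fs m)) (max_modulus r f) < e) sequentially"
  proof eventually_elim
    case (elim m)
    have less: "max_modulus r g < max_modulus r h + e"
      if gh: "continuous_on (sphere 0 r) g" "continuous_on (sphere 0 r) h" "\<And>z. z \<in> sphere 0 r \<Longrightarrow> dist (g z) (h z) < e" for g h
    proof -
      obtain u where u: "cmod u = 1" "cmod (g (of_real r * u)) = max_modulus r g"
        using max_modulus_attained(1)[OF gh(1) r] by auto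
      have ru: "cmod (of_real r * u) = r" using u r by (simp add: norm_mult)
      have "cmod (g (of_real r * u)) < cmod (h (of_real r * u)) + e"
        using gh(3)[of "of_real r * u"] ru norm_triangle_ineq2[of "g (of_real r * u)" "h (of_real r * u)"]
        by (simp add: dist_norm)
      also have "cmod (h (of_real r * u)) \<le> max_modulus r h"
        by (rule max_modulus_attained(2)[OF gh(2) r ru])
      finally show ?thesis using u by simp
    qed
    have "max_modulus r (fs m) < max_modulus r f + e" by (rule less) (use fs f elim in auto)
    moreover have "max_modulus r f < max_modulus r (fs m) + e"
      by (rule less) (use fs f elim in \<open>auto simp: dist_commute\<close>)
    ultimately show ?case by (simp add: dist_real_def abs_less_iff)
  qed
qed

subsection \<open>The Dirichlet integral of the two-point logarithm\<close>

lemma sin_neq_0_strip: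
  assumes "0 < y" "y < 2 * pi" "y \<noteq> pi"
  shows "sin y \<noteq> 0"
  using assms sin_gt_zero[of y] sin_lt_zero[of y] by (cases "y < pi") auto

text \<open>Under z = exp t the integrand |F'|^2 becomes |z F'|^2, and the coefficients of z F' are
  k times those of F. The real diameter is deleted because only non-real points are shown to be
  covered by the slit coordinate used later.\<close>

lemma Dirichlet_coefficients:
  assumes F: "F holomorphic_on ball 0 1"
    and le: "(\<integral>\<^sup>+z. ennreal ((cmod (deriv F z))\<^sup>2) * indicator {z. cmod z < 1 \<and> Im z \<noteq> 0} z \<partial>lborel) \<le> ennreal I"
    and I: "0 \<le> I"
  shows "pi * (\<Sum>k=1..K. real k * (cmod (taylor_coeff F k))\<^sup>2) \<le> I"
proof -
  define c where "c = (\<lambda>k. of_nat k * taylor_coeff F k)"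
  define u where "u = (\<lambda>z. z * deriv F z)"
  have hdF: "deriv F holomorphic_on ball 0 1" by (rule holomorphic_deriv[OF F]) simp
  have u: "(\<lambda>k. c k * z ^ k) sums u z" if "cmod z < 1" for z
  proof -
    have "(\<lambda>n. (deriv ^^ n) (deriv F) 0 / fact n * (z - 0) ^ n) sums deriv F z"
      by (rule holomorphic_power_series[OF hdF]) (use that in simp)
    hence "(\<lambda>n. z * ((deriv ^^ n) (deriv F) 0 / fact n * z ^ n)) sums (z * deriv F z)"
      by (intro sums_mult) simp
    moreover have "z * ((deriv ^^ n) (deriv F) 0 / fact n * z ^ n) = c (Suc n) * z ^ Suc n" for n
      by (simp add: c_def taylor_coeff_def funpow_Suc_right del: funpow.simps of_nat_Suc)
    ultimately have "(\<lambda>n. c (Suc n) * z ^ Suc n) sums u z" by (simp add: u_def)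
    thus ?thesis by (subst (asm) sums_Suc_iff) (simp add: c_def)
  qed
  define R where "R = {z. cmod z < 1 \<and> Im z \<noteq> 0}"
  have oR: "open R" unfolding R_def by (intro open_Collect_conj open_Collect_less open_Collect_neq continuous_intros)
  have fin: "pi * (\<Sum>k=1..K. real k * (cmod (taylor_coeff F k))\<^sup>2 * (1 - exp (2*real k*a))) \<le> I" if a: "a < 0" for a :: real
  proof -
    define S where "S = {t. a < Re t \<and> Re t < 0 \<and> 0 < Im t \<and> Im t < 2 * pi \<and> Im t \<noteq> pi}"
    have oS: "open S" unfolding S_def by (rule open_punctured_strip)
    have injS: "inj_on exp S" by (rule inj_on_exp_strip[of _ 0]) (auto simp: S_def)
    have expS: "exp t \<in> R" if t: "t \<in> S" for t
    proof -
      have "sin (Im t) \<noteq> 0" using t by (intro sin_neq_0_strip) (auto simp: S_def)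
      thus ?thesis using t by (auto simp: R_def S_def Im_exp)
    qed
    have cF: "continuous_on (exp ` S) (\<lambda>z. (cmod (deriv F z))\<^sup>2)"
      by (intro continuous_intros continuous_on_subset[OF holomorphic_on_imp_continuous_on[OF hdF]])
         (use expS in \<open>auto simp: R_def\<close>)
    have "ennreal (2 * pi * (cmod (c 0))\<^sup>2 * (0 - a) + pi * (\<Sum>k=1..K. (cmod (c k))\<^sup>2 / k * (exp (2*real k*(0::real)) - exp (2*real k*a))))
       \<le> (\<integral>\<^sup>+t. ennreal ((cmod (u (exp t)))\<^sup>2) * indicator S t \<partial>lborel)"
      by (rule nn_integral_strip_Bessel[OF u _ _ S_def]) (use a in auto)
    also have "\<dots> = (\<integral>\<^sup>+t. ennreal ((cmod (deriv exp t))\<^sup>2 * (cmod (deriv F (exp t)))\<^sup>2) * indicator S t \<partial>lborel)"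
      by (intro nn_integral_cong) (simp add: u_def norm_mult power_mult_distrib DERIV_imp_deriv[OF DERIV_exp])
    also have "\<dots> = (\<integral>\<^sup>+z. ennreal ((cmod (deriv F z))\<^sup>2) * indicator (exp ` S) z \<partial>lborel)"
      by (rule nn_integral_image_holomorphic[symmetric, OF oS _ injS cF]) (auto intro: holomorphic_intros)
    also have "\<dots> \<le> (\<integral>\<^sup>+z. ennreal ((cmod (deriv F z))\<^sup>2) * indicator R z \<partial>lborel)"
      by (intro nn_integral_mono mult_left_mono) (use expS in \<open>auto simp: indicator_def\<close>)
    also have "\<dots> \<le> ennreal I" using le by (simp add: R_def)
    finally have "2 * pi * (cmod (c 0))\<^sup>2 * (0 - a) + pi * (\<Sum>k=1..K. (cmod (c k))\<^sup>2 / k * (exp (2*real k*(0::real)) - exp (2*real k*a))) \<le> I"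
      using I by (subst (asm) ennreal_le_iff) auto
    moreover have "(cmod (c k))\<^sup>2 / k * (exp (2*real k*(0::real)) - exp (2*real k*a)) = real k * (cmod (taylor_coeff F k))\<^sup>2 * (1 - exp (2*real k*a))"
      if "k \<in> {1..K}" for k
      using that by (simp add: c_def norm_mult power2_eq_square)
    hence "(\<Sum>k=1..K. (cmod (c k))\<^sup>2 / k * (exp (2*real k*(0::real)) - exp (2*real k*a))) = (\<Sum>k=1..K. real k * (cmod (taylor_coeff F k))\<^sup>2 * (1 - exp (2*real k*a)))"
      by (intro sum.cong) auto
    ultimately show ?thesis by (simp add: c_def)
  qed
  have "((\<lambda>a. pi * (\<Sum>k=1..K. real k * (cmod (taylor_coeff F k))\<^sup>2 * (1 - exp (2*real k*a)))) \<longlongrightarrow>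
      pi * (\<Sum>k=1..K. real k * (cmod (taylor_coeff F k))\<^sup>2 * 1)) at_bot"
    by (intro tendsto_mult tendsto_const tendsto_exp_weight_sum)
  moreover have "eventually (\<lambda>a. pi * (\<Sum>k=1..K. real k * (cmod (taylor_coeff F k))\<^sup>2 * (1 - exp (2*real k*a))) \<le> I) at_bot"
    using eventually_gt_at_bot[of 0] by (metis (mono_tags, lifting) eventually_at_bot_linorder fin less_minus_one_simps(1) order_le_less_trans)
  ultimately have "pi * (\<Sum>k=1..K. real k * (cmod (taylor_coeff F k))\<^sup>2 * 1) \<le> I"
    by (intro tendsto_upperbound[where F = at_bot]) auto
  thus ?thesis by simp
qed

text \<open>The coordinate is \<open>exp t = z / ((z - s) (1 - s z))\<close>, which tends to the Koebe function as \<open>s\<close> tends to \<open>1\<close>.\<close>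

lemma two_point_logarithm_bound:
  fixes s :: real
  assumes f: "schlicht f" and s: "0 < s" "s < 1"
    and L: "L holomorphic_on ball 0 1" "\<And>z. z \<in> ball 0 1 \<Longrightarrow> f z = z * exp (L z)"
  shows "\<exists>F. F holomorphic_on ball 0 1 \<and>
     (\<forall>z\<in>ball 0 1. exp (F z) * (f z - f (of_real s)) = exp (L z) * (z - of_real s) * (1 - of_real s * z)) \<and>
     (\<forall>K. (\<Sum>k=1..K. real k * (cmod (taylor_coeff F k))\<^sup>2)
        \<le> max 0 (2 * ln (s\<^sup>2 * cmod (deriv f (of_real s)) / ((cmod (f (of_real s)))\<^sup>2 * (1 - s\<^sup>2)))))"
proof -
  let ?D = "ball 0 1 :: complex set"
  let ?s = "complex_of_real s"
  note fD = schlichtD[OF f]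
  have sD: "?s \<in> ?D" "0 \<in> ?D" using s by auto
  have s0: "0 \<noteq> ?s" using s by simp
  have s1: "s\<^sup>2 < 1" using s by (simp add: abs_square_less_1)
  have den: "1 - ?s * z \<noteq> 0" "1 - s \<le> cmod (1 - ?s * z)" if "z \<in> ?D" for z
  proof -
    have "cmod (?s * z) \<le> s * 1" unfolding norm_mult using that s by (intro mult_mono) auto
    moreover have "1 - cmod (?s * z) \<le> cmod (1 - ?s * z)" using norm_triangle_ineq2[of 1 "?s * z"] by simp
    ultimately show "1 - s \<le> cmod (1 - ?s * z)" by simp
    thus "1 - ?s * z \<noteq> 0" using s by auto
  qed
  have nz: "diff_quot f ?s z \<noteq> 0" if "z \<in> ?D" for z
    using diff_quot_nonzero[OF fD(1) _ fD(2) sD(1) that] by simp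
  \<comment> \<open>f / (f - f s) divided by z / ((z - s) (1 - s z)), with the common zero and pole
    cancelled.\<close>
  define G where "G = (\<lambda>z. exp (L z) / diff_quot f ?s z * (1 - ?s * z))"
  have holG: "G holomorphic_on ?D" unfolding G_def
    by (intro holomorphic_intros holomorphic_diff_quot fD(1) L(1)) (use nz in auto)
  have Gnz: "G z \<noteq> 0" if "z \<in> ?D" for z using nz[OF that] den[OF that] by (simp add: G_def)
  obtain F where F: "F holomorphic_on ?D" "\<And>z. z \<in> ?D \<Longrightarrow> exp (F z) = G z"
    using disc_logarithm[OF holG Gnz] by blast
  have Feq: "exp (F z) * (f z - f ?s) = exp (L z) * (z - ?s) * (1 - ?s * z)" if z: "z \<in> ?D" for z
  proof -
    have "f z - f ?s = (z - ?s) * diff_quot f ?s z" by (simp add: diff_quot_mult)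
    thus ?thesis unfolding F(2)[OF z] G_def using nz[OF z] by simp
  qed
  have fne: "f z \<noteq> f ?s" if "z \<in> ?D" "z \<noteq> ?s" for z using inj_onD[OF fD(2) _ that(1) sD(1)] that(2) by blast
  have fs0: "f ?s \<noteq> 0" using fne[of 0] sD s0 fD(3) by auto
  have ds: "deriv f ?s \<noteq> 0" using nz[OF sD(1)] by (simp add: diff_quot_def)
  obtain J where J: "J holomorphic_on {s. Im s \<noteq> 0 \<or> \<bar>Re s\<bar> > 2}"
    "\<And>s. Im s \<noteq> 0 \<or> \<bar>Re s\<bar> > 2 \<Longrightarrow> J s \<in> ball 0 1 - {0} \<and> J s + 1 / J s = s"
    "\<And>z. z \<in> ball 0 1 - {0} \<Longrightarrow> J (z + 1 / z) = z"
    using joukowski_inverse by blast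
  define X where "X = {t. 0 < Im t \<and> Im t < 2 * pi}"
  have oX: "open X" unfolding X_def by (intro open_Collect_conj open_halfspace_Im_gt open_halfspace_Im_lt)
  \<comment> \<open>From (z - s) (1 - s z) = z ((1 + s^2) - s (z + 1/z)), which the coordinate
    equation sets equal to z exp (-t); solve for z + 1/z.\<close>
  define w where "w = (\<lambda>t. of_real ((1 + s\<^sup>2) / s) - exp (- t) / ?s)"
  define \<kappa> where "\<kappa> = (\<lambda>t. J (w t))"
  \<comment> \<open>In the strip exp (-t) is real only for Im t = pi, where it is negative; then w t
    is real and exceeds (1 + s^2) / s > 2, beyond the slit [-2, 2].\<close>
  have wdom: "Im (w t) \<noteq> 0 \<or> \<bar>Re (w t)\<bar> > 2" if t: "t \<in> X" for t
  proof (cases "Im t = pi")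
    case True
    have "exp (- t) = of_real (- exp (- Re t))"
      using True by (simp add: complex_eq_iff Re_exp Im_exp)
    hence "Re (w t) = (1 + s\<^sup>2) / s + exp (- Re t) / s" unfolding w_def by simp
    moreover have "2 < (1 + s\<^sup>2) / s"
    proof -
      have "0 < (1 - s)\<^sup>2" using s by simp
      hence "2 * s < 1 + s\<^sup>2" by (simp add: power2_eq_square algebra_simps)
      thus ?thesis using s by (simp add: field_simps)
    qed
    moreover have "exp (- Re t) / s > 0" using s by simp
    ultimately show ?thesis by linarith
  next
    case False
    have "sin (Im t) \<noteq> 0" using t False by (intro sin_neq_0_strip) (auto simp: X_def)
    thus ?thesis using s by (simp add: w_def Im_exp)
  qed
  have kD: "\<kappa> t \<in> ?D" "\<kappa> t \<noteq> 0" and kw: "\<kappa> t + 1 / \<kappa> t = w t" if "t \<in> X" for t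
    using J(2)[OF wdom[OF that]] by (auto simp: \<kappa>_def)
  have key: "\<kappa> t = exp t * ((\<kappa> t - ?s) * (1 - ?s * \<kappa> t))" if t: "t \<in> X" for t
  proof -
    let ?z = "\<kappa> t"
    have "(?z - ?s) * (1 - ?s * ?z) = ?z * ((1 + ?s\<^sup>2) - ?s * (?z + 1 / ?z))"
      using kD(2)[OF t] by (simp add: field_simps power2_eq_square)
    also have "\<dots> = ?z * exp (- t)"
      unfolding kw[OF t] using s by (simp add: w_def field_simps)
    finally show ?thesis by (simp add: exp_minus)
  qed
  have ne: "\<kappa> t \<noteq> ?s" if t: "t \<in> X" for t using key[OF t] s0 by auto
  have kh: "\<kappa> holomorphic_on X"
  proof -
    have "w holomorphic_on X" unfolding w_def by (intro holomorphic_intros) (use s in auto)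
    moreover have "w ` X \<subseteq> {s. Im s \<noteq> 0 \<or> \<bar>Re s\<bar> > 2}"
      using wdom by (intro image_subsetI) simp
    ultimately have "J \<circ> w holomorphic_on X" by (intro holomorphic_on_compose_gen[OF _ J(1)])
    thus ?thesis by (simp add: \<kappa>_def o_def)
  qed
  have kinj: "inj_on \<kappa> X"
  proof (rule inj_onI)
    fix x y assume x: "x \<in> X" and y: "y \<in> X" and eq: "\<kappa> x = \<kappa> y"
    have "(\<kappa> x - ?s) * (1 - ?s * \<kappa> x) \<noteq> 0" using ne[OF x] den[OF kD(1)[OF x]] by simp
    hence "exp x = exp y" using key[OF x] key[OF y] eq by (metis mult_right_cancel)
    moreover have "\<bar>Im x - Im y\<bar> < 2 * pi" using x y by (auto simp: X_def)
    ultimately show "x = y" using exp_complex_eqI by blast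
  qed
  have kimg: "\<kappa> t \<in> ?D - {0, ?s}" if "t \<in> X" for t using kD[OF that] ne[OF that] by auto
  have keq: "exp (t + F (\<kappa> t)) = (f (\<kappa> t) - f 0) / (f (\<kappa> t) - f ?s)" if t: "t \<in> X" for t
  proof -
    have "f (\<kappa> t) - f ?s \<noteq> 0" using fne[OF kD(1)[OF t] ne[OF t]] by simp
    moreover have "exp t * exp (F (\<kappa> t)) * (f (\<kappa> t) - f ?s) = f (\<kappa> t)"
    proof -
      have "exp t * (exp (F (\<kappa> t)) * (f (\<kappa> t) - f ?s)) = exp (L (\<kappa> t)) * (exp t * ((\<kappa> t - ?s) * (1 - ?s * \<kappa> t)))"
        unfolding Feq[OF kD(1)[OF t]] by (simp add: mult_ac)
      also have "\<dots> = f (\<kappa> t)" unfolding key[OF t, symmetric] L(2)[OF kD(1)[OF t]] by simp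
      finally show ?thesis by (simp add: mult_ac)
    qed
    ultimately show ?thesis using fD(3) by (simp add: exp_add field_simps)
  qed
  have near: "\<exists>\<delta>>0. \<forall>z\<in>?D. cmod (z - p) < \<delta> \<longrightarrow> \<bar>Re (F z) - Re (F p)\<bar> < \<eta>" if p: "p \<in> ?D" and "\<eta> > 0" for p \<eta>
  proof -
    have "continuous (at p within ?D) F"
      using holomorphic_on_imp_continuous_on[OF F(1)] p by (auto simp: continuous_on_eq_continuous_within)
    then obtain d where d: "d > 0" "\<And>z. z \<in> ?D \<Longrightarrow> dist z p < d \<Longrightarrow> dist (F z) (F p) < \<eta>"
      using \<open>\<eta> > 0\<close> unfolding continuous_within_eps_delta by metis
    have "\<bar>Re (F z) - Re (F p)\<bar> < \<eta>" if "z \<in> ?D" "cmod (z - p) < d" for z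
      using d(2)[OF that(1)] that(2) abs_Re_le_cmod[of "F z - F p"] by (simp add: dist_norm)
    thus ?thesis using d(1) by blast
  qed
  have lim_p: "\<exists>A. \<forall>t\<in>X. Re t \<le> A \<longrightarrow> \<bar>Re (F (\<kappa> t)) - Re (F 0)\<bar> < \<eta>" if eta: "\<eta> > 0" for \<eta>
  proof -
    obtain \<delta> where \<delta>: "\<delta> > 0" "\<And>z. z \<in> ?D \<Longrightarrow> cmod (z - 0) < \<delta> \<Longrightarrow> \<bar>Re (F z) - Re (F 0)\<bar> < \<eta>"
      using near[OF sD(2) eta] by blast
    \<comment> \<open>Both factors |z - s| and |1 - s z| are at most 2, so |\<kappa> t| \<le> 4 exp
      (Re t); the 5 makes the inequality strict.\<close>
    have "\<bar>Re (F (\<kappa> t)) - Re (F 0)\<bar> < \<eta>" if t: "t \<in> X" "Re t \<le> ln (\<delta> / 5)" for t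
    proof (rule \<delta>(2)[OF kD(1)[OF t(1)]])
      have "cmod (\<kappa> t) < 1" using kD(1)[OF t(1)] by simp
      have "cmod (\<kappa> t - ?s) \<le> 2" using norm_triangle_ineq4[of "\<kappa> t" ?s] \<open>cmod (\<kappa> t) < 1\<close> s by simp
      moreover have "cmod (?s * \<kappa> t) \<le> 1 * 1"
        unfolding norm_mult using \<open>cmod (\<kappa> t) < 1\<close> s by (intro mult_mono) auto
      hence "cmod (1 - ?s * \<kappa> t) \<le> 2" using norm_triangle_ineq4[of 1 "?s * \<kappa> t"] by simp
      ultimately have "cmod (\<kappa> t - ?s) * cmod (1 - ?s * \<kappa> t) \<le> 2 * 2" by (intro mult_mono) auto
      moreover have "exp (Re t) \<le> \<delta> / 5" using t(2) \<delta>(1) by (metis exp_le_cancel_iff exp_ln divide_pos_pos zero_less_numeral)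
      ultimately have "exp (Re t) * (cmod (\<kappa> t - ?s) * cmod (1 - ?s * \<kappa> t)) \<le> \<delta> / 5 * 4"
        using \<delta>(1) by (intro mult_mono) auto
      moreover have "cmod (\<kappa> t) = exp (Re t) * (cmod (\<kappa> t - ?s) * cmod (1 - ?s * \<kappa> t))"
        by (subst key[OF t(1)]) (simp add: norm_mult)
      ultimately show "cmod (\<kappa> t - 0) < \<delta>" using \<delta>(1) by simp
    qed
    thus ?thesis by blast
  qed
  have lim_q: "\<exists>B. \<forall>t\<in>X. B \<le> Re t \<longrightarrow> \<bar>Re (F (\<kappa> t)) - Re (F ?s)\<bar> < \<eta>" if eta: "\<eta> > 0" for \<eta>
  proof -
    obtain \<delta> where \<delta>: "\<delta> > 0" "\<And>z. z \<in> ?D \<Longrightarrow> cmod (z - ?s) < \<delta> \<Longrightarrow> \<bar>Re (F z) - Re (F ?s)\<bar> < \<eta>"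
      using near[OF sD(1) eta] by blast
    have "\<bar>Re (F (\<kappa> t)) - Re (F ?s)\<bar> < \<eta>" if t: "t \<in> X" "- ln (\<delta> * (1 - s)) \<le> Re t" for t
    proof (rule \<delta>(2)[OF kD(1)[OF t(1)]])
      have e: "exp (- Re t) \<le> \<delta> * (1 - s)"
        using t(2) \<delta>(1) s by (metis diff_gt_0_iff_gt exp_le_cancel_iff exp_ln minus_le_iff mult_pos_pos)
      have "cmod (\<kappa> t) < 1" using kD(1)[OF t(1)] by simp
      have "cmod (\<kappa> t) = exp (Re t) * (cmod (\<kappa> t - ?s) * cmod (1 - ?s * \<kappa> t))"
        by (subst key[OF t(1)]) (simp add: norm_mult)
      hence "cmod (\<kappa> t - ?s) * cmod (1 - ?s * \<kappa> t) = exp (- Re t) * cmod (\<kappa> t)"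
        by (simp add: exp_minus field_simps)
      also have "\<dots> < exp (- Re t) * 1" using \<open>cmod (\<kappa> t) < 1\<close> by (intro mult_strict_left_mono) auto
      finally have "cmod (\<kappa> t - ?s) * cmod (1 - ?s * \<kappa> t) < \<delta> * (1 - s)" using e by simp
      moreover have "cmod (\<kappa> t - ?s) * (1 - s) \<le> cmod (\<kappa> t - ?s) * cmod (1 - ?s * \<kappa> t)"
        by (intro mult_left_mono den kD t) auto
      ultimately have "cmod (\<kappa> t - ?s) * (1 - s) < \<delta> * (1 - s)" by simp
      thus "cmod (\<kappa> t - ?s) < \<delta>" using s by simp
    qed
    thus ?thesis by blast
  qed
  define d where "d = Re (F 0) - Re (F ?s)"
  have area: "(\<integral>\<^sup>+t. ennreal ((cmod (deriv (\<lambda>t. F (\<kappa> t)) t))\<^sup>2) * indicator X t \<partial>lborel) \<le> ennreal (2 * pi * d)"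
    unfolding d_def
    by (rule radial_inequality[OF fD(1,2) open_ball sD(2,1) s0 F(1) X_def kh kinj kimg lim_p lim_q keq])
  define R where "R = {z. cmod z < 1 \<and> Im z \<noteq> 0}"
  have RX: "R \<subseteq> \<kappa> ` X"
  proof
    fix z assume z: "z \<in> R"
    hence zD: "z \<in> ?D - {0}" "cmod z < 1" "Im z \<noteq> 0" by (auto simp: R_def)
    define q where "q = z / ((z - ?s) * (1 - ?s * z))"
    have zs: "z - ?s \<noteq> 0" using zD by auto
    have q0: "q \<noteq> 0" using zD zs den[of z] by (auto simp: q_def)
    have "1 / q = (z - ?s) * (1 - ?s * z) / z" using zD zs den[of z] by (simp add: q_def)
    also have "\<dots> = of_real (1 + s\<^sup>2) - ?s * (z + 1 / z)" using zD by (auto simp: field_simps power2_eq_square)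
    finally have iq: "1 / q = of_real (1 + s\<^sup>2) - ?s * (z + 1 / z)" .
    have "Im (1 / z) = - Im z / (cmod z)\<^sup>2" by (simp add: Im_divide cmod_power2)
    hence "Im (z + 1 / z) = Im z * (1 - 1 / (cmod z)\<^sup>2)" by (simp add: algebra_simps)
    moreover have "1 / (cmod z)\<^sup>2 > 1" using zD by (auto simp: abs_square_less_1)
    ultimately have "Im (z + 1 / z) \<noteq> 0" using zD by simp
    hence "Im (1 / q) \<noteq> 0" using s unfolding iq by simp
    hence Imq: "Im q \<noteq> 0" by (simp add: Im_divide)
    \<comment> \<open>The logarithm of q with imaginary part in (0, 2 pi): a principal logarithm of
      -q has imaginary part in (-pi, pi), the value pi being excluded as q is not real.\<close>
    define t where "t = Ln (- q) + pi * \<i>"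
    have "Im (Ln (- q)) \<noteq> pi" using Im_Ln_eq_pi[of "- q"] q0 Imq by auto
    hence tX: "t \<in> X" using mpi_less_Im_Ln[of "- q"] Im_Ln_le_pi[of "- q"] q0 by (auto simp: t_def X_def)
    have "exp t = q" using q0 by (simp add: t_def exp_add)
    hence "exp (- t) = 1 / q" by (simp add: exp_minus inverse_eq_divide)
    moreover have "?s * w t = of_real (1 + s\<^sup>2) - exp (- t)" unfolding w_def using s by (simp add: right_diff_distrib)
    ultimately have "?s * w t = ?s * (z + 1 / z)" unfolding iq by simp
    hence "w t = z + 1 / z" using s by (metis mult_left_cancel s0)
    hence "\<kappa> t = z" unfolding \<kappa>_def using J(3)[OF zD(1)] by simp
    thus "z \<in> \<kappa> ` X" using tX by blast
  qed
  have hdF: "continuous_on ?D (\<lambda>z. (cmod (deriv F z))\<^sup>2)" by (rule continuous_on_cmod_deriv(1)[OF F(1)]) simp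
  have dW: "deriv (\<lambda>t. F (\<kappa> t)) t = deriv F (\<kappa> t) * deriv \<kappa> t" if t: "t \<in> X" for t
    by (rule DERIV_imp_deriv, rule DERIV_chain'[OF holomorphic_derivI[OF kh oX t] holomorphic_derivI[OF F(1) open_ball kD(1)[OF t]]])
  have "(\<integral>\<^sup>+z. ennreal ((cmod (deriv F z))\<^sup>2) * indicator R z \<partial>lborel) \<le> (\<integral>\<^sup>+z. ennreal ((cmod (deriv F z))\<^sup>2) * indicator (\<kappa> ` X) z \<partial>lborel)"
    by (intro nn_integral_mono mult_left_mono) (use RX in \<open>auto simp: indicator_def\<close>)
  also have "\<dots> = (\<integral>\<^sup>+t. ennreal ((cmod (deriv \<kappa> t))\<^sup>2 * (cmod (deriv F (\<kappa> t)))\<^sup>2) * indicator X t \<partial>lborel)"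
    by (rule nn_integral_image_holomorphic[OF oX kh kinj continuous_on_subset[OF hdF]]) (use kD in auto)
  also have "\<dots> = (\<integral>\<^sup>+t. ennreal ((cmod (deriv (\<lambda>t. F (\<kappa> t)) t))\<^sup>2) * indicator X t \<partial>lborel)"
    by (intro nn_integral_cong) (auto simp: indicator_def dW norm_mult power_mult_distrib mult.commute)
  \<comment> \<open>\<open>ennreal\<close> sends negative numbers to 0, so the sign of
    \<open>d\<close> is left open at this point.\<close>
  also have "\<dots> \<le> ennreal (max 0 (2 * pi * d))" using area by (rule order_trans) (auto intro: ennreal_leI)
  finally have dir: "(\<integral>\<^sup>+z. ennreal ((cmod (deriv F z))\<^sup>2) * indicator R z \<partial>lborel) \<le> ennreal (max 0 (2 * pi * d))" .
  have "exp (Re (F 0)) = s / cmod (f ?s)"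
  proof -
    have "exp (F 0) * (- f ?s) = exp (L 0) * (- ?s)" using Feq[OF sD(2)] fD(3) by simp
    moreover have "cmod (exp (L 0)) = 1"
    proof -
      have "(L has_field_derivative deriv L 0) (at 0)" by (rule holomorphic_derivI[OF L(1) open_ball sD(2)])
      hence "((\<lambda>z. z * exp (L z)) has_field_derivative exp (L 0)) (at 0)" by (auto intro!: derivative_eq_intros)
      hence "(f has_field_derivative exp (L 0)) (at 0)"
        by (rule has_field_derivative_transform_within_open[OF _ open_ball[of 0 1] sD(2)]) (use L in auto)
      thus ?thesis using fD(4) by (simp add: DERIV_imp_deriv)
    qed
    ultimately have "cmod (exp (F 0)) * cmod (f ?s) = s"
      using s by (metis abs_of_pos mult_1 norm_minus_cancel norm_mult norm_of_real)
    thus ?thesis using fs0 by (simp add: field_simps)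
  qed
  moreover have "exp (Re (F ?s)) = cmod (f ?s) / s * (1 - s\<^sup>2) / cmod (deriv f ?s)"
  proof -
    have "exp (F ?s) = exp (L ?s) / deriv f ?s * (1 - ?s * ?s)"
      using F(2)[OF sD(1)] by (simp add: G_def diff_quot_def)
    moreover have "exp (L ?s) = f ?s / ?s" using L(2)[OF sD(1)] s by simp
    moreover have "1 - ?s * ?s = of_real (1 - s\<^sup>2)" by (simp add: power2_eq_square)
    moreover have "cmod (of_real (1 - s\<^sup>2)) = 1 - s\<^sup>2" using s1 by (subst norm_of_real) simp
    ultimately have "cmod (exp (F ?s)) = cmod (f ?s) / s / cmod (deriv f ?s) * (1 - s\<^sup>2)"
      using s by (simp only: norm_mult norm_divide norm_of_real abs_of_pos)
    thus ?thesis by simp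
  qed
  ultimately have "exp d = s\<^sup>2 * cmod (deriv f ?s) / ((cmod (f ?s))\<^sup>2 * (1 - s\<^sup>2))"
    unfolding d_def exp_diff using fs0 ds s by (simp add: power2_eq_square)
  hence dln: "d = ln (s\<^sup>2 * cmod (deriv f ?s) / ((cmod (f ?s))\<^sup>2 * (1 - s\<^sup>2)))" by (metis ln_exp)
  show ?thesis
  proof (intro exI[of _ F] conjI ballI allI)
    show "F holomorphic_on ?D" by (rule F(1))
    show "exp (F z) * (f z - f ?s) = exp (L z) * (z - ?s) * (1 - ?s * z)" if "z \<in> ?D" for z by (rule Feq[OF that])
    fix K
    have "pi * (\<Sum>k=1..K. real k * (cmod (taylor_coeff F k))\<^sup>2) \<le> max 0 (2 * pi * d)"
      by (rule Dirichlet_coefficients[OF F(1) dir[unfolded R_def]]) simp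
    also have "max 0 (2 * pi * d) = pi * max 0 (2 * d)"
      by (simp add: max_mult_distrib_left)
    finally have "(\<Sum>k=1..K. real k * (cmod (taylor_coeff F k))\<^sup>2) \<le> max 0 (2 * d)"
      using pi_gt_zero by (simp only: mult_le_cancel_left_pos)
    thus "(\<Sum>k=1..K. real k * (cmod (taylor_coeff F k))\<^sup>2) \<le> max 0 (2 * ln (s\<^sup>2 * cmod (deriv f ?s) / ((cmod (f ?s))\<^sup>2 * (1 - s\<^sup>2))))"
      by (simp only: dln)
  qed
qed

section \<open>Taylor coefficients of the two-point logarithm\<close>

lemma taylor_coeff_sums:
  assumes "f holomorphic_on ball 0 r" "cmod z < r"
  shows "(\<lambda>k. taylor_coeff f k * z ^ k) sums f z"
  using holomorphic_power_series[OF assms(1), of z] assms(2) by (simp add: taylor_coeff_def)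

lemma taylor_coeff_eqI:
  assumes "r > 0" "\<And>z. cmod z < r \<Longrightarrow> (\<lambda>k. c k * z ^ k) sums f z"
  shows "taylor_coeff f n = c n"
proof -
  have "eventually (\<lambda>z. z \<in> ball (0::complex) r) (nhds 0)" by (intro eventually_nhds_in_open) (use assms in auto)
  hence "f has_fps_expansion Abs_fps c"
    by (intro has_fps_expansionI) (auto elim!: eventually_mono simp: assms(2))
  from fps_nth_fps_expansion[OF this, of n] show ?thesis by (simp add: taylor_coeff_def)
qed

lemma taylor_coeff_fps:
  assumes "f holomorphic_on ball 0 r" "r > 0"
  shows "f has_fps_expansion Abs_fps (taylor_coeff f)"
proof -
  have "eventually (\<lambda>z. z \<in> ball (0::complex) r) (nhds 0)" by (intro eventually_nhds_in_open) (use assms in auto)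
  thus ?thesis
    by (intro has_fps_expansionI) (auto elim!: eventually_mono intro: taylor_coeff_sums[OF assms(1)])
qed

lemma taylor_coeff_deriv: "of_nat (Suc k) * taylor_coeff f (Suc k) = taylor_coeff (deriv f) k"
proof -
  have "fact (Suc k) = (of_nat (Suc k) * fact k :: complex)" by (rule fact_Suc)
  thus ?thesis
    by (simp only: taylor_coeff_def funpow_Suc_right o_apply of_nat_fact) (simp del: of_nat_Suc fact_Suc)
qed

text \<open>Writing z - s = -s (1 - z/s) splits F into L(u z), log (1 - z/s), log (1 - s z) and a
  remainder H with exp H = u s / (f(u s) - f(u z)). On the disc of radius 1/2 the first logarithm is
  defined because s \<ge> 2/3. H is described through its derivative, which is insensitive to the
  branch and is small when f(u s) is large.\<close>

lemma taylor_coeff_decomposition: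
  fixes s :: real
  assumes f: "schlicht f" and L: "L holomorphic_on ball 0 1" "\<And>z. z \<in> ball 0 1 \<Longrightarrow> f z = z * exp (L z)"
    and u: "cmod u = 1" and s: "2 / 3 \<le> s" "s < 1"
    and F: "F holomorphic_on ball 0 1"
    and eq: "\<And>z. z \<in> ball 0 1 \<Longrightarrow> exp (F z) * (cnj u * f (u * z) - cnj u * f (u * of_real s)) = exp (L (u * z)) * (z - of_real s) * (1 - of_real s * z)"
  shows "\<exists>H. H holomorphic_on ball 0 (1/2) \<and>
     (\<forall>z\<in>ball 0 (1/2). deriv H z * (f (u * of_real s) - f (u * z)) = u * deriv f (u * z)) \<and>
     (\<forall>k\<ge>1. taylor_coeff F k = u ^ k * taylor_coeff L k - (1 / of_real s) ^ k / of_nat k - of_real s ^ k / of_nat k + taylor_coeff H k)"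
proof -
  let ?s = "complex_of_real s"
  let ?B = "ball 0 (1/2) :: complex set"
  have us: "u * cnj u = 1" using u by (simp add: complex_norm_square[symmetric])
  have u0: "u \<noteq> 0" using u by auto
  have lin: "(\<lambda>k. - (c ^ k / of_nat k) * z ^ k) sums Ln (1 - c * z)" if "cmod (c * z) < 1" for c z :: complex
    using Ln_series'[of "- (c * z)"] that by (simp add: power_mult_distrib)
  have d1: "cmod (1 / ?s * z) < 1" "cmod (?s * z) < 1" "cmod (u * z) < 1" "z \<in> ball 0 1" if "z \<in> ?B" for z
  proof -
    have z: "cmod z < 1/2" using that by simp
    show "cmod (1 / ?s * z) < 1" using s z by (simp add: norm_mult norm_divide)
    have "s * cmod z \<le> 1 * cmod z" using s by (intro mult_right_mono) auto
    thus "cmod (?s * z) < 1" using z s by (simp add: norm_mult)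
    show "cmod (u * z) < 1" "z \<in> ball 0 1" using z u by (auto simp: norm_mult)
  qed
  have nonpos: "1 - z \<notin> \<real>\<^sub>\<le>\<^sub>0" if "cmod z < 1" for z
  proof
    assume "1 - z \<in> \<real>\<^sub>\<le>\<^sub>0"
    hence "Re (1 - z) \<le> 0" by (auto simp: complex_nonpos_Reals_iff)
    thus False using that complex_Re_le_cmod[of z] by simp
  qed
  define Lu where "Lu = (\<lambda>z. L (u * z))"
  have "L \<circ> (\<lambda>z. u * z) holomorphic_on ball 0 1"
    by (rule holomorphic_on_compose_gen[OF _ L(1)]) (use u in \<open>auto intro!: holomorphic_intros simp: norm_mult\<close>)
  hence Lu: "Lu holomorphic_on ball 0 1" by (simp add: Lu_def o_def)
  define A where "A = (\<lambda>z. Ln (1 - 1 / ?s * z))"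
  define B where "B = (\<lambda>z. Ln (1 - ?s * z))"
  define H where "H = (\<lambda>z. F z - Lu z - A z - B z)"
  have holA: "A holomorphic_on ?B" unfolding A_def
    by (intro holomorphic_intros) (use nonpos d1 s in auto)
  have holB: "B holomorphic_on ?B" unfolding B_def
    by (intro holomorphic_intros) (use nonpos d1 in auto)
  have sub: "?B \<subseteq> ball 0 1" by auto
  have holH: "H holomorphic_on ?B" unfolding H_def
    by (intro holomorphic_intros holA holB holomorphic_on_subset[OF F sub] holomorphic_on_subset[OF Lu sub])
  have expH: "exp (H z) * (f (u * ?s) - f (u * z)) = u * ?s" if z: "z \<in> ?B" for z
  proof -
    have nz: "1 - 1 / ?s * z \<noteq> 0" "1 - ?s * z \<noteq> 0" using d1[OF z] by (metis norm_one order_less_irrefl right_minus_eq)+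
    have "exp (A z) = 1 - 1 / ?s * z" "exp (B z) = 1 - ?s * z" using nz by (simp_all add: A_def B_def)
    hence "exp (H z) = exp (F z) / exp (L (u * z)) / (1 - 1 / ?s * z) / (1 - ?s * z)"
      by (simp add: H_def exp_diff Lu_def)
    hence "exp (H z) * (cnj u * f (u * z) - cnj u * f (u * ?s)) =
        exp (F z) * (cnj u * f (u * z) - cnj u * f (u * ?s)) / exp (L (u * z)) / (1 - 1 / ?s * z) / (1 - ?s * z)"
      by (simp only: times_divide_eq_left)
    also have "\<dots> = (z - ?s) / (1 - 1 / ?s * z)"
      unfolding eq[OF d1(4)[OF z]] using nz by simp
    also have "\<dots> = - ?s"
    proof -
      have "z - ?s = - ?s * (1 - 1 / ?s * z)" using s by (simp add: algebra_simps)
      thus ?thesis using nz by (metis nonzero_mult_div_cancel_right)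
    qed
    finally have "u * (exp (H z) * (cnj u * f (u * z) - cnj u * f (u * ?s))) = u * (- ?s)" by simp
    hence "exp (H z) * ((u * cnj u) * f (u * z) - (u * cnj u) * f (u * ?s)) = u * (- ?s)" by (simp add: algebra_simps)
    thus ?thesis unfolding us by (simp add: algebra_simps)
  qed
  have dH: "deriv H z * (f (u * ?s) - f (u * z)) = u * deriv f (u * z)" if z: "z \<in> ?B" for z
  proof -
    have 1: "(H has_field_derivative deriv H z) (at z)" by (rule holomorphic_derivI[OF holH open_ball z])
    have "u * z \<in> ball 0 1" using d1(3)[OF z] by simp
    hence "(f has_field_derivative deriv f (u * z)) (at (u * z))"
      by (rule holomorphic_derivI[OF schlichtD(1)[OF f] open_ball])
    hence "((\<lambda>z. f (u * z)) has_field_derivative deriv f (u * z) * u) (at z)"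
      by (intro DERIV_chain'[of "\<lambda>z. u * z"]) (auto intro!: derivative_eq_intros)
    with 1 have "((\<lambda>z. exp (H z) * (f (u * ?s) - f (u * z))) has_field_derivative
       exp (H z) * (deriv H z * (f (u * ?s) - f (u * z)) - u * deriv f (u * z))) (at z)"
      by (auto intro!: derivative_eq_intros simp: algebra_simps)
    moreover have "((\<lambda>z. exp (H z) * (f (u * ?s) - f (u * z))) has_field_derivative 0) (at z)"
      by (rule has_field_derivative_transform_within_open[OF DERIV_const open_ball z]) (simp add: expH)
    ultimately have "exp (H z) * (deriv H z * (f (u * ?s) - f (u * z)) - u * deriv f (u * z)) = 0"
      by (rule DERIV_unique)
    thus ?thesis by simp
  qed
  have coef: "taylor_coeff F k = u ^ k * taylor_coeff L k - (1 / ?s) ^ k / of_nat k - ?s ^ k / of_nat k + taylor_coeff H k" if "k \<ge> 1" for k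
  proof -
    have "taylor_coeff F k = taylor_coeff L k * u ^ k + - ((1 / ?s) ^ k / of_nat k) + - (?s ^ k / of_nat k) + taylor_coeff H k"
    proof (rule taylor_coeff_eqI[of "1/2"])
      fix z :: complex assume "cmod z < 1/2"
      hence z: "z \<in> ?B" by simp
      have "(\<lambda>k. taylor_coeff L k * u ^ k * z ^ k + - ((1 / ?s) ^ k / of_nat k) * z ^ k + - (?s ^ k / of_nat k) * z ^ k + taylor_coeff H k * z ^ k)
          sums (Lu z + A z + B z + H z)"
        unfolding A_def B_def Lu_def
        using taylor_coeff_sums[OF L(1) d1(3)[OF z]] lin[OF d1(1)[OF z]] lin[OF d1(2)[OF z]] taylor_coeff_sums[OF holH \<open>cmod z < 1/2\<close>]
        by (intro sums_add) (simp_all add: power_mult_distrib mult.assoc)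
      moreover have "Lu z + A z + B z + H z = F z" by (simp add: H_def)
      ultimately show "(\<lambda>k. (taylor_coeff L k * u ^ k + - ((1 / ?s) ^ k / of_nat k) + - (?s ^ k / of_nat k) + taylor_coeff H k) * z ^ k) sums F z"
        by (simp add: algebra_simps)
    qed simp
    thus ?thesis by (simp add: mult.commute)
  qed
  show ?thesis using holH dH coef by blast
qed

subsection \<open>The Lebedev-Milin inequality\<close>

lemma Lebedev_Milin_step:
  fixes c \<gamma> :: "nat \<Rightarrow> complex"
  assumes rec: "of_nat n * c n = (\<Sum>j=1..n. of_nat j * \<gamma> j * c (n - j))" and n: "n \<ge> 1"
  shows "(real n)\<^sup>2 * (cmod (c n))\<^sup>2 \<le> (\<Sum>j=1..n. (real j * cmod (\<gamma> j))\<^sup>2) * (\<Sum>k<n. (cmod (c k))\<^sup>2)"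
proof -
  have "real n * cmod (c n) = cmod (of_nat n * c n)" by (simp add: norm_mult)
  also have "\<dots> \<le> (\<Sum>j=1..n. cmod (of_nat j * \<gamma> j * c (n - j)))" unfolding rec by (rule norm_sum)
  also have "\<dots> = (\<Sum>j=1..n. (real j * cmod (\<gamma> j)) * cmod (c (n - j)))" by (simp add: norm_mult)
  finally have "(real n * cmod (c n))\<^sup>2 \<le> (\<Sum>j=1..n. (real j * cmod (\<gamma> j)) * cmod (c (n - j)))\<^sup>2"
    by (intro power_mono) auto
  also have "\<dots> \<le> (\<Sum>j=1..n. (real j * cmod (\<gamma> j))\<^sup>2) * (\<Sum>j=1..n. (cmod (c (n - j)))\<^sup>2)"
    by (rule Cauchy_Schwarz_ineq_sum)
  also have "(\<Sum>j=1..n. (cmod (c (n - j)))\<^sup>2) = (\<Sum>k<n. (cmod (c k))\<^sup>2)"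
    by (rule sum.reindex_bij_witness[of _ "\<lambda>k. n - k" "\<lambda>j. n - j"]) auto
  finally show ?thesis by (simp add: power_mult_distrib)
qed

text \<open>The recursion says that c is the exponential of the series with coefficients \<gamma>.
  By Cauchy-Schwarz, B (n+1) \<le> B n * (1 + A n / n^2), and the last factor equals (n+1)/n * (1 +
  t), where t is exactly the increment of the exponent E. The inequality 1 + t \<le> exp t closes
  the induction.\<close>

lemma Lebedev_Milin:
  fixes c \<gamma> :: "nat \<Rightarrow> complex"
  assumes c0: "c 0 = 1" and rec: "\<And>n. n \<ge> 1 \<Longrightarrow> of_nat n * c n = (\<Sum>j=1..n. of_nat j * \<gamma> j * c (n - j))"
    and n: "n \<ge> 1"
  shows "(\<Sum>k<n. (cmod (c k))\<^sup>2) \<le> real n * exp (\<Sum>j=1..<n. (1 - real j / real n) * (real j * (cmod (\<gamma> j))\<^sup>2 - 1 / real j))"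
proof -
  define a where "a = (\<lambda>j. real j * (cmod (\<gamma> j))\<^sup>2 - 1 / real j)"
  define A where "A = (\<lambda>n. \<Sum>j=1..n. (real j * cmod (\<gamma> j))\<^sup>2)"
  define B where "B = (\<lambda>n. \<Sum>k<n. (cmod (c k))\<^sup>2)"
  define E where "E = (\<lambda>n. \<Sum>j=1..<n. (1 - real j / real n) * a j)"
  have step: "E (Suc n) - E n = (A n - real n) / (real n * (real n + 1))" if "n \<ge> 1" for n
  proof -
    have "E (Suc n) = (\<Sum>j=1..<n. (1 - real j / real (Suc n)) * a j) + (1 - real n / real (Suc n)) * a n"
      unfolding E_def using that by (simp add: sum.atLeastLessThan_Suc)
    hence "E (Suc n) - E n = (\<Sum>j=1..<n. (1 - real j / real (Suc n)) * a j - (1 - real j / real n) * a j) + (1 - real n / real (Suc n)) * a n"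
      by (simp add: E_def sum_subtractf)
    also have "(\<Sum>j=1..<n. (1 - real j / real (Suc n)) * a j - (1 - real j / real n) * a j) = (\<Sum>j=1..<n. real j * a j / (real n * (real n + 1)))"
      using that by (intro sum.cong) (auto simp: field_simps)
    also have "(1 - real n / real (Suc n)) * a n = real n * a n / (real n * (real n + 1))"
    proof -
      have "1 - real n / real (Suc n) = 1 / (real n + 1)" by (simp add: field_simps)
      moreover have "real n / (real n * (real n + 1)) = 1 / (real n + 1)" using that by simp
      ultimately have "1 - real n / real (Suc n) = real n / (real n * (real n + 1))" by simp
      thus ?thesis by simp
    qed
    also have "(\<Sum>j=1..<n. real j * a j / (real n * (real n + 1))) + real n * a n / (real n * (real n + 1))
       = (\<Sum>j=1..n. real j * a j) / (real n * (real n + 1))"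
      using that by (simp add: sum_divide_distrib atLeastLessThanSuc_atLeastAtMost[symmetric] sum.atLeastLessThan_Suc add_divide_distrib)
    also have "(\<Sum>j=1..n. real j * a j) = (\<Sum>j=1..n. (real j * cmod (\<gamma> j))\<^sup>2 - 1)"
      by (intro sum.cong) (auto simp: a_def power2_eq_square algebra_simps)
    also have "\<dots> = A n - real n" by (simp add: A_def sum_subtractf)
    finally show ?thesis .
  qed
  have "B n \<le> real n * exp (E n)" using n
  proof (induction n rule: dec_induct)
    case base
    thus ?case using c0 by (simp add: B_def E_def)
  next
    case (step n)
    have n1: "n \<ge> 1" by fact
    have Ln: "(real n)\<^sup>2 * (cmod (c n))\<^sup>2 \<le> A n * B n"
      unfolding A_def B_def by (rule Lebedev_Milin_step[OF rec[OF n1] n1])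
    have B0: "B n \<ge> 0" unfolding B_def by (intro sum_nonneg) auto
    define t where "t = (A n - real n) / (real n * (real n + 1))"
    have At: "A n = real n + t * (real n * (real n + 1))" using n1 by (simp add: t_def)
    have "B (Suc n) = B n + (cmod (c n))\<^sup>2" by (simp add: B_def)
    also have "(cmod (c n))\<^sup>2 \<le> A n * B n / (real n)\<^sup>2" using Ln n1 by (simp add: field_simps)
    also have "B n + A n * B n / (real n)\<^sup>2 = B n * ((real n + 1) / real n * (1 + t))"
      unfolding At using n1 by (simp add: field_simps power2_eq_square)
    also have "\<dots> \<le> B n * ((real n + 1) / real n * exp t)"
      using B0 n1 exp_ge_add_one_self[of t] by (intro mult_left_mono) auto
    also have "\<dots> \<le> (real n * exp (E n)) * ((real n + 1) / real n * exp t)"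
      using step.IH by (intro mult_right_mono) auto
    also have "\<dots> = real (Suc n) * exp (E n + t)" using n1 by (simp add: exp_add field_simps)
    also have "E n + t = E (Suc n)" using \<open>\<And>n. n \<ge> 1 \<Longrightarrow> E (Suc n) - E n = _ n\<close>[OF n1] unfolding t_def by simp
    finally show ?case by simp
  qed
  thus ?thesis by (simp add: B_def E_def a_def)
qed

subsection \<open>Bazilevich's inequality\<close>

text \<open>The decreasing quotient along a ray starts with the value 1 at the origin, because L 0 =
  0.\<close>

lemma growth_le_1:
  assumes f: "schlicht f" and r: "0 < r" "r < 1"
  shows "growth f r \<le> 1"
proof -
  obtain L where L: "L holomorphic_on ball 0 1" "L 0 = 0" "\<And>z. z \<in> ball 0 1 \<Longrightarrow> f z = z * exp (L z)"
    using schlicht_logarithm[OF f] by auto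
  obtain u where u: "cmod u = 1" "cmod (f (of_real r * u)) = max_modulus r f"
    using max_modulus_attained(1)[OF schlicht_continuous_sphere[OF f r(2)] r(1)] by auto
  have "Re (L (of_real r * u)) + 2 * ln (1 - r) \<le> 0"
    using schlicht_growth_antimono[OF f L(1,3) u(1), of 0 r] r L(2) by simp
  moreover have "cmod (f (of_real r * u)) = r * exp (Re (L (of_real r * u)))"
    using L(3)[of "of_real r * u"] u r by (simp add: norm_mult)
  moreover have "exp (2 * ln (1 - r)) = (1 - r)\<^sup>2" using r by (simp add: exp_double)
  ultimately have "growth f r = exp (Re (L (of_real r * u)) + 2 * ln (1 - r))"
    using r u by (simp add: growth_def exp_add)
  thus ?thesis using \<open>Re (L (of_real r * u)) + 2 * ln (1 - r) \<le> 0\<close> by simp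
qed

text \<open>The distortion theorem replaces |g'(s)| by (1 + s) / (1 - s) * |g(s)| / s, after which
  the argument of the logarithm becomes s / ((1 - s)^2 |g(s)|). At a point of maximal modulus this
  is the reciprocal of \<open>growth f s\<close>, hence at most 1/\<alpha>.\<close>

lemma max_modulus_point_bound:
  fixes s :: real
  assumes f: "schlicht f" and L: "L holomorphic_on ball 0 1" "\<And>z. z \<in> ball 0 1 \<Longrightarrow> f z = z * exp (L z)"
    and s: "2 / 3 \<le> s" "s < 1" and u: "cmod u = 1" "cmod (f (of_real s * u)) = max_modulus s f"
    and \<alpha>: "0 < \<alpha>" "\<alpha> \<le> growth f s"
  shows "\<exists>H. H holomorphic_on ball 0 (1/2) \<and>
     (\<forall>z\<in>ball 0 (1/2). deriv H z * (f (u * of_real s) - f (u * z)) = u * deriv f (u * z)) \<and>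
     (\<forall>K. (\<Sum>k=1..K. real k * (cmod (u ^ k * taylor_coeff L k - (1 / of_real s) ^ k / of_nat k - of_real s ^ k / of_nat k + taylor_coeff H k))\<^sup>2)
        \<le> 2 * ln (1 / \<alpha>))"
proof -
  have s0: "0 < s" using s by simp
  let ?s = "complex_of_real s"
  define g where "g = (\<lambda>z. cnj u * f (u * z))"
  have g: "schlicht g" unfolding g_def by (rule schlicht_rotate[OF f u(1)])
  define Lg where "Lg = (\<lambda>z. L (u * z))"
  have uD: "u * z \<in> ball 0 1" if "z \<in> ball 0 1" for z using that u by (simp add: norm_mult)
  have us: "cnj u * u = 1" using u by (simp add: mult.commute complex_norm_square[symmetric])
  have "L \<circ> (\<lambda>z. u * z) holomorphic_on ball 0 1"
    by (rule holomorphic_on_compose_gen[OF _ L(1)]) (use uD in \<open>auto intro!: holomorphic_intros\<close>)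
  hence Lg: "Lg holomorphic_on ball 0 1" by (simp add: Lg_def o_def)
  have Lgeq: "g z = z * exp (Lg z)" if "z \<in> ball 0 1" for z
  proof -
    have "g z = (cnj u * u) * (z * exp (Lg z))" using L(2)[OF uD[OF that]] by (simp add: g_def Lg_def mult_ac)
    thus ?thesis by (simp add: us)
  qed
  obtain F where F: "F holomorphic_on ball 0 1"
     "\<And>z. z \<in> ball 0 1 \<Longrightarrow> exp (F z) * (g z - g ?s) = exp (Lg z) * (z - ?s) * (1 - ?s * z)"
     "\<And>K. (\<Sum>k=1..K. real k * (cmod (taylor_coeff F k))\<^sup>2)
        \<le> max 0 (2 * ln (s\<^sup>2 * cmod (deriv g ?s) / ((cmod (g ?s))\<^sup>2 * (1 - s\<^sup>2))))"
    using two_point_logarithm_bound[OF g s0 s(2) Lg Lgeq] by blast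
  have gs: "cmod (g ?s) = max_modulus s f" using u by (simp add: g_def norm_mult mult.commute)
  have gr: "growth f s = (1 - s)\<^sup>2 * cmod (g ?s) / s" by (simp add: growth_def gs)
  have gpos: "0 < growth f s" by (rule growth_pos[OF f s0 s(2)])
  hence gs0: "cmod (g ?s) > 0" using gr s0 by (metis divide_eq_0_iff mult_zero_right norm_le_zero_iff norm_zero not_less order_less_irrefl)
  have "s * cmod (deriv g ?s) / cmod (g ?s) \<le> (1 + s) / (1 - s)"
    using schlicht_distortion_real[OF g s0 s(2)] s0 by (simp add: norm_mult norm_divide)
  hence d: "s * cmod (deriv g ?s) \<le> (1 + s) / (1 - s) * cmod (g ?s)" using gs0 by (simp add: pos_divide_le_eq)
  have s2: "1 - s\<^sup>2 = (1 - s) * (1 + s)" by (simp add: power2_eq_square algebra_simps)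
  have "s\<^sup>2 * cmod (deriv g ?s) / ((cmod (g ?s))\<^sup>2 * (1 - s\<^sup>2)) = s * (s * cmod (deriv g ?s)) / ((cmod (g ?s))\<^sup>2 * (1 - s\<^sup>2))"
    by (simp add: power2_eq_square)
  also have "\<dots> \<le> s * ((1 + s) / (1 - s) * cmod (g ?s)) / ((cmod (g ?s))\<^sup>2 * (1 - s\<^sup>2))"
    using d s0 s gs0 by (intro divide_right_mono mult_left_mono) (auto simp: s2)
  also have "\<dots> = 1 / growth f s"
    unfolding gr s2 using s0 s gs0 by (simp add: divide_simps power2_eq_square)
  also have "\<dots> \<le> 1 / \<alpha>" using \<alpha> by (simp add: frac_le)
  finally have le: "s\<^sup>2 * cmod (deriv g ?s) / ((cmod (g ?s))\<^sup>2 * (1 - s\<^sup>2)) \<le> 1 / \<alpha>" .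
  have a1: "\<alpha> \<le> 1" using \<alpha>(2) growth_le_1[OF f s0 s(2)] by simp
  have "2 * ln (s\<^sup>2 * cmod (deriv g ?s) / ((cmod (g ?s))\<^sup>2 * (1 - s\<^sup>2))) \<le> 2 * ln (1 / \<alpha>)"
  \<comment> \<open>A vanishing derivative is impossible by univalence, but the convention ln 0 = 0
    settles that case directly.\<close>
  proof (cases "deriv g ?s = 0")
    case False
    hence "0 < s\<^sup>2 * cmod (deriv g ?s) / ((cmod (g ?s))\<^sup>2 * (1 - s\<^sup>2))"
      using s0 s gs0 by (auto simp: s2)
    thus ?thesis using le \<alpha> by (simp add: ln_le_cancel_iff del: ln_le_cancel_iff) (metis ln_mono)
  qed (use a1 \<alpha> in \<open>simp add: ln_div\<close>)
  moreover have "0 \<le> 2 * ln (1 / \<alpha>)" using a1 \<alpha> by simp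
  ultimately have bound: "(\<Sum>k=1..K. real k * (cmod (taylor_coeff F k))\<^sup>2) \<le> 2 * ln (1 / \<alpha>)" for K
    using F(3)[of K] by simp
  obtain H where H: "H holomorphic_on ball 0 (1/2)"
     "\<And>z. z \<in> ball 0 (1/2) \<Longrightarrow> deriv H z * (f (u * ?s) - f (u * z)) = u * deriv f (u * z)"
     "\<And>k. k \<ge> 1 \<Longrightarrow> taylor_coeff F k = u ^ k * taylor_coeff L k - (1 / ?s) ^ k / of_nat k - ?s ^ k / of_nat k + taylor_coeff H k"
    using taylor_coeff_decomposition[OF f L u(1) s F(1)] F(2) unfolding g_def Lg_def by blast
  show ?thesis
  proof (intro exI[of _ H] conjI ballI allI)
    fix K
    show "(\<Sum>k=1..K. real k * (cmod (u ^ k * taylor_coeff L k - (1 / ?s) ^ k / of_nat k - ?s ^ k / of_nat k + taylor_coeff H k))\<^sup>2)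
        \<le> 2 * ln (1 / \<alpha>)"
      using bound[of K] H(3) by simp
  qed (use H in auto)
qed

text \<open>u is a limit point of directions of maximal modulus on circles of radius s n tending to
  1. The lower bound by \<alpha> at radius s n passes to every smaller radius along the same ray by
  monotonicity, hence to the limit direction. As \<alpha> > 0 the maxima tend to infinity, which
  kills the remainders H n, while the terms s^(-k) / k and s^k / k add up to 2 / k.\<close>

theorem Bazilevich:
  assumes f: "schlicht f" and L: "L holomorphic_on ball 0 1" "\<And>z. z \<in> ball 0 1 \<Longrightarrow> f z = z * exp (L z)"
    and \<alpha>: "\<alpha> = hayman_index f" "0 < \<alpha>"
  shows "\<exists>u. cmod u = 1 \<and> (\<forall>r. 0 < r \<and> r < 1 \<longrightarrow> \<alpha> \<le> (1 - r)\<^sup>2 * cmod (f (of_real r * u)) / r) \<and>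
    (\<forall>K. (\<Sum>k=1..K. real k * (cmod (u ^ k * taylor_coeff L k - 2 / of_nat k))\<^sup>2) \<le> 2 * ln (1 / \<alpha>))"
proof -
  \<comment> \<open>Starts at 2/3, as the coefficient decomposition requires, and gives 1 / (1 - s
    n)^2 = (n + 3)^2.\<close>
  define s where "s = (\<lambda>n::nat. 1 - 1 / (real n + 3))"
  have s: "2 / 3 \<le> s n" "s n < 1" "0 < s n" for n by (auto simp: s_def field_simps)
  have s_lim: "s \<longlonglongrightarrow> 1"
  proof -
    have "(\<lambda>n. 1 - 1 / real (n + 3)) \<longlonglongrightarrow> 1 - 0"
      by (intro tendsto_diff tendsto_const LIMSEQ_ignore_initial_segment[OF lim_1_over_n])
    thus ?thesis by (simp add: s_def)
  qed
  have ag: "\<alpha> \<le> growth f (s n)" for n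
    unfolding \<alpha>(1) by (rule growth_tendsto_hayman(2)[OF f s(3,2)])
  have "\<exists>u. cmod u = 1 \<and> cmod (f (of_real (s n) * u)) = max_modulus (s n) f" for n
    by (rule max_modulus_attained(1)[OF schlicht_continuous_sphere[OF f s(2)] s(3)])
  then obtain u where u: "\<And>n. cmod (u n) = 1" "\<And>n. cmod (f (of_real (s n) * u n)) = max_modulus (s n) f" by metis
  define P where "P = (\<lambda>n H. H holomorphic_on ball 0 (1/2) \<and>
     (\<forall>z\<in>ball 0 (1/2). deriv H z * (f (u n * of_real (s n)) - f (u n * z)) = u n * deriv f (u n * z)) \<and>
     (\<forall>K. (\<Sum>k=1..K. real k * (cmod (u n ^ k * taylor_coeff L k - (1 / of_real (s n)) ^ k / of_nat k - of_real (s n) ^ k / of_nat k + taylor_coeff H k))\<^sup>2)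
        \<le> 2 * ln (1 / \<alpha>)))"
  have "\<exists>H. P n H" for n
    unfolding P_def by (rule max_modulus_point_bound[OF f L s(1,2) u \<alpha>(2) ag])
  then obtain H where PH: "\<And>n. P n (H n)" by metis
  have H: "H n holomorphic_on ball 0 (1/2)"
     "\<And>z. z \<in> ball 0 (1/2) \<Longrightarrow> deriv (H n) z * (f (u n * of_real (s n)) - f (u n * z)) = u n * deriv f (u n * z)"
     "\<And>K. (\<Sum>k=1..K. real k * (cmod (u n ^ k * taylor_coeff L k - (1 / of_real (s n)) ^ k / of_nat k - of_real (s n) ^ k / of_nat k + taylor_coeff (H n) k))\<^sup>2)
        \<le> 2 * ln (1 / \<alpha>)" for n
    using PH[of n] unfolding P_def by blast+
  have cb: "\<exists>C. C > 0 \<and> (\<forall>z\<in>cball 0 (1/2). cmod (g z) \<le> C)" if "g holomorphic_on ball 0 1" for g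
  proof -
    have "continuous_on (cball 0 (1/2)) g"
      by (rule continuous_on_subset[OF holomorphic_on_imp_continuous_on[OF that]]) auto
    hence "bounded (g ` cball 0 (1/2))" by (intro compact_imp_bounded compact_continuous_image) auto
    thus ?thesis by (auto simp: bounded_pos)
  qed
  obtain C0 where C0: "C0 > 0" "\<And>z. z \<in> cball 0 (1/2) \<Longrightarrow> cmod (f z) \<le> C0" using cb[OF schlichtD(1)[OF f]] by blast
  obtain C1 where C1: "C1 > 0" "\<And>z. z \<in> cball 0 (1/2) \<Longrightarrow> cmod (deriv f z) \<le> C1"
    using cb[OF holomorphic_deriv[OF schlichtD(1)[OF f]]] by auto
  have w_lower: "\<alpha> * (2 / 3) * (real n + 3)\<^sup>2 \<le> cmod (f (u n * of_real (s n)))" for n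
  proof -
    have "\<alpha> * s n \<le> (1 - s n)\<^sup>2 * cmod (f (u n * of_real (s n)))"
      using ag[of n] s(3)[of n] u(2)[of n] by (simp add: growth_def pos_le_divide_eq mult.commute)
    also have "(1 - s n)\<^sup>2 = 1 / (real n + 3)\<^sup>2" by (simp add: s_def power_one_over)
    finally have "\<alpha> * s n * (real n + 3)\<^sup>2 \<le> cmod (f (u n * of_real (s n)))" by (simp add: field_simps)
    moreover have "\<alpha> * (2 / 3) * (real n + 3)\<^sup>2 \<le> \<alpha> * s n * (real n + 3)\<^sup>2"
      using s(1)[of n] \<alpha>(2) by (intro mult_right_mono mult_left_mono) auto
    ultimately show ?thesis by simp
  qed
  have unif: "uniform_limit (ball 0 (1/2)) (\<lambda>n. deriv (H n)) (\<lambda>_. 0) sequentially"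
  proof (rule uniform_limitI)
    fix e :: real assume e: "e > 0"
    \<comment> \<open>Once |f(u s)| > C0 + C1/e, the denominator f(u s) - f(u z) exceeds C1/e in
      modulus on the half disc, while the numerator is at most C1.\<close>
    obtain N :: nat where N: "(C0 + C1 / e) / (\<alpha> * (2 / 3)) < real N" using reals_Archimedean2 by blast
    have "C0 + C1 / e < \<alpha> * (2 / 3) * (real n + 3)\<^sup>2" if "n \<ge> N" for n
    proof -
      have "real N \<le> (real n + 3) * 1" using that by simp
      also have "\<dots> \<le> (real n + 3)\<^sup>2" unfolding power2_eq_square by (intro mult_left_mono) auto
      finally have "(C0 + C1 / e) / (\<alpha> * (2 / 3)) < (real n + 3)\<^sup>2" using N by simp
      thus ?thesis using \<alpha>(2) by (simp add: pos_divide_less_eq mult.commute)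
    qed
    hence "eventually (\<lambda>n. \<alpha> * (2 / 3) * (real n + 3)\<^sup>2 > C0 + C1 / e) sequentially"
      by (auto simp: eventually_sequentially)
    thus "eventually (\<lambda>n. \<forall>z\<in>ball 0 (1/2). dist (deriv (H n) z) 0 < e) sequentially"
    proof eventually_elim
      case (elim n)
      show ?case
      proof
        fix z :: complex assume z: "z \<in> ball 0 (1/2)"
        let ?w = "f (u n * of_real (s n))"
        have uz: "u n * z \<in> cball 0 (1/2)" using z u(1)[of n] by (simp add: norm_mult)
        have "C0 + C1 / e < cmod ?w" using elim w_lower[of n] by (rule less_le_trans)
        moreover have "cmod ?w - cmod (f (u n * z)) \<le> cmod (?w - f (u n * z))" by (rule norm_triangle_ineq2)
        ultimately have D: "C1 / e < cmod (?w - f (u n * z))" using C0(2)[OF uz] by simp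
        have D0: "0 < cmod (?w - f (u n * z))" using D C1(1) e by (smt (verit) divide_pos_pos)
        have "cmod (deriv (H n) z) * cmod (?w - f (u n * z)) = cmod (deriv f (u n * z))"
          using arg_cong[OF H(2)[OF z, of n], of cmod] u(1)[of n] by (simp add: norm_mult)
        also have "\<dots> \<le> C1" by (rule C1(2)[OF uz])
        also have "\<dots> < e * cmod (?w - f (u n * z))" using D e by (simp add: field_simps)
        finally show "dist (deriv (H n) z) 0 < e" using D0 by simp
      qed
    qed
  qed
  \<comment> \<open>Only the derivatives of H n are known to vanish in the limit, so the constant
    term is excluded.\<close>
  have H0: "(\<lambda>n. taylor_coeff (H n) k) \<longlonglongrightarrow> 0" if k1: "k \<ge> 1" for k
  proof -
    obtain j where j: "k = Suc j" using k1 by (cases k) auto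
    have "(\<lambda>n. (deriv ^^ j) (deriv (H n)) 0) \<longlonglongrightarrow> (deriv ^^ j) (\<lambda>_. 0) 0"
      by (rule higher_deriv_complex_uniform_limit[OF unif]) (auto intro!: always_eventually holomorphic_deriv H)
    moreover have "(deriv ^^ j) (\<lambda>_. 0) 0 = (0 :: complex)" by (induction j) auto
    ultimately have "(\<lambda>n. (deriv ^^ j) (deriv (H n)) 0 / of_nat (fact k)) \<longlonglongrightarrow> 0 / of_nat (fact k)"
      by (intro tendsto_divide tendsto_const) auto
    thus ?thesis by (simp add: taylor_coeff_def j funpow_Suc_right del: funpow.simps)
  qed
  have "compact (sphere (0::complex) 1)" by simp
  then obtain v r where v: "v \<in> sphere 0 1" and r: "strict_mono r" and lim: "(u \<circ> r) \<longlonglongrightarrow> v"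
    using u(1) unfolding compact_def by (metis dist_0_norm mem_sphere)
  have sr: "(\<lambda>n. s (r n)) \<longlonglongrightarrow> 1" using LIMSEQ_subseq_LIMSEQ[OF s_lim r] by (simp add: o_def)
  have ur: "(\<lambda>n. u (r n)) \<longlonglongrightarrow> v" using lim by (simp add: o_def)
  show ?thesis
  proof (intro exI[of _ v] conjI allI impI)
    show "cmod v = 1" using v by simp
    fix t :: real assume t: "0 < t \<and> t < 1"
    have tv: "of_real t * v \<in> ball 0 1" using t v by (simp add: norm_mult)
    have "isCont f (of_real t * v)"
      using holomorphic_on_imp_continuous_on[OF schlichtD(1)[OF f]] tv
      by (simp add: continuous_on_eq_continuous_at)
    hence "(\<lambda>n. f (of_real t * u (r n))) \<longlonglongrightarrow> f (of_real t * v)"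
      by (rule isCont_tendsto_compose) (intro tendsto_intros ur)
    hence "(\<lambda>n. (1 - t)\<^sup>2 * cmod (f (of_real t * u (r n))) / t) \<longlonglongrightarrow> (1 - t)\<^sup>2 * cmod (f (of_real t * v)) / t"
      using t by (intro tendsto_intros) auto
    moreover have "eventually (\<lambda>n. \<alpha> \<le> (1 - t)\<^sup>2 * cmod (f (of_real t * u (r n))) / t) sequentially"
    proof -
      have "eventually (\<lambda>n. s (r n) > t) sequentially" using order_tendstoD(1)[OF sr, of t] t by simp
      thus ?thesis
      proof eventually_elim
        case (elim n)
        have "\<alpha> \<le> (1 - s (r n))\<^sup>2 * cmod (f (of_real (s (r n)) * u (r n))) / s (r n)"
          using ag[of "r n"] u(2)[of "r n"] by (simp add: growth_def)
        also have "\<dots> \<le> (1 - t)\<^sup>2 * cmod (f (of_real t * u (r n))) / t"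
          by (rule schlicht_growth_along_ray[OF f u(1)]) (use t elim s(2)[of "r n"] in auto)
        finally show ?case .
      qed
    qed
    ultimately show "\<alpha> \<le> (1 - t)\<^sup>2 * cmod (f (of_real t * v)) / t"
      by (intro tendsto_lowerbound[where F = sequentially]) auto
  next
    fix K
    have "(\<lambda>n. \<Sum>k=1..K. real k * (cmod (u (r n) ^ k * taylor_coeff L k - (1 / of_real (s (r n))) ^ k / of_nat k - of_real (s (r n)) ^ k / of_nat k + taylor_coeff (H (r n)) k))\<^sup>2)
      \<longlonglongrightarrow> (\<Sum>k=1..K. real k * (cmod (v ^ k * taylor_coeff L k - (1 / of_real 1) ^ k / of_nat k - of_real 1 ^ k / of_nat k + 0))\<^sup>2)"
    proof (intro tendsto_sum tendsto_mult tendsto_const tendsto_power tendsto_norm tendsto_add tendsto_diff tendsto_divide tendsto_of_real sr ur)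
      fix k assume "k \<in> {1..K}"
      thus "(\<lambda>n. taylor_coeff (H (r n)) k) \<longlonglongrightarrow> 0"
        using LIMSEQ_subseq_LIMSEQ[OF H0 r, of k] by (simp add: o_def)
    qed auto
    moreover have "(1 / of_real 1) ^ k / of_nat k = (1::complex) / of_nat k" "of_real 1 ^ k / of_nat k = (1::complex) / of_nat k" for k by simp_all
    moreover have "(v ^ k * taylor_coeff L k - 1 / of_nat k - 1 / of_nat k + 0) = v ^ k * taylor_coeff L k - 2 / of_nat k" for k
      by (simp add: diff_diff_add add_divide_distrib[symmetric])
    ultimately have "(\<lambda>n. \<Sum>k=1..K. real k * (cmod (u (r n) ^ k * taylor_coeff L k - (1 / of_real (s (r n))) ^ k / of_nat k - of_real (s (r n)) ^ k / of_nat k + taylor_coeff (H (r n)) k))\<^sup>2)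
      \<longlonglongrightarrow> (\<Sum>k=1..K. real k * (cmod (v ^ k * taylor_coeff L k - 2 / of_nat k))\<^sup>2)" by simp
    thus "(\<Sum>k=1..K. real k * (cmod (v ^ k * taylor_coeff L k - 2 / of_nat k))\<^sup>2) \<le> 2 * ln (1 / \<alpha>)"
      by (rule tendsto_upperbound) (intro always_eventually allI H(3), rule trivial_limit_sequentially)
  qed
qed

subsection \<open>A Tauberian estimate for Fejer means\<close>

text \<open>The Fejer weight \<open>(1 - x)\<^sub>+\<close> written in the variable \<open>y = exp (- x)\<close>.\<close>

definition fejer_weight :: "real \<Rightarrow> real" where
  "fejer_weight y = (if y \<le> exp (-1) then 0 else 1 + ln y)"

text \<open>The continuous extension of (\<open>fejer_weight y\<close> - y) / (y (1 - y)) to [0, 1].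
  The difference vanishes at both ends, to second order at y = 1, whence the value 0 there.
  Approximating the quotient and not the weight leaves a factor y (1 - y) in the error: it decays
  for large j and is O(j/n) for small j.\<close>

definition fejer_quot :: "real \<Rightarrow> real" where
  "fejer_quot y = (if y = 1 then 0 else if y \<le> exp (-1) then - 1 / (1 - y) else (1 + ln y - y) / (y * (1 - y)))"

lemma fejer_quot_eq:
  assumes "y \<in> {0..1}"
  shows "fejer_weight y - y = y * (1 - y) * fejer_quot y"
proof -
  have e: "exp (-1) < (1::real)" by simp
  show ?thesis
  proof (cases "y = 1")
    case True
    thus ?thesis using e by (simp add: fejer_weight_def not_le)
  next
    case False
    thus ?thesis using assms e exp_gt_zero[of "-1::real"]
      by (auto simp: fejer_weight_def fejer_quot_def)
  qed
qed

lemma continuous_fejer_quot: "continuous_on {0..1} fejer_quot"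
proof -
  let ?e = "exp (-1) :: real"
  have e: "0 < ?e" "?e < 1" by auto
  have 1: "continuous_on {0..?e} fejer_quot"
  proof -
    have "continuous_on {0..?e} (\<lambda>y::real. - 1 / (1 - y))" using e by (intro continuous_intros) auto
    moreover have "fejer_quot y = - 1 / (1 - y)" if "y \<in> {0..?e}" for y using that e by (auto simp: fejer_quot_def)
    ultimately show ?thesis by (metis (no_types, lifting) continuous_on_eq)
  qed
  have 2: "continuous_on {?e..1} fejer_quot"
    unfolding continuous_on_eq_continuous_within
  proof
    fix y assume y: "y \<in> {?e..1}"
    have form: "fejer_quot z = (1 + ln z - z) / (z * (1 - z))" if "z \<in> {?e..1}" for z
    proof (cases "z = ?e")
      case True
      have "(1 + ln z - z) / (z * (1 - z)) = - z / (z * (1 - z))" using True by simp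
      also have "\<dots> = - 1 / (1 - z)" using True e by (simp add: divide_simps)
      finally show ?thesis using True e by (simp add: fejer_quot_def)
    qed (use that in \<open>auto simp: fejer_quot_def\<close>)
    show "continuous (at y within {?e..1}) fejer_quot"
    proof (cases "y = 1")
      case False
      have "continuous (at y within {?e..1}) (\<lambda>z. (1 + ln z - z) / (z * (1 - z)))"
        using y e False by (intro continuous_intros) (auto simp: less_le_trans[OF e(1)] intro: less_le_trans[OF e(1)])
      thus ?thesis
        by (rule continuous_transform_within[OF _ zero_less_one y]) (use form in auto)
    next
      case True
      \<comment> \<open>Squeeze: ln z \<le> z - 1 gives the upper bound 0, and the same inequality
        at 1/z gives the lower bound.\<close>
      have "(fejer_quot \<longlongrightarrow> 0) (at 1 within {?e..1})"
      proof (rule tendsto_sandwich[of "\<lambda>z. - ((1 - z) / (z * z))" _ _ "\<lambda>_. 0"])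
        have ev: "eventually (\<lambda>z. z \<in> {?e..1} \<and> z \<noteq> 1) (at 1 within {?e..1})"
          by (auto simp: eventually_at_filter)
        show "eventually (\<lambda>z. fejer_quot z \<le> 0) (at 1 within {?e..1})"
          using ev
        proof eventually_elim
          case (elim z)
          hence "?e \<le> z" "z < 1" by auto
          hence z: "0 < z" "z < 1" using less_le_trans[OF e(1)] by blast+
          have "ln z \<le> z - 1" by (rule ln_le_minus_one[OF z(1)])
          thus ?case using form[of z] elim z by (simp add: divide_nonpos_pos)
        qed
        show "eventually (\<lambda>z. - ((1 - z) / (z * z)) \<le> fejer_quot z) (at 1 within {?e..1})"
          using ev
        proof eventually_elim
          case (elim z)
          hence "?e \<le> z" "z < 1" by auto
          hence z: "0 < z" "z < 1" using less_le_trans[OF e(1)] by blast+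
          have "ln (1 / z) \<le> 1 / z - 1" using z by (intro ln_le_minus_one) auto
          hence "1 - 1 / z \<le> ln z" using z by (simp add: ln_div)
          hence "- ((1 - z) * (1 - z) / z) \<le> 1 + ln z - z"
            using z by (simp add: field_simps)
          hence "- ((1 - z) * (1 - z) / z) / (z * (1 - z)) \<le> (1 + ln z - z) / (z * (1 - z))"
            using z by (intro divide_right_mono) auto
          moreover have "- ((1 - z) * (1 - z) / z) / (z * (1 - z)) = - ((1 - z) / (z * z))"
            using z by (simp add: divide_simps)
          ultimately show ?case using form[of z] elim by simp
        qed
        have "((\<lambda>z::real. - ((1 - z) / (z * z))) \<longlongrightarrow> - ((1 - 1) / (1 * 1))) (at 1 within {?e..1})"
          by (intro tendsto_intros) auto
        thus "((\<lambda>z::real. - ((1 - z) / (z * z))) \<longlongrightarrow> 0) (at 1 within {?e..1})" by simp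
      qed simp
      moreover have "fejer_quot 1 = 0" by (simp add: fejer_quot_def)
      ultimately show ?thesis using True by (simp add: continuous_within)
    qed
  qed
  have "{0..?e} \<union> {?e..1} = {0..1}" using e by (intro ivl_disj_un_two_touch) auto
  thus ?thesis using continuous_on_closed_Un[OF _ _ 1 2] by simp
qed

lemma polynomial_approximation:
  fixes h :: "real \<Rightarrow> real"
  assumes "continuous_on {0..1} h" "e > 0"
  shows "\<exists>a d. \<forall>y\<in>{0..1}. \<bar>h y - (\<Sum>i\<le>d. a i * y ^ i)\<bar> < e"
proof -
  obtain g where g: "real_polynomial_function g" "\<And>x. x \<in> {0..1} \<Longrightarrow> \<bar>h x - g x\<bar> < e"
    using Stone_Weierstrass_real_polynomial_function[OF compact_Icc assms] by blast
  from g(1) obtain a d where "g = (\<lambda>x. \<Sum>i\<le>d. a i * x ^ i)"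
    unfolding real_polynomial_function_iff_sum by blast
  with g(2) show ?thesis by (intro exI[of _ a] exI[of _ d]) auto
qed

text \<open>One factor (j/n) exp (-j/n) is at most 1; the rest is 1/n times a geometric series with
  sum at most n. This is the second factor in a Cauchy-Schwarz estimate, bounded independently of
  n.\<close>

lemma exp_weight_square_sum:
  assumes n: "n \<ge> (1::nat)"
  shows "(\<Sum>j=1..K. (sqrt (real j) / real n * exp (- real j / real n))\<^sup>2) \<le> 1"
proof -
  define y where "y = exp (- 1 / real n)"
  have y: "0 < y" "y < 1" using n by (auto simp: y_def)
  have yj: "exp (- real j / real n) = y ^ j" for j
    using exp_of_nat_mult[of j "- 1 / real n"] by (simp add: y_def)
  have "(sqrt (real j) / real n * exp (- real j / real n))\<^sup>2 \<le> y ^ j / real n" for j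
  proof -
    have "real j / real n \<le> exp (real j / real n)" using exp_ge_add_one_self[of "real j / real n"] by linarith
    hence "real j / real n * exp (- (real j / real n)) \<le> exp (real j / real n) * exp (- (real j / real n))"
      by (intro mult_right_mono) auto
    hence "real j / real n * exp (- real j / real n) \<le> 1" by (simp add: exp_add[symmetric])
    hence "(real j / real n * exp (- real j / real n)) * (exp (- real j / real n) / real n) \<le> 1 * (exp (- real j / real n) / real n)"
      by (intro mult_right_mono) auto
    moreover have "(sqrt (real j) / real n * exp (- real j / real n))\<^sup>2 = (real j / real n * exp (- real j / real n)) * (exp (- real j / real n) / real n)"
      by (simp add: power_mult_distrib power_divide) (simp add: power2_eq_square)
    ultimately show ?thesis by (simp only: yj[symmetric] mult_1_left)
  qed
  hence "(\<Sum>j=1..K. (sqrt (real j) / real n * exp (- real j / real n))\<^sup>2) \<le> (\<Sum>j=1..K. y ^ j / real n)"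
    by (intro sum_mono)
  also have "\<dots> = (\<Sum>j=1..K. y ^ j) / real n" by (simp add: sum_divide_distrib)
  also have "(\<Sum>j=1..K. y ^ j) \<le> y / (1 - y)"
  proof -
    have "(\<Sum>j=1..K. y ^ j) = y * (\<Sum>j<K. y ^ j)"
      unfolding sum_distrib_left by (rule sum.reindex_bij_witness[of _ Suc "\<lambda>j. j - 1"]) (auto simp flip: power_Suc)
    also have "\<dots> \<le> y * (1 / (1 - y))"
      using y by (intro mult_left_mono) (auto simp: sum_gp_strict divide_right_mono)
    finally show ?thesis by simp
  qed
  also have "y / (1 - y) \<le> real n"
  proof -
    have "1 + 1 / real n \<le> exp (1 / real n)" by (rule exp_ge_add_one_self)
    hence "(1 + 1 / real n) * y \<le> 1" by (simp add: y_def exp_minus field_simps)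
    thus ?thesis using y n by (simp add: field_simps)
  qed
  finally show ?thesis using n by (simp add: divide_right_mono)
qed

text \<open>Karamata's method: approximate the Fejer weight by a polynomial in \<open>exp (- j / n)\<close>. Bounded Dirichlet
  norm makes the error uniformly small without any uniform smallness of the tails of the series.\<close>

lemma fejer_mean_tauberian:
  assumes \<eta>: "\<eta> > 0"
  shows "\<exists>\<delta>>0. \<forall>r0. 0 < r0 \<and> r0 < 1 \<longrightarrow> (\<exists>N. \<forall>n\<ge>N. \<forall>x c A.
     (\<forall>K. (\<Sum>j=1..K. real j * (x j)\<^sup>2) \<le> C) \<longrightarrow>
     (\<forall>r. r0 \<le> r \<and> r < 1 \<longrightarrow> (\<lambda>j. x j * r ^ j) sums A r \<and> \<bar>A r - c\<bar> \<le> \<delta>) \<longrightarrow> x 0 = 0 \<longrightarrow>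
     (\<Sum>j=1..<n. (1 - real j / real n) * x j) \<le> c + \<eta>)"
proof -
  \<comment> \<open>Half of \<eta> pays for the approximation error, at most \<eta>1 * sqrt |C|; the
    other half pays for the Abel means of the polynomial, which determines \<delta> below.\<close>
  define \<eta>1 where "\<eta>1 = \<eta> / (2 * (sqrt \<bar>C\<bar> + 1))"
  have \<eta>1: "\<eta>1 > 0" "\<eta>1 * sqrt \<bar>C\<bar> \<le> \<eta> / 2"
  proof -
    have "0 < sqrt \<bar>C\<bar> + 1" by (simp add: add_nonneg_pos)
    thus "\<eta>1 > 0" "\<eta>1 * sqrt \<bar>C\<bar> \<le> \<eta> / 2" using \<eta> by (auto simp: \<eta>1_def field_simps)
  qed
  obtain a d where ad: "\<And>y. y \<in> {0..1} \<Longrightarrow> \<bar>fejer_quot y - (\<Sum>i\<le>d. a i * y ^ i)\<bar> < \<eta>1"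
    using polynomial_approximation[OF continuous_fejer_quot \<eta>1(1)] by blast
  define Q where "Q = (\<lambda>y::real. \<Sum>i\<le>d. a i * y ^ i)"
  define S where "S = (\<Sum>i\<le>d. \<bar>a i\<bar>)"
  have S: "S \<ge> 0" unfolding S_def by (intro sum_nonneg) auto
  define \<delta> where "\<delta> = \<eta> / (2 * (1 + 2 * S))"
  have \<delta>: "\<delta> > 0" "\<delta> * (1 + 2 * S) = \<eta> / 2" using \<eta> S by (auto simp: \<delta>_def field_simps)
  show ?thesis
  proof (intro exI[of _ \<delta>] conjI allI impI)
    fix r0 :: real assume r0: "0 < r0 \<and> r0 < 1"
    \<comment> \<open>For such n all radii exp (-i/n) with 1 \<le> i \<le> d + 2 lie in [r0, 1). The
      degree d comes from \<eta> and C alone, so the threshold serves all sequences x at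
      once.\<close>
    obtain N :: nat where N: "real (d + 2) / (- ln r0) < real N" using reals_Archimedean2 by blast
    show "\<exists>N. \<forall>n\<ge>N. \<forall>x c A.
     (\<forall>K. (\<Sum>j=1..K. real j * (x j)\<^sup>2) \<le> C) \<longrightarrow>
     (\<forall>r. r0 \<le> r \<and> r < 1 \<longrightarrow> (\<lambda>j. x j * r ^ j) sums A r \<and> \<bar>A r - c\<bar> \<le> \<delta>) \<longrightarrow> x 0 = 0 \<longrightarrow>
     (\<Sum>j=1..<n. (1 - real j / real n) * x j) \<le> c + \<eta>"
    proof (intro exI[of _ "N + 1"] allI impI)
      fix n :: nat and x :: "nat \<Rightarrow> real" and c A
      assume n: "N + 1 \<le> n" and C: "\<forall>K. (\<Sum>j=1..K. real j * (x j)\<^sup>2) \<le> C"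
        and A: "\<forall>r. r0 \<le> r \<and> r < 1 \<longrightarrow> (\<lambda>j. x j * r ^ j) sums A r \<and> \<bar>A r - c\<bar> \<le> \<delta>" and x0: "x 0 = 0"
      have n1: "n \<ge> 1" "real n > 0" using n by auto
      define y where "y = (\<lambda>j::nat. exp (- real j / real n))"
      define R where "R = (\<lambda>i::nat. exp (- real i / real n))"
      have yR: "y j ^ i = R i ^ j" for i j
        unfolding y_def R_def by (simp add: exp_of_nat_mult[symmetric] mult.commute)
      have y01: "y j \<in> {0..1}" for j by (simp add: y_def)
      have R: "r0 \<le> R i" "R i < 1" if "1 \<le> i" "i \<le> d + 2" for i
      proof -
        have "real (d + 2) < real N * (- ln r0)" using N r0 by (subst (asm) pos_divide_less_eq) (auto simp: mult.commute)
        also have "\<dots> \<le> real n * (- ln r0)" using n r0 by (intro mult_right_mono) auto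
        finally have "real i < real n * (- ln r0)" using that by simp
        hence "ln r0 \<le> - real i / real n" using n1 by (simp add: field_simps)
        thus "r0 \<le> R i" unfolding R_def using r0 by (metis exp_le_cancel_iff exp_ln)
        show "R i < 1" using that n1 by (simp add: R_def)
      qed
      have sR: "(\<lambda>j. x j * y j ^ i) sums A (R i)" "\<bar>A (R i) - c\<bar> \<le> \<delta>" if "1 \<le> i" "i \<le> d + 2" for i
        unfolding yR using A R[OF that] by auto
      \<comment> \<open>The polynomial replacing the weight. Its monomials have exponents 1 to d +
        2, and y_j^i = (R i)^j turns each into an Abel sum. Since p(1) = 1, c enters exactly once,
        and in the terms with a i it cancels.\<close>
      define p where "p = (\<lambda>y. y + y * (1 - y) * Q y)"
      define P where "P = A (R 1) + (\<Sum>i\<le>d. a i * (A (R (i + 1)) - A (R (i + 2))))"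
      have sP: "(\<lambda>j. p (y j) * x j) sums P"
      proof -
        have "(\<lambda>j. x j * y j ^ 1 + (\<Sum>i\<le>d. a i * (x j * y j ^ (i + 1) - x j * y j ^ (i + 2)))) sums P"
          unfolding P_def by (intro sums_add sums_sum sums_mult sums_diff sR) auto
        moreover have "x j * y j ^ 1 + (\<Sum>i\<le>d. a i * (x j * y j ^ (i + 1) - x j * y j ^ (i + 2))) = p (y j) * x j" for j
          unfolding p_def Q_def by (simp add: algebra_simps sum_distrib_left sum_distrib_right)
        ultimately show ?thesis by simp
      qed
      have Pc: "\<bar>P - c\<bar> \<le> \<eta> / 2"
      proof -
        have "\<bar>P - c\<bar> = \<bar>(A (R 1) - c) + (\<Sum>i\<le>d. a i * (A (R (i + 1)) - A (R (i + 2))))\<bar>" by (simp add: P_def)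
        also have "\<dots> \<le> \<bar>A (R 1) - c\<bar> + (\<Sum>i\<le>d. \<bar>a i * (A (R (i + 1)) - A (R (i + 2)))\<bar>)"
          by (rule order_trans[OF abs_triangle_ineq]) (intro add_left_mono sum_abs)
        also have "\<dots> \<le> \<delta> + (\<Sum>i\<le>d. \<bar>a i\<bar> * (2 * \<delta>))"
        proof (intro add_mono sum_mono)
          show "\<bar>A (R 1) - c\<bar> \<le> \<delta>" by (rule sR(2)) auto
          fix i assume "i \<in> {..d}"
          hence "\<bar>A (R (i + 1)) - c\<bar> \<le> \<delta>" "\<bar>A (R (i + 2)) - c\<bar> \<le> \<delta>" by (auto intro!: sR(2))
          hence "\<bar>A (R (i + 1)) - A (R (i + 2))\<bar> \<le> 2 * \<delta>" by linarith
          thus "\<bar>a i * (A (R (i + 1)) - A (R (i + 2)))\<bar> \<le> \<bar>a i\<bar> * (2 * \<delta>)"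
            unfolding abs_mult by (intro mult_left_mono) auto
        qed
        also have "\<dots> = \<delta> * (1 + 2 * S)" unfolding S_def sum_distrib_right[symmetric] by (simp add: algebra_simps)
        finally show ?thesis using \<delta>(2) by simp
      qed
      define w where "w = (\<lambda>j. fejer_weight (y j))"
      have w: "w j = (if j < n then 1 - real j / real n else 0)" for j
      proof -
        have "y j \<le> exp (-1) \<longleftrightarrow> n \<le> j" unfolding y_def using n1 by (simp add: field_simps)
        thus ?thesis by (auto simp: w_def fejer_weight_def y_def)
      qed
      have fin: "\<bar>\<Sum>j=1..K. (w j - p (y j)) * x j\<bar> \<le> \<eta> / 2" for K
      proof -
        \<comment> \<open>The factor 1 - y_j \<le> j/n is written as sqrt j * sqrt j / n: one root
          goes to x to form the Dirichlet norm, the other to the weight.\<close>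
        have tm: "\<bar>(w j - p (y j)) * x j\<bar> \<le> \<eta>1 * ((sqrt (real j) * \<bar>x j\<bar>) * (sqrt (real j) / real n * y j))" for j
        proof -
          have "w j - p (y j) = y j * (1 - y j) * (fejer_quot (y j) - Q (y j))"
            using fejer_quot_eq[OF y01] unfolding w_def p_def by (simp add: algebra_simps)
          hence "\<bar>w j - p (y j)\<bar> = y j * (1 - y j) * \<bar>fejer_quot (y j) - Q (y j)\<bar>"
            using y01[of j] by (simp add: abs_mult)
          also have "\<dots> \<le> y j * (real j / real n) * \<eta>1"
          proof (intro mult_mono)
            show "1 - y j \<le> real j / real n" unfolding y_def using exp_ge_add_one_self[of "- real j / real n"] by simp
            show "\<bar>fejer_quot (y j) - Q (y j)\<bar> \<le> \<eta>1" using ad[OF y01[of j]] by (simp add: Q_def)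
          qed (use y01[of j] in auto)
          finally have "\<bar>w j - p (y j)\<bar> * \<bar>x j\<bar> \<le> y j * (real j / real n) * \<eta>1 * \<bar>x j\<bar>"
            by (intro mult_right_mono) auto
          also have "real j = sqrt (real j) * sqrt (real j)" by simp
          finally show ?thesis by (simp add: abs_mult mult_ac)
        qed
        have "\<bar>\<Sum>j=1..K. (w j - p (y j)) * x j\<bar> \<le> (\<Sum>j=1..K. \<bar>(w j - p (y j)) * x j\<bar>)" by (rule sum_abs)
        also have "\<dots> \<le> \<eta>1 * (\<Sum>j=1..K. (sqrt (real j) * \<bar>x j\<bar>) * (sqrt (real j) / real n * y j))"
          unfolding sum_distrib_left by (intro sum_mono tm)
        also have "(\<Sum>j=1..K. (sqrt (real j) * \<bar>x j\<bar>) * (sqrt (real j) / real n * y j)) \<le> sqrt \<bar>C\<bar>"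
        proof (rule real_le_rsqrt)
          have "(\<Sum>j=1..K. (sqrt (real j) * \<bar>x j\<bar>) * (sqrt (real j) / real n * y j))\<^sup>2
             \<le> (\<Sum>j=1..K. (sqrt (real j) * \<bar>x j\<bar>)\<^sup>2) * (\<Sum>j=1..K. (sqrt (real j) / real n * y j)\<^sup>2)"
            by (rule Cauchy_Schwarz_ineq_sum)
          also have "\<dots> \<le> \<bar>C\<bar> * 1"
          proof (intro mult_mono)
            show "(\<Sum>j=1..K. (sqrt (real j) * \<bar>x j\<bar>)\<^sup>2) \<le> \<bar>C\<bar>"
              using C[rule_format, of K] by (simp add: power_mult_distrib)
            show "(\<Sum>j=1..K. (sqrt (real j) / real n * y j)\<^sup>2) \<le> 1"
              unfolding y_def by (rule exp_weight_square_sum[OF n1(1)])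
          qed (auto intro: sum_nonneg)
          finally show "(\<Sum>j=1..K. (sqrt (real j) * \<bar>x j\<bar>) * (sqrt (real j) / real n * y j))\<^sup>2 \<le> \<bar>C\<bar>" by simp
        qed
        finally show ?thesis using \<eta>1 by (smt (verit) mult_left_mono)
      qed
      have "(\<lambda>K. \<Sum>j\<le>K. p (y j) * x j) \<longlonglongrightarrow> P" using sP by (simp add: sums_def_le)
      hence "(\<lambda>K. \<bar>(\<Sum>j=1..<n. (1 - real j / real n) * x j) - (\<Sum>j\<le>K. p (y j) * x j)\<bar>)
         \<longlonglongrightarrow> \<bar>(\<Sum>j=1..<n. (1 - real j / real n) * x j) - P\<bar>"
        by (intro tendsto_intros)
      moreover have "\<bar>(\<Sum>j=1..<n. (1 - real j / real n) * x j) - (\<Sum>j\<le>K. p (y j) * x j)\<bar> \<le> \<eta> / 2" if K: "n \<le> K" for K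
      proof -
        have "(\<Sum>j=1..K. w j * x j) = (\<Sum>j=1..<n. (1 - real j / real n) * x j)"
          by (rule sum.mono_neutral_cong_right) (use K in \<open>auto simp: w\<close>)
        moreover have "(\<Sum>j\<le>K. p (y j) * x j) = (\<Sum>j=1..K. p (y j) * x j)"
          by (rule sum.mono_neutral_right) (auto simp: x0 not_le)
        ultimately show ?thesis using fin[of K] by (simp add: sum_subtractf left_diff_distrib)
      qed
      hence "eventually (\<lambda>K. \<bar>(\<Sum>j=1..<n. (1 - real j / real n) * x j) - (\<Sum>j\<le>K. p (y j) * x j)\<bar> \<le> \<eta> / 2) sequentially"
        by (auto simp: eventually_sequentially)
      ultimately have "\<bar>(\<Sum>j=1..<n. (1 - real j / real n) * x j) - P\<bar> \<le> \<eta> / 2"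
        by (rule tendsto_upperbound) simp
      thus "(\<Sum>j=1..<n. (1 - real j / real n) * x j) \<le> c + \<eta>" using Pc by linarith
    qed
  qed (rule \<delta>(1))
qed

subsection \<open>Coefficient bounds\<close>

text \<open>Compare logarithmic areas for the cut annulus exp a < |z| < r. Its image lies between
  log radii a - \<eta> and ln M, while z f'/f = 1 + z L' has constant coefficient 1, which
  contributes 2 pi (ln r - a) from below. The divergent -a cancels, and then a tends to minus
  infinity.\<close>

lemma logarithmic_area_bound:
  assumes f: "schlicht f" and L: "L holomorphic_on ball 0 1" "L 0 = 0" "\<And>z. z \<in> ball 0 1 \<Longrightarrow> f z = z * exp (L z)"
    and r: "0 < r" "r < 1"
  shows "(\<Sum>k=1..K. real k * (cmod (taylor_coeff L k))\<^sup>2 * r ^ (2 * k)) \<le> 2 * ln (max_modulus r f / r)"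
proof (rule field_le_epsilon)
  fix e :: real assume "e > 0"
  define \<eta> where "\<eta> = e / 2"
  have \<eta>: "\<eta> > 0" using \<open>e > 0\<close> by (simp add: \<eta>_def)
  note fD = schlichtD[OF f]
  have hdL: "deriv L holomorphic_on ball 0 1" by (rule holomorphic_deriv[OF L(1)]) simp
  define M where "M = max_modulus r f"
  have Mr: "cmod (f z) \<le> M" if "cmod z \<le> r" for z
  proof (rule maximum_modulus_frontier[of f "cball 0 r"])
    show "f holomorphic_on interior (cball 0 r)" by (rule holomorphic_on_subset[OF fD(1)]) (use r in auto)
    show "continuous_on (closure (cball 0 r)) f"
      by (rule continuous_on_subset[OF holomorphic_on_imp_continuous_on[OF fD(1)]]) (use r in auto)
    show "cmod (f z) \<le> M" if "z \<in> frontier (cball 0 r)" for z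
      unfolding M_def using that r by (intro max_modulus_attained(2) schlicht_continuous_sphere f) auto
  qed (use that in auto)
  have "f (of_real r) \<noteq> f 0" using inj_onD[OF fD(2), of "of_real r" 0] r by auto
  hence "0 < cmod (f (of_real r))" using fD(3) by simp
  also have "\<dots> \<le> M" by (rule Mr) (use r in simp)
  finally have M0: "M > 0" .
  have "continuous (at 0 within ball 0 1) L"
    using holomorphic_on_imp_continuous_on[OF L(1)] by (auto simp: continuous_on_eq_continuous_within)
  then obtain d where d: "d > 0" "\<And>z. z \<in> ball 0 1 \<Longrightarrow> dist z 0 < d \<Longrightarrow> dist (L z) (L 0) < \<eta>"
    using \<eta> unfolding continuous_within_eps_delta by metis
  obtain e0 where e0: "e0 > 0" "\<And>z. z \<in> ball 0 1 \<Longrightarrow> cmod (f z - f 0) < e0 \<Longrightarrow> cmod (z - 0) < d"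
    using injective_small_imp_near[OF fD(1,2) open_ball _ d(1), of 0] by auto
  define c where "c = (\<lambda>k. if k = 0 then 1 else of_nat k * taylor_coeff L k)"
  define u where "u = (\<lambda>z. 1 + z * deriv L z)"
  have u: "(\<lambda>k. c k * z ^ k) sums u z" if z: "cmod z < 1" for z
  proof -
    have "(\<lambda>k. z * (taylor_coeff (deriv L) k * z ^ k)) sums (z * deriv L z)"
      by (intro sums_mult taylor_coeff_sums[OF hdL z])
    moreover have "z * (taylor_coeff (deriv L) k * z ^ k) = c (Suc k) * z ^ Suc k" for k
      by (simp add: c_def taylor_coeff_deriv[symmetric] del: of_nat_Suc)
    ultimately have "(\<lambda>k. c (Suc k) * z ^ Suc k) sums (u z - c 0 * z ^ 0)" by (simp add: u_def c_def)
    hence "(\<lambda>k. c k * z ^ k) sums (u z - c 0 * z ^ 0 + c 0 * z ^ 0)"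
      using sums_Suc_iff[of "\<lambda>k. c k * z ^ k"] by blast
    thus ?thesis by simp
  qed
  \<comment> \<open>Below ln r, ln e0 and ln M simultaneously, without distinguishing their
    signs.\<close>
  define A where "A = - \<bar>ln e0\<bar> - \<bar>ln M\<bar> - \<bar>ln r\<bar>"
  have key: "(\<Sum>k=1..K. real k * (cmod (taylor_coeff L k))\<^sup>2 * (r ^ (2 * k) - exp (2 * real k * a))) \<le> 2 * (ln (M / r) + \<eta>)"
    if a: "a \<le> A" for a
  proof -
    define X where "X = {t. a < Re t \<and> Re t < ln r \<and> 0 < Im t \<and> Im t < 2 * pi \<and> Im t \<noteq> pi}"
    have oX: "open X" unfolding X_def by (rule open_punctured_strip)
    have lnr: "ln r < 0" using r by simp
    have ar: "a \<le> ln r" "a \<le> ln e0" "a - \<eta> \<le> ln M" using a \<eta> unfolding A_def by linarith+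
    have eD: "exp t \<in> ball 0 1" if "t \<in> X" for t using that lnr by (auto simp: X_def)
    define W where "W = (\<lambda>t. L (exp t))"
    have "L \<circ> exp holomorphic_on X"
      by (rule holomorphic_on_compose_gen[OF _ L(1)]) (use eD in \<open>auto intro: holomorphic_intros\<close>)
    hence holW: "W holomorphic_on X" by (simp add: W_def o_def)
    have Y: "exp (t + W t) = f (exp t)" if "t \<in> X" for t using L(3)[OF eD[OF that]] by (simp add: W_def exp_add)
    have mY: "exp (Re t + Re (W t)) = cmod (f (exp t))" if "t \<in> X" for t
      using arg_cong[OF Y[OF that], of cmod] by simp
    have dW: "1 + deriv W t = u (exp t)" if t: "t \<in> X" for t
    proof -
      have "(W has_field_derivative deriv L (exp t) * exp t) (at t)"
        unfolding W_def by (rule DERIV_chain'[OF DERIV_exp holomorphic_derivI[OF L(1) open_ball eD[OF t]]])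
      thus ?thesis by (simp add: u_def DERIV_imp_deriv mult.commute)
    qed
    have "ennreal (2 * pi * (cmod (c 0))\<^sup>2 * (ln r - a) + pi * (\<Sum>k=1..K. (cmod (c k))\<^sup>2 / k * (exp (2 * real k * ln r) - exp (2 * real k * a))))
      \<le> (\<integral>\<^sup>+t. ennreal ((cmod (u (exp t)))\<^sup>2) * indicator X t \<partial>lborel)"
      by (rule nn_integral_strip_Bessel[OF u ar(1) _ X_def]) (use lnr in auto)
    also have "\<dots> = (\<integral>\<^sup>+t. ennreal ((cmod (1 + deriv W t))\<^sup>2) * indicator X t \<partial>lborel)"
      by (intro nn_integral_cong) (auto simp: indicator_def dW)
    also have "\<dots> \<le> ennreal (2 * pi * (ln M - (a - \<eta>)))"
    proof (rule log_area_le[OF oX holW])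
      show "inj_on (\<lambda>t. exp (t + W t)) X"
      proof (rule inj_onI)
        fix x y assume x: "x \<in> X" and y: "y \<in> X" and "exp (x + W x) = exp (y + W y)"
        hence "f (exp x) = f (exp y)" using Y by simp
        hence "exp x = exp y" using inj_onD[OF fD(2) _ eD[OF x] eD[OF y]] by blast
        moreover have "\<bar>Im x - Im y\<bar> < 2 * pi" using x y unfolding X_def by auto
        ultimately show "x = y" using exp_complex_eqI by blast
      qed
      show "a - \<eta> \<le> Re t + Re (W t)" if t: "t \<in> X" for t
      proof (cases "cmod (f (exp t)) < e0")
        case True
        hence "cmod (exp t - 0) < d" using e0(2)[OF eD[OF t]] fD(3) by simp
        hence "dist (L (exp t)) (L 0) < \<eta>" using d(2)[OF eD[OF t]] by simp
        hence "cmod (W t) < \<eta>" using L(2) by (simp add: W_def)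
        hence "- \<eta> \<le> Re (W t)" using abs_Re_le_cmod[of "W t"] by linarith
        thus ?thesis using t by (auto simp: X_def)
      next
        case False
        hence "e0 \<le> exp (Re t + Re (W t))" using mY[OF t] by simp
        hence "ln e0 \<le> Re t + Re (W t)" using e0(1) by (metis exp_gt_zero ln_exp ln_le_cancel_iff)
        thus ?thesis using ar \<eta> by simp
      qed
      show "Re t + Re (W t) \<le> ln M" if t: "t \<in> X" for t
      proof -
        have "exp (Re t) \<le> exp (ln r)" using t by (auto simp: X_def)
        hence "cmod (exp t) \<le> r" using r by simp
        hence "exp (Re t + Re (W t)) \<le> M" unfolding mY[OF t] by (rule Mr)
        thus ?thesis using M0 by (metis exp_gt_zero ln_exp ln_le_cancel_iff)
      qed
      show "a - \<eta> \<le> ln M" by (rule ar(3))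
    qed
    finally have "2 * pi * (cmod (c 0))\<^sup>2 * (ln r - a) + pi * (\<Sum>k=1..K. (cmod (c k))\<^sup>2 / k * (exp (2 * real k * ln r) - exp (2 * real k * a)))
       \<le> 2 * pi * (ln M - (a - \<eta>))"
      by (subst (asm) ennreal_le_iff) (use ar in auto)
    moreover have "(\<Sum>k=1..K. (cmod (c k))\<^sup>2 / k * (exp (2 * real k * ln r) - exp (2 * real k * a)))
       = (\<Sum>k=1..K. real k * (cmod (taylor_coeff L k))\<^sup>2 * (r ^ (2 * k) - exp (2 * real k * a)))"
    proof (intro sum.cong refl)
      fix k assume "k \<in> {1..K}"
      moreover have "exp (2 * real k * ln r) = r ^ (2 * k)"
        using exp_of_nat_mult[of "2 * k" "ln r"] r by simp
      ultimately show "(cmod (c k))\<^sup>2 / k * (exp (2 * real k * ln r) - exp (2 * real k * a)) = real k * (cmod (taylor_coeff L k))\<^sup>2 * (r ^ (2 * k) - exp (2 * real k * a))"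
        by (simp add: c_def norm_mult power2_eq_square)
    qed
    ultimately have "pi * (2 * (ln r - a) + (\<Sum>k=1..K. real k * (cmod (taylor_coeff L k))\<^sup>2 * (r ^ (2 * k) - exp (2 * real k * a)))) \<le> pi * (2 * (ln M - (a - \<eta>)))"
      by (simp add: c_def algebra_simps)
    hence "2 * (ln r - a) + (\<Sum>k=1..K. real k * (cmod (taylor_coeff L k))\<^sup>2 * (r ^ (2 * k) - exp (2 * real k * a))) \<le> 2 * (ln M - (a - \<eta>))"
      using pi_gt_zero by (simp only: mult_le_cancel_left_pos)
    thus ?thesis using M0 r by (simp add: ln_div algebra_simps)
  qed
  have "((\<lambda>a. \<Sum>k=1..K. real k * (cmod (taylor_coeff L k))\<^sup>2 * (r ^ (2 * k) - exp (2 * real k * a))) \<longlongrightarrow>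
      (\<Sum>k=1..K. real k * (cmod (taylor_coeff L k))\<^sup>2 * r ^ (2 * k))) at_bot"
    by (rule tendsto_exp_weight_sum)
  moreover have "eventually (\<lambda>a. (\<Sum>k=1..K. real k * (cmod (taylor_coeff L k))\<^sup>2 * (r ^ (2 * k) - exp (2 * real k * a))) \<le> 2 * (ln (M / r) + \<eta>)) at_bot"
    using eventually_le_at_bot[of A] by eventually_elim (rule key)
  ultimately have "(\<Sum>k=1..K. real k * (cmod (taylor_coeff L k))\<^sup>2 * r ^ (2 * k)) \<le> 2 * (ln (M / r) + \<eta>)"
    by (rule tendsto_upperbound) simp
  thus "(\<Sum>k=1..K. real k * (cmod (taylor_coeff L k))\<^sup>2 * r ^ (2 * k)) \<le> 2 * ln (max_modulus r f / r) + e"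
    by (simp add: M_def \<eta>_def)
qed

text \<open>With E = exp (L/2) one has f = z E^2, so a_n is a convolution of the coefficients of E,
  and |x y| \<le> (|x|^2 + |y|^2) / 2 bounds it by the sum of |c k|^2 over k < n. The recursion for
  c is the coefficient form of E' = L' E / 2.\<close>

lemma schlicht_coefficient_Lebedev_Milin:
  assumes f: "schlicht f" and L: "L holomorphic_on ball 0 1" "L 0 = 0" "\<And>z. z \<in> ball 0 1 \<Longrightarrow> f z = z * exp (L z)"
    and n: "n \<ge> 1"
  shows "cmod (taylor_coeff f n) / real n \<le> exp (\<Sum>j=1..<n. (1 - real j / real n) * (real j * (cmod (taylor_coeff L j / 2))\<^sup>2 - 1 / real j))"
proof -
  define E where "E = (\<lambda>z. exp (L z / 2))"
  have holE: "E holomorphic_on ball 0 1" unfolding E_def by (intro holomorphic_intros L(1)) auto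
  define c where "c = taylor_coeff E"
  have fE: "E has_fps_expansion Abs_fps c" unfolding c_def by (rule taylor_coeff_fps[OF holE]) simp
  have ev: "eventually (\<lambda>z. z \<in> ball (0::complex) 1) (nhds 0)" by (intro eventually_nhds_in_open) auto
  have c0: "c 0 = 1" by (simp add: c_def taylor_coeff_def E_def L(2))
  have rec: "of_nat m * c m = (\<Sum>j=1..m. of_nat j * (taylor_coeff L j / 2) * c (m - j))" if m: "m \<ge> 1" for m
  proof -
    obtain k where k: "m = Suc k" using m by (metis Suc_le_D One_nat_def)
    have hL: "L has_fps_expansion Abs_fps (taylor_coeff L)" by (rule taylor_coeff_fps[OF L(1)]) simp
    have a: "deriv E has_fps_expansion fps_deriv (Abs_fps c)" by (rule has_fps_expansion_deriv[OF fE])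
    have "(\<lambda>z. deriv L z * E z) has_fps_expansion fps_deriv (Abs_fps (taylor_coeff L)) * Abs_fps c"
      by (intro has_fps_expansion_mult has_fps_expansion_deriv hL fE)
    hence b: "(\<lambda>z. (1/2) * (deriv L z * E z)) has_fps_expansion fps_const (1/2) * (fps_deriv (Abs_fps (taylor_coeff L)) * Abs_fps c)"
      by (rule has_fps_expansion_cmult_left)
    have e: "eventually (\<lambda>z. deriv E z = (1/2) * (deriv L z * E z)) (nhds 0)"
      using ev
    proof eventually_elim
      case (elim z)
      have "(E has_field_derivative exp (L z / 2) * (deriv L z / 2)) (at z)"
        unfolding E_def by (auto intro!: derivative_eq_intros holomorphic_derivI[OF L(1) open_ball elim])
      thus ?case by (simp add: DERIV_imp_deriv E_def)
    qed
    have "fps_deriv (Abs_fps c) = fps_const (1/2) * (fps_deriv (Abs_fps (taylor_coeff L)) * Abs_fps c)"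
      by (rule fps_expansion_unique_complex[OF a has_fps_expansion_cong[OF e refl, THEN iffD2, OF b]])
    from arg_cong[OF this, of "\<lambda>F. fps_nth F k"]
    have "of_nat (Suc k) * c (Suc k) = (1/2) * (\<Sum>i\<le>k. of_nat (Suc i) * taylor_coeff L (Suc i) * c (k - i))"
      unfolding fps_mult_left_const_nth by (simp add: fps_mult_nth atLeast0AtMost del: of_nat_Suc)
    also have "\<dots> = (\<Sum>i\<le>k. of_nat (Suc i) * (taylor_coeff L (Suc i) / 2) * c (k - i))"
      by (simp add: sum_distrib_left del: of_nat_Suc)
    also have "\<dots> = (\<Sum>j=1..m. of_nat j * (taylor_coeff L j / 2) * c (m - j))"
      unfolding k by (rule sum.reindex_bij_witness[of _ "\<lambda>j. j - 1" Suc]) auto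
    finally show ?thesis unfolding k .
  qed
  have b: "(\<lambda>z. z * (E z * E z)) has_fps_expansion fps_X * (Abs_fps c * Abs_fps c)"
    by (intro has_fps_expansion_mult has_fps_expansion_fps_X fE)
  have e: "eventually (\<lambda>z. f z = z * (E z * E z)) (nhds 0)"
    using ev by eventually_elim (simp add: L(3) E_def exp_add[symmetric])
  have "f has_fps_expansion fps_X * (Abs_fps c * Abs_fps c)"
    by (rule has_fps_expansion_cong[OF e refl, THEN iffD2, OF b])
  from fps_nth_fps_expansion[OF this, of n]
  have "taylor_coeff f n = (\<Sum>i\<le>n - 1. c i * c (n - 1 - i))"
    using n unfolding fps_X_mult_nth by (simp add: taylor_coeff_def fps_mult_nth atLeast0AtMost)
  hence "cmod (taylor_coeff f n) \<le> (\<Sum>i\<le>n - 1. cmod (c i) * cmod (c (n - 1 - i)))"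
    using norm_sum[of "\<lambda>i. c i * c (n - 1 - i)" "{..n - 1}"] by (simp add: norm_mult)
  also have "\<dots> \<le> (\<Sum>i\<le>n - 1. ((cmod (c i))\<^sup>2 + (cmod (c (n - 1 - i)))\<^sup>2) / 2)"
  proof (intro sum_mono)
    fix i
    have "0 \<le> (cmod (c i) - cmod (c (n - 1 - i)))\<^sup>2" by simp
    thus "cmod (c i) * cmod (c (n - 1 - i)) \<le> ((cmod (c i))\<^sup>2 + (cmod (c (n - 1 - i)))\<^sup>2) / 2"
      by (simp add: power2_eq_square algebra_simps)
  qed
  also have "\<dots> = ((\<Sum>i\<le>n - 1. (cmod (c i))\<^sup>2) + (\<Sum>i\<le>n - 1. (cmod (c (n - 1 - i)))\<^sup>2)) / 2"
    by (simp add: sum_divide_distrib[symmetric] sum.distrib)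
  also have "(\<Sum>i\<le>n - 1. (cmod (c (n - 1 - i)))\<^sup>2) = (\<Sum>i\<le>n - 1. (cmod (c i))\<^sup>2)"
    by (rule sum.reindex_bij_witness[of _ "\<lambda>i. n - 1 - i" "\<lambda>i. n - 1 - i"]) auto
  also have "{..n - 1} = {..<n}" using n by auto
  also have "((\<Sum>i<n. (cmod (c i))\<^sup>2) + (\<Sum>i<n. (cmod (c i))\<^sup>2)) / 2 = (\<Sum>k<n. (cmod (c k))\<^sup>2)" by simp
  also have "\<dots> \<le> real n * exp (\<Sum>j=1..<n. (1 - real j / real n) * (real j * (cmod (taylor_coeff L j / 2))\<^sup>2 - 1 / real j))"
    by (rule Lebedev_Milin[OF c0 rec n])
  finally show ?thesis using n by (simp add: field_simps)
qed

text \<open>The radius is chosen so that r^(2 j) = exp (-j/n) dominates the Fejer weight 1 - j/n.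
  The area bound then yields ln (growth) / 2 - ln (1 - r), and -ln (1 - r) \<le> ln n + ln 3 is
  balanced by the subtracted harmonic sum, at least ln n - 1. The slack ln 3 + 1 gives the constant
  3 e.\<close>

lemma coefficient_growth_bound:
  assumes f: "schlicht f" and n: "n \<ge> 1"
  shows "cmod (taylor_coeff f n) / real n \<le> 3 * exp 1 * sqrt (growth f (exp (- 1 / (2 * real n))))"
proof -
  obtain L where L: "L holomorphic_on ball 0 1" "L 0 = 0" "\<And>z. z \<in> ball 0 1 \<Longrightarrow> f z = z * exp (L z)"
    using schlicht_logarithm[OF f] by auto
  define r where "r = exp (- 1 / (2 * real n))"
  have n0: "real n > 0" using n by simp
  have r: "0 < r" "r < 1" using n0 by (auto simp: r_def)
  define l where "l = (\<lambda>j. real j * (cmod (taylor_coeff L j))\<^sup>2)"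
  have split: "(\<Sum>j=1..<n. (1 - real j / real n) * (real j * (cmod (taylor_coeff L j / 2))\<^sup>2 - 1 / real j))
     = (\<Sum>j=1..<n. (1 - real j / real n) * l j) / 4 - (\<Sum>j=1..<n. (1 - real j / real n) / real j)"
    unfolding sum_divide_distrib sum_subtractf[symmetric]
    by (intro sum.cong) (auto simp: l_def norm_divide power_divide field_simps)
  have "(\<Sum>j=1..<n. (1 - real j / real n) * l j) \<le> (\<Sum>j=1..<n. l j * r ^ (2 * j))"
  proof (intro sum_mono)
    fix j
    have "r ^ (2 * j) = exp (- real j / real n)"
      unfolding r_def using n0 by (simp add: exp_of_nat_mult[symmetric] field_simps)
    hence "1 - real j / real n \<le> r ^ (2 * j)" using exp_ge_add_one_self[of "- real j / real n"] by simp
    thus "(1 - real j / real n) * l j \<le> l j * r ^ (2 * j)"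
      by (subst mult.commute, intro mult_left_mono) (auto simp: l_def)
  qed
  also have "\<dots> = (\<Sum>k=1..n-1. real k * (cmod (taylor_coeff L k))\<^sup>2 * r ^ (2 * k))"
    by (intro sum.cong) (auto simp: l_def)
  also have "\<dots> \<le> 2 * ln (max_modulus r f / r)" by (rule logarithmic_area_bound[OF f L r])
  also have "max_modulus r f / r = growth f r / (1 - r)\<^sup>2" using r by (simp add: growth_def)
  also have "ln (growth f r / (1 - r)\<^sup>2) = ln (growth f r) - 2 * ln (1 - r)"
    using growth_pos[OF f r] r by (simp add: ln_div ln_realpow)
  finally have 1: "(\<Sum>j=1..<n. (1 - real j / real n) * l j) / 4 \<le> ln (growth f r) / 2 - ln (1 - r)" by simp
  have "1 / (3 * real n) \<le> 1 - r"
  proof -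
    have "1 + 1 / (2 * real n) \<le> exp (1 / (2 * real n))" by (rule exp_ge_add_one_self)
    hence "(1 + 1 / (2 * real n)) * r \<le> exp (1 / (2 * real n)) * r" using r by (intro mult_right_mono) auto
    also have "\<dots> = 1" by (simp add: r_def exp_add[symmetric])
    finally have "r \<le> 2 * real n / (2 * real n + 1)" using n0 by (simp add: field_simps)
    also have "\<dots> \<le> 1 - 1 / (3 * real n)" using n by (simp add: field_simps)
    finally show ?thesis by simp
  qed
  hence "ln (1 / (3 * real n)) \<le> ln (1 - r)" using r n0 by (intro ln_mono) auto
  hence 2: "- ln (1 - r) \<le> ln 3 + ln (real n)" using n0 by (simp add: ln_div ln_mult)
  have 3: "ln (real n) - 1 \<le> (\<Sum>j=1..<n. (1 - real j / real n) / real j)"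
  proof -
    have "(\<Sum>j=1..<n. (1 - real j / real n) / real j) = (\<Sum>j=1..<n. 1 / real j) - (\<Sum>j=1..<n. 1 / real n)"
      unfolding sum_subtractf[symmetric] by (intro sum.cong) (auto simp: field_simps)
    also have "(\<Sum>j=1..<n. 1 / real n) = (real n - 1) / real n" using n by (simp add: of_nat_diff)
    also have "(\<Sum>j=1..<n. 1 / real j) = harm (n - 1)"
      unfolding harm_def by (intro sum.cong) (auto simp: inverse_eq_divide)
    finally have "(\<Sum>j=1..<n. (1 - real j / real n) / real j) = harm (n - 1) - (real n - 1) / real n" .
    moreover have "(real n - 1) / real n \<le> 1" using n0 by simp
    ultimately have "(\<Sum>j=1..<n. (1 - real j / real n) / real j) \<ge> harm (n - 1) - 1" by linarith
    moreover have "ln (real n) \<le> harm (n - 1)"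
    proof -
      have "ln (real (n - 1) + 1) \<le> harm (n - 1)" by (rule ln_le_harm)
      thus ?thesis using n by (simp add: of_nat_diff)
    qed
    ultimately show ?thesis by linarith
  qed
  have "cmod (taylor_coeff f n) / real n \<le> exp (\<Sum>j=1..<n. (1 - real j / real n) * (real j * (cmod (taylor_coeff L j / 2))\<^sup>2 - 1 / real j))"
    by (rule schlicht_coefficient_Lebedev_Milin[OF f L n])
  also have "\<dots> \<le> exp (ln (growth f r) / 2 + ln 3 + 1)"
    unfolding split using 1 2 3 by simp
  also have "\<dots> = 3 * exp 1 * sqrt (growth f r)"
    using growth_pos[OF f r] by (simp add: exp_add powr_half_sqrt[symmetric] powr_def)
  finally show ?thesis by (simp add: r_def)
qed

text \<open>The exponent in the Lebedev-Milin bound is \<open>\<Sum> w\<^sub>j (j |\<delta>\<^sub>j|\<^sup>2 + 2 Re \<delta>\<^sub>j)\<close>. Bazilevich's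
  inequality bounds the first part by \<open>ln (1 / \<alpha>) / 2\<close>; the second is a Fejer mean of a series whose
  Abel means are close to \<open>ln \<alpha> / 2\<close>, which gives \<open>ln \<alpha> / 2\<close> in total.\<close>

lemma coefficient_bound_uniform:
  assumes \<eta>: "\<eta> > 0" and \<alpha>0: "\<alpha>0 > 0"
  shows "\<exists>\<delta>>0. \<forall>r0. 0 < r0 \<and> r0 < 1 \<longrightarrow> (\<exists>N. \<forall>n\<ge>N. \<forall>f. schlicht f \<longrightarrow> \<alpha>0 \<le> hayman_index f \<longrightarrow>
     growth f r0 \<le> hayman_index f * exp (2 * \<delta>) \<longrightarrow>
     cmod (taylor_coeff f n) / real n \<le> sqrt (hayman_index f) * exp (2 * \<eta>))"
proof -
  \<comment> \<open>One Dirichlet bound for all functions with index at least \<alpha>0; this is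
    what makes N independent of f.\<close>
  define C where "C = ln (1 / \<alpha>0) / 2"
  obtain \<delta> where \<delta>: "\<delta> > 0" and T: "\<And>r0. 0 < r0 \<and> r0 < 1 \<Longrightarrow> \<exists>N. \<forall>n\<ge>N. \<forall>x c A.
     (\<forall>K. (\<Sum>j=1..K. real j * (x j)\<^sup>2) \<le> C) \<longrightarrow>
     (\<forall>r. r0 \<le> r \<and> r < 1 \<longrightarrow> (\<lambda>j. x j * r ^ j) sums A r \<and> \<bar>A r - c\<bar> \<le> \<delta>) \<longrightarrow> x 0 = 0 \<longrightarrow>
     (\<Sum>j=1..<n. (1 - real j / real n) * x j) \<le> c + \<eta>"
    using fejer_mean_tauberian[OF \<eta>, of C] by blast
  show ?thesis
  proof (intro exI[of _ \<delta>] conjI allI impI)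
    fix r0 :: real assume r0: "0 < r0 \<and> r0 < 1"
    obtain N where N: "\<And>n x c A. n \<ge> N \<Longrightarrow> (\<forall>K. (\<Sum>j=1..K. real j * (x j)\<^sup>2) \<le> C) \<Longrightarrow>
     (\<forall>r. r0 \<le> r \<and> r < 1 \<longrightarrow> (\<lambda>j. x j * r ^ j) sums A r \<and> \<bar>A r - c\<bar> \<le> \<delta>) \<Longrightarrow> x 0 = 0 \<Longrightarrow>
     (\<Sum>j=1..<n. (1 - real j / real n) * x j) \<le> c + \<eta>"
      using T[OF r0] by blast
    show "\<exists>N. \<forall>n\<ge>N. \<forall>f. schlicht f \<longrightarrow> \<alpha>0 \<le> hayman_index f \<longrightarrow>
     growth f r0 \<le> hayman_index f * exp (2 * \<delta>) \<longrightarrow>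
     cmod (taylor_coeff f n) / real n \<le> sqrt (hayman_index f) * exp (2 * \<eta>)"
    proof (intro exI[of _ "N + 1"] allI impI)
      fix n f assume n: "N + 1 \<le> n" and f: "schlicht f" and \<alpha>_ge: "\<alpha>0 \<le> hayman_index f"
        and gr: "growth f r0 \<le> hayman_index f * exp (2 * \<delta>)"
      define \<alpha> where "\<alpha> = hayman_index f"
      have \<alpha>: "\<alpha> > 0" using \<alpha>0 \<alpha>_ge by (simp add: \<alpha>_def)
      have n1: "n \<ge> 1" using n by simp
      obtain L where L: "L holomorphic_on ball 0 1" "L 0 = 0" "\<And>z. z \<in> ball 0 1 \<Longrightarrow> f z = z * exp (L z)"
        using schlicht_logarithm[OF f] by auto
      obtain u where u: "cmod u = 1" "\<And>r. 0 < r \<Longrightarrow> r < 1 \<Longrightarrow> \<alpha> \<le> (1 - r)\<^sup>2 * cmod (f (of_real r * u)) / r"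
        and B: "\<And>K. (\<Sum>k=1..K. real k * (cmod (u ^ k * taylor_coeff L k - 2 / of_nat k))\<^sup>2) \<le> 2 * ln (1 / \<alpha>)"
        using Bazilevich[OF f L(1,3) \<alpha>_def \<alpha>] by blast
      define d where "d = (\<lambda>k. (u ^ k * taylor_coeff L k - 2 / of_nat k) / 2)"
      have dB: "(\<Sum>k=1..K. real k * (cmod (d k))\<^sup>2) \<le> ln (1 / \<alpha>) / 2" for K
      proof -
        have "(\<Sum>k=1..K. real k * (cmod (d k))\<^sup>2) = (\<Sum>k=1..K. real k * (cmod (u ^ k * taylor_coeff L k - 2 / of_nat k))\<^sup>2) / 4"
          unfolding sum_divide_distrib by (intro sum.cong) (auto simp: d_def norm_divide power_divide)
        thus ?thesis using B[of K] by simp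
      qed
      define x where "x = (\<lambda>k. Re (d k))"
      \<comment> \<open>Half the logarithm of |f(r u)| (1 - r)^2 / r; as -2 ln (1 - r) is the sum of
        2 r^k / k, this is the Abel sum of x.\<close>
      define A where "A = (\<lambda>r::real. (Re (L (of_real r * u)) + 2 * ln (1 - r)) / 2)"
      have "(\<Sum>j=1..<n. (1 - real j / real n) * x j) \<le> ln \<alpha> / 2 + \<eta>"
      proof (rule N[where A = A])
        show "n \<ge> N" using n by simp
        show "\<forall>K. (\<Sum>j=1..K. real j * (x j)\<^sup>2) \<le> C"
        proof
          fix K
          have "(\<Sum>j=1..K. real j * (x j)\<^sup>2) \<le> (\<Sum>k=1..K. real k * (cmod (d k))\<^sup>2)"
            by (intro sum_mono mult_left_mono) (auto simp: x_def cmod_power2)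
          also have "\<dots> \<le> ln (1 / \<alpha>) / 2" by (rule dB)
          also have "\<dots> \<le> C" unfolding C_def using \<alpha> \<alpha>0 \<alpha>_ge by (simp add: \<alpha>_def ln_div)
          finally show "(\<Sum>j=1..K. real j * (x j)\<^sup>2) \<le> C" .
        qed
        show "x 0 = 0" by (simp add: x_def d_def taylor_coeff_def L(2))
        show "\<forall>r. r0 \<le> r \<and> r < 1 \<longrightarrow> (\<lambda>j. x j * r ^ j) sums A r \<and> \<bar>A r - ln \<alpha> / 2\<bar> \<le> \<delta>"
        proof (intro allI impI conjI)
          fix r :: real assume rr: "r0 \<le> r \<and> r < 1"
          hence r: "0 < r" "r < 1" using r0 by auto
          have ru: "cmod (of_real r * u) < 1" using r u by (simp add: norm_mult)
          have "(\<lambda>k. Re (taylor_coeff L k * (of_real r * u) ^ k)) sums Re (L (of_real r * u))"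
            by (intro sums_Re taylor_coeff_sums[OF L(1) ru])
          moreover have "(\<lambda>k. 2 * (- (r ^ k) / real k)) sums (2 * ln (1 - r))"
            using sums_mult[OF ln_series'[of "- r"], of 2] r by simp
          ultimately have "(\<lambda>k. (Re (taylor_coeff L k * (of_real r * u) ^ k) + 2 * (- (r ^ k) / real k)) / 2) sums A r"
            unfolding A_def by (intro sums_divide sums_add)
          moreover have "(Re (taylor_coeff L k * (of_real r * u) ^ k) + 2 * (- (r ^ k) / real k)) / 2 = x k * r ^ k" for k
          proof -
            have "taylor_coeff L k * (of_real r * u) ^ k = of_real (r ^ k) * (u ^ k * taylor_coeff L k)"
              by (simp add: power_mult_distrib mult_ac)
            hence "Re (taylor_coeff L k * (of_real r * u) ^ k) = Re (of_real (r ^ k) * (u ^ k * taylor_coeff L k))"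
              by (rule arg_cong)
            also have "\<dots> = r ^ k * Re (u ^ k * taylor_coeff L k)"
              by (simp only: times_complex.sel(1)[of "of_real (r ^ k)"] Re_complex_of_real Im_complex_of_real mult_zero_left diff_0_right)
            finally have "Re (taylor_coeff L k * (of_real r * u) ^ k) = r ^ k * Re (u ^ k * taylor_coeff L k)" .
            moreover have "x k = (Re (u ^ k * taylor_coeff L k) - 2 / real k) / 2"
            proof -
              have "d k = (u ^ k * taylor_coeff L k - of_real (2 / real k)) / of_real 2" by (simp add: d_def)
              thus ?thesis unfolding x_def by (simp only: Re_divide_of_real minus_complex.sel Re_complex_of_real)
            qed
            \<comment> \<open>Stated for all b to include the index k = 0, where both quotients by
              zero are 0.\<close>
            moreover have "(a * q + 2 * (- a / b)) / 2 = (q - 2 / b) / 2 * a" for a b q :: real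
              by (cases "b = 0") (simp_all add: field_simps)
            ultimately show ?thesis by (simp only:)
          qed
          ultimately show "(\<lambda>j. x j * r ^ j) sums A r" by simp
          \<comment> \<open>Control at the single radius r0 suffices for all r \<ge> r0: from below
            by the choice of u, from above because \<open>growth\<close> decreases.\<close>
          define G where "G = (1 - r)\<^sup>2 * cmod (f (of_real r * u)) / r"
          have "exp (2 * A r) = G"
          proof -
            have "cmod (f (of_real r * u)) = r * exp (Re (L (of_real r * u)))"
              using L(3)[of "of_real r * u"] ru r u by (simp add: norm_mult)
            moreover have "exp (2 * ln (1 - r)) = (1 - r)\<^sup>2" using r by (simp add: exp_double)
            moreover have "2 * A r = Re (L (of_real r * u)) + 2 * ln (1 - r)" by (simp add: A_def)
            ultimately show ?thesis using r by (simp only: G_def exp_add) simp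
          qed
          moreover have "\<alpha> \<le> G" unfolding G_def by (rule u(2)[OF r])
          moreover have "G \<le> \<alpha> * exp (2 * \<delta>)"
          proof -
            have "G \<le> growth f r" unfolding G_def by (rule growth_ray_le[OF f r u(1)])
            also have "\<dots> \<le> growth f r0" by (rule growth_antimono[OF f]) (use rr r0 in auto)
            finally show ?thesis using gr by (simp add: \<alpha>_def)
          qed
          ultimately have "exp (ln \<alpha>) \<le> exp (2 * A r)" "exp (2 * A r) \<le> exp (ln \<alpha> + 2 * \<delta>)"
            using \<alpha> by (auto simp: exp_add)
          thus "\<bar>A r - ln \<alpha> / 2\<bar> \<le> \<delta>" unfolding exp_le_cancel_iff using \<delta> by linarith
        qed
      qed
      moreover have "(\<Sum>j=1..<n. (1 - real j / real n) * (real j * (cmod (taylor_coeff L j / 2))\<^sup>2 - 1 / real j))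
         = (\<Sum>j=1..<n. (1 - real j / real n) * (real j * (cmod (d j))\<^sup>2)) + 2 * (\<Sum>j=1..<n. (1 - real j / real n) * x j)"
      proof -
        have "real j * (cmod (taylor_coeff L j / 2))\<^sup>2 - 1 / real j = real j * (cmod (d j))\<^sup>2 + 2 * x j" if j: "j \<ge> 1" for j
        proof -
          have "cmod (taylor_coeff L j / 2) = cmod (u ^ j * (taylor_coeff L j / 2))"
            using u(1) by (simp add: norm_mult norm_power)
          also have "u ^ j * (taylor_coeff L j / 2) = of_real (1 / real j) + d j" by (simp add: d_def diff_divide_distrib)
          finally have "(cmod (taylor_coeff L j / 2))\<^sup>2 = (1 / real j)\<^sup>2 + 2 * (1 / real j * x j) + (cmod (d j))\<^sup>2"
            unfolding x_def by (simp only: cmod_add_squared) (simp add: norm_divide)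
          thus ?thesis using j by (simp add: field_simps power2_eq_square)
        qed
        hence "(\<Sum>j=1..<n. (1 - real j / real n) * (real j * (cmod (taylor_coeff L j / 2))\<^sup>2 - 1 / real j))
          = (\<Sum>j=1..<n. (1 - real j / real n) * (real j * (cmod (d j))\<^sup>2) + 2 * ((1 - real j / real n) * x j))"
          by (intro sum.cong) (auto simp: algebra_simps)
        thus ?thesis by (simp add: sum.distrib sum_distrib_left)
      qed
      moreover have "(\<Sum>j=1..<n. (1 - real j / real n) * (real j * (cmod (d j))\<^sup>2)) \<le> ln (1 / \<alpha>) / 2"
      proof -
        have "(\<Sum>j=1..<n. (1 - real j / real n) * (real j * (cmod (d j))\<^sup>2)) \<le> (\<Sum>j=1..<n. 1 * (real j * (cmod (d j))\<^sup>2))"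
          by (intro sum_mono mult_right_mono) auto
        also have "\<dots> \<le> (\<Sum>k=1..n. real k * (cmod (d k))\<^sup>2)"
          unfolding mult_1_left by (intro sum_mono2) auto
        also have "\<dots> \<le> ln (1 / \<alpha>) / 2" by (rule dB)
        finally show ?thesis .
      qed
      ultimately have "(\<Sum>j=1..<n. (1 - real j / real n) * (real j * (cmod (taylor_coeff L j / 2))\<^sup>2 - 1 / real j)) \<le> ln \<alpha> / 2 + 2 * \<eta>"
        using \<alpha> by (simp add: ln_div)
      hence "cmod (taylor_coeff f n) / real n \<le> exp (ln \<alpha> / 2 + 2 * \<eta>)"
        using schlicht_coefficient_Lebedev_Milin[OF f L n1] by (meson exp_le_cancel_iff order_trans)
      also have "\<dots> = sqrt \<alpha> * exp (2 * \<eta>)" using \<alpha> by (simp add: exp_add powr_half_sqrt[symmetric] powr_def)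
      finally show "cmod (taylor_coeff f n) / real n \<le> sqrt (hayman_index f) * exp (2 * \<eta>)" by (simp add: \<alpha>_def)
    qed
  qed (rule \<delta>)
qed

section \<open>Uniformity along a convergent sequence\<close>

theorem theorem1:
  fixes fs :: "nat \<Rightarrow> complex \<Rightarrow> complex" and f :: "complex \<Rightarrow> complex" and \<epsilon> :: real
  assumes "\<And>m. schlicht (fs m)"
    and "schlicht f"
    and "\<epsilon> > 0"
    and "\<And>K. compact K \<Longrightarrow> K \<subseteq> ball 0 1 \<Longrightarrow> uniform_limit K fs f sequentially"
    and "(\<lambda>m. hayman_index (fs m)) \<longlonglongrightarrow> hayman_index f"
  shows "\<exists>N::nat. \<forall>m n. m > N \<and> n > N \<longrightarrow>
           norm (taylor_coeff (fs m) n) / real n < \<epsilon> + sqrt (hayman_index (fs m))"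
proof -
  have growth_lim: "(\<lambda>m. growth (fs m) r) \<longlonglongrightarrow> growth f r" if r: "0 < r" "r < 1" for r
    unfolding growth_def
    by (intro tendsto_divide tendsto_mult tendsto_const max_modulus_tendsto schlicht_continuous_sphere assms r)
       (use r in auto)
  have near: "\<exists>r0. 0 < r0 \<and> r0 < 1 \<and> growth f r0 < b" if b: "hayman_index f < b" for b
  proof -
    have "eventually (\<lambda>r. growth f r < b) (at_left 1)"
      by (rule order_tendstoD(2)[OF growth_tendsto_hayman(1)[OF assms(2)] b])
    moreover have "eventually (\<lambda>r. 0 < r \<and> r < 1) (at_left (1::real))"
      by (auto simp: eventually_at_left_field intro: exI[of _ 0])
    ultimately have "eventually (\<lambda>r. 0 < r \<and> r < 1 \<and> growth f r < b) (at_left 1)" by eventually_elim auto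
    thus ?thesis using eventually_happens'[of "at_left (1::real)"] by force
  qed
  have sq0: "0 \<le> sqrt (hayman_index (fs m))" for m
    using growth_tendsto_hayman(3)[OF assms(1)] by simp
  show ?thesis
  proof (cases "hayman_index f = 0")
    case True
    \<comment> \<open>Chosen so that 3 * exp 1 * sqrt b = \<epsilon>, matching the constant of
      \<open>coefficient_growth_bound\<close>.\<close>
    define b where "b = (\<epsilon> / (3 * exp 1))\<^sup>2"
    have b: "b > 0" using assms(3) by (simp add: b_def)
    obtain r0 where r0: "0 < r0" "r0 < 1" "growth f r0 < b" using near[of b] b True by auto
    obtain N1 where N1: "\<And>m. m \<ge> N1 \<Longrightarrow> growth (fs m) r0 < b"
      using order_tendstoD(2)[OF growth_lim[OF r0(1,2)] r0(3)] by (auto simp: eventually_sequentially)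
    \<comment> \<open>Ensures exp (-1 / (2 n)) \<ge> r0, so that the growth at this n-dependent
      radius is controlled by its value at the fixed r0, for all large m at once.\<close>
    obtain N2 :: nat where N2: "1 / (- 2 * ln r0) < real N2" using reals_Archimedean2 by blast
    show ?thesis
    proof (intro exI[of _ "max N1 N2"] allI impI)
      fix m n assume mn: "max N1 N2 < m \<and> max N1 N2 < n"
      hence n: "n \<ge> 1" "real n > 0" by auto
      define r where "r = exp (- 1 / (2 * real n))"
      have r: "0 < r" "r < 1" using n by (auto simp: r_def)
      have "1 / (- 2 * ln r0) < real n" using N2 mn by (simp add: max_def split: if_splits)
      hence "1 < real n * (- 2 * ln r0)" using r0 by (subst (asm) pos_divide_less_eq) auto
      hence "ln r0 \<le> - 1 / (2 * real n)" using n by (simp add: field_simps)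
      hence "r0 \<le> r" unfolding r_def using r0 by (metis exp_le_cancel_iff exp_ln)
      hence "growth (fs m) r \<le> growth (fs m) r0" using growth_antimono[OF assms(1) r0(1)] r by blast
      also have "\<dots> < b" by (rule N1) (use mn in auto)
      finally have "sqrt (growth (fs m) r) < sqrt b" by simp
      also have "sqrt b = \<epsilon> / (3 * exp 1)" using assms(3) by (simp add: b_def)
      finally have "3 * exp 1 * sqrt (growth (fs m) r) < \<epsilon>" by (simp add: field_simps)
      moreover have "norm (taylor_coeff (fs m) n) / real n \<le> 3 * exp 1 * sqrt (growth (fs m) r)"
        unfolding r_def by (rule coefficient_growth_bound[OF assms(1) n(1)])
      ultimately show "norm (taylor_coeff (fs m) n) / real n < \<epsilon> + sqrt (hayman_index (fs m))"
        using sq0[of m] by linarith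
    qed
  next
    case False
    define \<alpha> where "\<alpha> = hayman_index f"
    have \<alpha>: "\<alpha> > 0" using False growth_tendsto_hayman(3)[OF assms(2)] by (simp add: \<alpha>_def)
    \<comment> \<open>Turns the factor exp (2 \<eta>) into 1 + \<epsilon>/2; the relative error
      becomes an absolute one because the indices are at most 1.\<close>
    define \<eta> where "\<eta> = ln (1 + \<epsilon> / 2) / 2"
    have \<eta>: "\<eta> > 0" "exp (2 * \<eta>) = 1 + \<epsilon> / 2" using assms(3) by (auto simp: \<eta>_def)
    have \<alpha>2: "\<alpha> / 2 > 0" using \<alpha> by simp
    obtain \<delta> where \<delta>: "\<delta> > 0" and key: "\<And>r0. 0 < r0 \<and> r0 < 1 \<Longrightarrow> \<exists>N. \<forall>n\<ge>N. \<forall>f. schlicht f \<longrightarrow> \<alpha> / 2 \<le> hayman_index f \<longrightarrow>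
     growth f r0 \<le> hayman_index f * exp (2 * \<delta>) \<longrightarrow>
     cmod (taylor_coeff f n) / real n \<le> sqrt (hayman_index f) * exp (2 * \<eta>)"
      using coefficient_bound_uniform[OF \<eta>(1) \<alpha>2] by blast
    \<comment> \<open>The allowed factor exp (2 \<delta>) is shared equally: one exp \<delta> for
      the growth of f_m at r0 against \<alpha>, the other for \<alpha> against \<alpha>_m.\<close>
    have "\<alpha> * 1 < \<alpha> * exp \<delta>" using \<alpha> \<delta> by (intro mult_strict_left_mono) auto
    then obtain r0 where r0: "0 < r0" "r0 < 1" "growth f r0 < \<alpha> * exp \<delta>" using near[of "\<alpha> * exp \<delta>"] by (auto simp: \<alpha>_def)
    obtain N1 where N1: "\<And>m. m \<ge> N1 \<Longrightarrow> growth (fs m) r0 < \<alpha> * exp \<delta>"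
      using order_tendstoD(2)[OF growth_lim[OF r0(1,2)] r0(3)] by (auto simp: eventually_sequentially)
    have "\<alpha> * exp (- \<delta>) < \<alpha> * 1" using \<alpha> \<delta> by (intro mult_strict_left_mono) auto
    hence "max (\<alpha> / 2) (\<alpha> * exp (- \<delta>)) < hayman_index f" using \<alpha> by (simp add: \<alpha>_def)
    from order_tendstoD(1)[OF assms(5) this]
    obtain N2 where N2: "\<And>m. m \<ge> N2 \<Longrightarrow> max (\<alpha> / 2) (\<alpha> * exp (- \<delta>)) < hayman_index (fs m)"
      by (auto simp: eventually_sequentially)
    obtain N3 where N3: "\<And>n f. n \<ge> N3 \<Longrightarrow> schlicht f \<Longrightarrow> \<alpha> / 2 \<le> hayman_index f \<Longrightarrow>
     growth f r0 \<le> hayman_index f * exp (2 * \<delta>) \<Longrightarrow>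
     cmod (taylor_coeff f n) / real n \<le> sqrt (hayman_index f) * exp (2 * \<eta>)"
      using key r0 by blast
    show ?thesis
    proof (intro exI[of _ "N1 + N2 + N3"] allI impI)
      fix m n assume mn: "N1 + N2 + N3 < m \<and> N1 + N2 + N3 < n"
      define \<alpha>m where "\<alpha>m = hayman_index (fs m)"
      have am: "\<alpha> / 2 \<le> \<alpha>m" "\<alpha> * exp (- \<delta>) < \<alpha>m" using N2[of m] mn by (auto simp: \<alpha>m_def)
      have am1: "\<alpha>m \<le> 1"
        unfolding \<alpha>m_def using growth_tendsto_hayman(2)[OF assms(1) r0(1,2)] growth_le_1[OF assms(1) r0(1,2)] order_trans by blast
      have "growth (fs m) r0 \<le> \<alpha> * exp \<delta>" using N1[of m] mn by simp
      also have "\<dots> = (\<alpha> * exp (- \<delta>)) * exp (2 * \<delta>)" by (simp add: exp_add[symmetric])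
      also have "\<dots> \<le> \<alpha>m * exp (2 * \<delta>)" using am(2) by (intro mult_right_mono) auto
      finally have g: "growth (fs m) r0 \<le> hayman_index (fs m) * exp (2 * \<delta>)" by (simp add: \<alpha>m_def)
      have "norm (taylor_coeff (fs m) n) / real n \<le> sqrt (hayman_index (fs m)) * exp (2 * \<eta>)"
        by (rule N3[OF _ assms(1) _ g]) (use mn am in \<open>auto simp: \<alpha>m_def\<close>)
      also have "\<dots> = sqrt \<alpha>m + sqrt \<alpha>m * (\<epsilon> / 2)" unfolding \<eta>(2) \<alpha>m_def by (simp add: algebra_simps)
      also have "sqrt \<alpha>m * (\<epsilon> / 2) \<le> 1 * (\<epsilon> / 2)" using am1 assms(3) by (intro mult_right_mono) auto
      also have "sqrt \<alpha>m + 1 * (\<epsilon> / 2) < \<epsilon> + sqrt \<alpha>m" using assms(3) by simp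
      finally show "norm (taylor_coeff (fs m) n) / real n < \<epsilon> + sqrt (hayman_index (fs m))" by (simp add: \<alpha>m_def)
    qed
  qed
qed

end
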